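(* Suppose the SCC fails. Then there exists $\varepsilon>0$ such that, for all $\sigma,\delta\ge 1$, there is an algorithm that solves every $n$-vertex instance of Triangle Packing given with a $(\sigma,\delta)$-hub of size $p$ in time $(2-\varepsilon)^p\cdot n^{\mathcal{O}(1)}$.
   Context: For a graph $G$, a set $Q\subseteq V(G)$ is a $(\sigma,\delta)$-hub if every connected component of $G-Q$ has at most $\sigma$ vertices and is adjacent to at most $\delta$ vertices of $Q$. Triangle Packing: given a graph $G$ and an integer $t$, decide whether $G$ contains at least $t$ pairwise vertex-disjoint triangles. $\le d$-Set Cover: given a universe $U$, a family $\mathcal{F}$ of subsets of $U$ of size at most $d$ with $\bigcup\mathcal{F}=U$, and an integer $t$, decide whether at most $t$ sets of $\mathcal{F}$ cover $U$. SCC: for all $\epsilon>0$ there is $d\ge1$ such that no algorithm solves every $\le d$-Set Cover instance in time $(2-\epsilon)^{|U|}|U|^{\mathcal{O}(1)}$. *)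

theory Defs
  imports Complex_Main
begin

section \<open>Model of computation\<close>

text \<open>
  Algorithms are programs of a strict untyped functional language over cons cells, in de Bruijn
  notation.  Inside the body of a function, index 0 is the argument and index 1 is the function
  itself, which provides recursion; inside the second branch of a \<^verbatim>\<open>Case\<close>, index 0 is the head and
  index 1 the tail of the cell.  Every evaluation step has unit cost, and for a fixed program each
  step is a constant number of pointer operations, so a random access machine simulates the
  language with constant overhead (in memory cell operations).  Conversely the language simulates
  \<open>T\<close> steps of such a machine with overhead polylogarithmic in \<open>T\<close>, by storing the memory as a
  balanced tree.  For running times of the form \<open>c\<^sup>k \<cdot> n\<^bsup>O(1)\<^esup>\<close> with \<open>k \<le> n\<close> these factors
  are absorbed by \<open>n\<^bsup>O(1)\<^esup>\<close>.
\<close>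

datatype expr =
    Var nat
  | Fun expr
  | App expr expr
  | Empty
  | Cell expr expr
  | Case expr expr expr

datatype val =
    VEmpty
  | VCell val val
  | VClos "val list" expr

text \<open>\<open>eval env e v k\<close>: in environment \<open>env\<close>, \<open>e\<close> terminates with value \<open>v\<close> after \<open>k\<close> steps.\<close>

inductive eval :: "val list \<Rightarrow> expr \<Rightarrow> val \<Rightarrow> nat \<Rightarrow> bool" where
  eval_Var: "i < length env \<Longrightarrow> eval env (Var i) (env ! i) 1"
| eval_Fun: "eval env (Fun e) (VClos env e) 1"
| eval_App: "\<lbrakk>eval env e1 (VClos env' e) k1; eval env e2 u k2;
              eval (u # VClos env' e # env') e v k3\<rbrakk>
             \<Longrightarrow> eval env (App e1 e2) v (k1 + k2 + k3 + 1)"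
| eval_Empty: "eval env Empty VEmpty 1"
| eval_Cell: "\<lbrakk>eval env e1 v1 k1; eval env e2 v2 k2\<rbrakk>
              \<Longrightarrow> eval env (Cell e1 e2) (VCell v1 v2) (k1 + k2 + 1)"
| eval_Case_Empty: "\<lbrakk>eval env e VEmpty k1; eval env e1 v k2\<rbrakk>
              \<Longrightarrow> eval env (Case e e1 e2) v (k1 + k2 + 1)"
| eval_Case_Cell: "\<lbrakk>eval env e (VCell x y) k1; eval (x # y # env) e2 v k2\<rbrakk>
              \<Longrightarrow> eval env (Case e e1 e2) v (k1 + k2 + 1)"

lemma eval_deterministic:
  "eval env e v k \<Longrightarrow> eval env e v' k' \<Longrightarrow> v' = v \<and> k' = k"
proof (induction arbitrary: v' k' rule: eval.induct)
  case (eval_App env e1 env' e k1 e2 u k2 v k3)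
  from eval_App.prems show ?case
    by (cases rule: eval.cases) (use eval_App.IH in \<open>(blast | fastforce)+\<close>)
next
  case (eval_Cell env e1 v1 k1 e2 v2 k2)
  from eval_Cell.prems show ?case
    by (cases rule: eval.cases) (use eval_Cell.IH in \<open>(blast | fastforce)+\<close>)
next
  case (eval_Case_Empty env e k1 e1 v k2 e2)
  from eval_Case_Empty.prems show ?case
    by (cases rule: eval.cases) (use eval_Case_Empty.IH in \<open>(blast | fastforce)+\<close>)
next
  case (eval_Case_Cell env e x y k1 e2 v k2 e1)
  from eval_Case_Cell.prems show ?case
    by (cases rule: eval.cases) (use eval_Case_Cell.IH in \<open>(blast | fastforce)+\<close>)
qed (auto elim: eval.cases)

section \<open>Encoding of inputs\<close>

text \<open>
  Numbers are encoded in unary.  All elements of a universe or vertex set \<open>{..<n}\<close> are smaller than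
  \<open>n\<close>, and running times are measured in \<open>n\<close> up to factors \<open>n\<^bsup>O(1)\<^esup>\<close>, so this costs only a
  polynomial factor; a threshold exceeding \<open>n\<close> can be recognised without reading it completely.
\<close>

fun enc_list :: "val list \<Rightarrow> val" where
  "enc_list [] = VEmpty"
| "enc_list (v # vs) = VCell v (enc_list vs)"

definition enc_nat :: "nat \<Rightarrow> val" where
  "enc_nat n = enc_list (replicate n VEmpty)"

definition enc_bool :: "bool \<Rightarrow> val" where
  "enc_bool b = (if b then VCell VEmpty VEmpty else VEmpty)"

definition enc_int :: "int \<Rightarrow> val" where
  "enc_int i = VCell (enc_bool (i < 0)) (enc_nat (nat \<bar>i\<bar>))"

definition enc_nats :: "nat list \<Rightarrow> val" where
  "enc_nats xs = enc_list (map enc_nat xs)"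

definition enc_natss :: "nat list list \<Rightarrow> val" where
  "enc_natss xss = enc_list (map enc_nats xss)"

text \<open>
  A finite set is presented by listing its elements, and a finite family of sets by listing its
  members, in arbitrary order but without repetition.
\<close>

definition lists_set :: "'a list \<Rightarrow> 'a set \<Rightarrow> bool" where
  "lists_set xs A \<longleftrightarrow> distinct xs \<and> set xs = A"

definition lists_family :: "'a list list \<Rightarrow> 'a set set \<Rightarrow> bool" where
  "lists_family xss F \<longleftrightarrow> (\<forall>xs \<in> set xss. distinct xs) \<and> lists_set (map set xss) F"

text \<open>A program is an expression whose only free index, 0, is bound to the input.\<close>

definition decides_within :: "expr \<Rightarrow> val \<Rightarrow> bool \<Rightarrow> real \<Rightarrow> bool" where
  "decides_within A x b T \<longleftrightarrow> (\<exists>k. eval [x] A (enc_bool b) k \<and> real k \<le> T)"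

section \<open>Set Cover with sets of bounded size\<close>

definition set_cover_instance :: "nat \<Rightarrow> 'a set \<Rightarrow> 'a set set \<Rightarrow> bool" where
  "set_cover_instance d U F \<longleftrightarrow>
     finite U \<and> (\<forall>S \<in> F. S \<subseteq> U \<and> card S \<le> d) \<and> \<Union>F = U"

definition has_set_cover :: "'a set \<Rightarrow> 'a set set \<Rightarrow> int \<Rightarrow> bool" where
  "has_set_cover U F t \<longleftrightarrow> (\<exists>S \<subseteq> F. \<Union>S = U \<and> int (card S) \<le> t)"

definition solves_set_cover :: "nat \<Rightarrow> expr \<Rightarrow> (nat \<Rightarrow> real) \<Rightarrow> bool" where
  "solves_set_cover d A T \<longleftrightarrow>
     (\<forall>m F t Fs. set_cover_instance d {..<m} F \<longrightarrow> lists_family Fs F \<longrightarrow>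
        decides_within A (enc_list [enc_nat m, enc_natss Fs, enc_int t])
          (has_set_cover {..<m} F t) (T m))"

text \<open>
  A factor \<open>n\<^bsup>O(1)\<^esup>\<close> is rendered as \<open>C \<cdot> (n + 1)\<^sup>c\<close>, so that the bound does not collapse to 0
  for \<open>n = 0\<close>.
\<close>

definition SCC :: bool where
  "SCC \<longleftrightarrow>
     (\<forall>\<epsilon>::real > 0. \<exists>d \<ge> 1.
        \<not> (\<exists>A (C::real) (c::nat). solves_set_cover d A (\<lambda>m. (2 - \<epsilon>) ^ m * (C * (real m + 1) ^ c))))"

section \<open>Graphs, hubs and Triangle Packing\<close>

text \<open>Finite simple undirected graphs, with edges as two-element vertex sets.\<close>

definition simple_graph :: "'a set \<Rightarrow> 'a set set \<Rightarrow> bool" where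
  "simple_graph V E \<longleftrightarrow> finite V \<and> (\<forall>e \<in> E. e \<subseteq> V \<and> card e = 2)"

definition connected_in :: "'a set \<Rightarrow> 'a set set \<Rightarrow> ('a \<times> 'a) set" where
  "connected_in V E = {(u, v). u \<in> V \<and> v \<in> V \<and> (u, v) \<in> {(x, y). {x, y} \<in> E}\<^sup>*}"

definition components :: "'a set \<Rightarrow> 'a set set \<Rightarrow> 'a set set" where
  "components V E = V // connected_in V E"

definition hub :: "nat \<Rightarrow> nat \<Rightarrow> 'a set \<Rightarrow> 'a set set \<Rightarrow> 'a set \<Rightarrow> bool" where
  "hub \<sigma> \<delta> V E Q \<longleftrightarrow> Q \<subseteq> V \<and>
     (\<forall>K \<in> components (V - Q) {e \<in> E. e \<inter> Q = {}}.
        card K \<le> \<sigma> \<and> card {q \<in> Q. \<exists>x \<in> K. {q, x} \<in> E} \<le> \<delta>)"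

definition triangles :: "'a set \<Rightarrow> 'a set set \<Rightarrow> 'a set set" where
  "triangles V E = {T. T \<subseteq> V \<and> card T = 3 \<and> (\<forall>x \<in> T. \<forall>y \<in> T. x \<noteq> y \<longrightarrow> {x, y} \<in> E)}"

definition has_triangle_packing :: "'a set \<Rightarrow> 'a set set \<Rightarrow> int \<Rightarrow> bool" where
  "has_triangle_packing V E t \<longleftrightarrow>
     (\<exists>P \<subseteq> triangles V E. pairwise disjnt P \<and> t \<le> int (card P))"

text \<open>
  The time bound depends on the number of vertices and the size of the hub, and the hub is part of
  the input.
\<close>

definition solves_triangle_packing_hub ::
    "nat \<Rightarrow> nat \<Rightarrow> expr \<Rightarrow> (nat \<Rightarrow> nat \<Rightarrow> real) \<Rightarrow> bool" where
  "solves_triangle_packing_hub \<sigma> \<delta> A T \<longleftrightarrow>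
     (\<forall>n E t Q Es Qs. simple_graph {..<n} E \<longrightarrow> hub \<sigma> \<delta> {..<n} E Q \<longrightarrow>
        lists_family Es E \<longrightarrow> lists_set Qs Q \<longrightarrow>
        decides_within A (enc_list [enc_nat n, enc_natss Es, enc_int t, enc_nats Qs])
          (has_triangle_packing {..<n} E t) (T n (card Q)))"

end

theory Submission
  imports Defs
begin

text \<open>
  Let \<open>Q\<close> be the hub and \<open>p\<close> its size.  Put two triangles in the same class if they meet the same
  component of \<open>G - Q\<close> and have the same key, the set of hub vertices that belong to the triangle or are adjacent
  to that component.  Then different classes share hub vertices only, keys have at most \<open>\<delta> + 3\<close> elements,
  and the number of triangles in a class is bounded.  The keys are hashed into \<open>r = p div g + 1\<close>
  buckets by a pairwise independent family of quasi-polynomial size.  For every packing some hash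
  function has few collisions, so that the triangles in overfull buckets occupy at most \<open>p div h\<close>
  hub vertices; these triangles are found by dynamic programming over the small subsets \<open>T\<close> of the hub.

  For each remaining bucket \<open>j\<close> one guesses how many hub vertices it occupies and how many triangles it
  gains.  Every hub subset \<open>S\<close> of bounded size that realises the guess becomes a set
  \<open>S \<union> {p + j, p + r + j}\<close>.  Together with all singletons and the budget \<open>r + |T|\<close> this is an instance of
  Set Cover with sets of bounded size and \<open>p + 2r\<close> elements: a pair of tokens is too expensive to be
  covered by singletons, so each bucket contributes exactly one set.

  Numbers of hash functions, of guesses and of small subsets, and \<open>2\<^sup>2\<^sup>r\<close>, are all at most
  \<open>C \<cdot> \<rho>\<^sup>p\<close> with \<open>\<rho>\<close> as close to 1 as desired, so the total time is \<open>(\<rho>\<^sup>3 b)\<^sup>p\<close> up to polynomial factors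
  if Set Cover takes time \<open>b\<^sup>m\<close> on \<open>m\<close> elements.
\<close>

text \<open>The saving must be fixed before \<open>\<sigma>\<close> and \<open>\<delta>\<close>. The
  negated SCC supplies one base for all set sizes, and the three exponential factors carry exponents
  \<open>a1\<close>, \<open>a2\<close>, \<open>a3\<close> that depend on loop bodies alone; so
  \<open>h\<close> is chosen after \<open>a3\<close>, and \<open>g\<close> after \<open>a2\<close>,
  \<open>h\<close> and \<open>\<delta>\<close>, without the choice altering the exponents.
  \<open>\<sigma>\<close> enters the polynomial factor only. Keys rather than classes are hashed
  because there are at most \<open>(p + 1) ^ (\<delta> + 3)\<close> keys, while the number of
  classes grows with \<open>n\<close>, and a quasi-polynomial in \<open>n\<close> would be too much.
  Disjoint triangles that meet the hub and share a key use different vertices of it, so few of them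
  do; a second-moment bound, for which pairwise independence suffices, then controls the overfull
  buckets. A bucket may contain arbitrarily many disjoint triangles that avoid the hub. Hence only
  the excess over the best such packing is guessed, which is bounded by a constant. The guessed
  sizes add up to exactly the part of the hub outside \<open>T\<close>, so every cover within budget
  is a partition and the packings of different buckets cannot collide.\<close>

section \<open>Evaluation within a step bound\<close>

definition runs :: "val list \<Rightarrow> expr \<Rightarrow> val \<Rightarrow> nat \<Rightarrow> bool" where
  "runs env e v T \<longleftrightarrow> (\<exists>k\<le>T. eval env e v k)"

lemma runs_mono: "runs env e v T \<Longrightarrow> T \<le> T' \<Longrightarrow> runs env e v T'"
  unfolding runs_def using le_trans by blast

lemma runs_Var: "i < length env \<Longrightarrow> env ! i = v \<Longrightarrow> runs env (Var i) v 1"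
  unfolding runs_def using eval_Var by blast

lemma runs_Var_0: "runs (x # env) (Var 0) x 1"
  and runs_Var_1: "runs (x # y # env) (Var (Suc 0)) y 1"
  and runs_Var_2: "runs (x # y # z # env) (Var 2) z 1"
  by (rule runs_Var; simp)+

lemma runs_Empty: "runs env Empty VEmpty 1"
  unfolding runs_def using eval_Empty by blast

lemma runs_Cell:
  assumes "runs env e1 v1 T1" "runs env e2 v2 T2"
  shows "runs env (Cell e1 e2) (VCell v1 v2) (T1 + T2 + 1)"
proof -
  obtain k1 k2 where "k1 \<le> T1" "eval env e1 v1 k1" "k2 \<le> T2" "eval env e2 v2 k2"
    using assms unfolding runs_def by blast
  then show ?thesis
    unfolding runs_def using eval_Cell[of env e1 v1 k1 e2 v2 k2]
    by (intro exI[of _ "k1 + k2 + 1"]) auto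
qed

lemma runs_App:
  assumes "runs env e1 (VClos env' b) T1" "runs env e2 u T2" "runs (u # VClos env' b # env') b v T3"
  shows "runs env (App e1 e2) v (T1 + T2 + T3 + 1)"
proof -
  obtain k1 k2 k3 where "k1 \<le> T1" "eval env e1 (VClos env' b) k1" "k2 \<le> T2" "eval env e2 u k2"
    "k3 \<le> T3" "eval (u # VClos env' b # env') b v k3"
    using assms unfolding runs_def by blast
  then show ?thesis
    unfolding runs_def using eval_App[of env e1 env' b k1 e2 u k2 v k3]
    by (intro exI[of _ "k1 + k2 + k3 + 1"]) auto
qed

text \<open>An immediately applied abstraction serves as a let binding. Its body finds the bound
  value at index 0, the closure at index 1 and the old environment from index 2 on.\<close>

lemma runs_let:
  assumes "runs env a u T1" "runs (u # VClos env b # env) b v T2"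
  shows "runs env (App (Fun b) a) v (T1 + T2 + 2)"
proof -
  have "runs env (Fun b) (VClos env b) 1"
    unfolding runs_def using eval_Fun by blast
  from runs_App[OF this assms] show ?thesis by (rule runs_mono) simp
qed

lemma runs_Case_Empty:
  assumes "runs env e VEmpty T1" "runs env e1 v T2"
  shows "runs env (Case e e1 e2) v (T1 + T2 + 1)"
proof -
  obtain k1 k2 where "k1 \<le> T1" "eval env e VEmpty k1" "k2 \<le> T2" "eval env e1 v k2"
    using assms unfolding runs_def by blast
  then show ?thesis
    unfolding runs_def using eval_Case_Empty[of env e k1 e1 v k2 e2]
    by (intro exI[of _ "k1 + k2 + 1"]) auto
qed

lemma runs_Case_Cell:
  assumes "runs env e (VCell x y) T1" "runs (x # y # env) e2 v T2"
  shows "runs env (Case e e1 e2) v (T1 + T2 + 1)"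
proof -
  obtain k1 k2 where "k1 \<le> T1" "eval env e (VCell x y) k1" "k2 \<le> T2" "eval (x # y # env) e2 v k2"
    using assms unfolding runs_def by blast
  then show ?thesis
    unfolding runs_def using eval_Case_Cell[of env e x y k1 e2 v k2 e1]
    by (intro exI[of _ "k1 + k2 + 1"]) auto
qed

text \<open>
  A program given for a one-element environment also runs when further entries follow, although
  the closures it builds then capture longer environments.
\<close>

inductive ext :: "val \<Rightarrow> val \<Rightarrow> bool" where
  ext_Empty: "ext VEmpty VEmpty"
| ext_Cell: "ext a a' \<Longrightarrow> ext b b' \<Longrightarrow> ext (VCell a b) (VCell a' b')"
| ext_Clos: "length env \<le> length env' \<Longrightarrow> (\<forall>i<length env. ext (env ! i) (env' ! i))
    \<Longrightarrow> ext (VClos env e) (VClos env' e)"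

inductive_cases ext_EmptyE: "ext VEmpty v"
inductive_cases ext_CellE: "ext (VCell a b) v"
inductive_cases ext_ClosE: "ext (VClos env e) v"

text \<open>Only valid indices are ever read, so the derivation can be replayed over an environment
  that is longer at its end, with the same number of steps. The values may differ, but only in what
  their closures capture.\<close>

lemma eval_ext:
  "eval env e v k \<Longrightarrow> length env \<le> length env' \<Longrightarrow> \<forall>i<length env. ext (env ! i) (env' ! i)
    \<Longrightarrow> \<exists>v'. eval env' e v' k \<and> ext v v'"
proof (induction arbitrary: env' rule: eval.induct)
  case (eval_Var i env)
  then show ?case using eval.eval_Var[of i env'] by auto
next
  case (eval_Fun env e)
  then show ?case using eval.eval_Fun[of env' e] ext_Clos by blast
next
  case (eval_App env e1 env0 e k1 e2 u k2 v k3)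
  obtain f where f: "eval env' e1 f k1" "ext (VClos env0 e) f"
    using eval_App.IH(1)[OF eval_App.prems] by blast
  obtain env1 where f1: "f = VClos env1 e" "length env0 \<le> length env1"
      "\<forall>i<length env0. ext (env0 ! i) (env1 ! i)"
    using f(2) by (auto elim: ext_ClosE)
  obtain u' where u: "eval env' e2 u' k2" "ext u u'"
    using eval_App.IH(2)[OF eval_App.prems] by blast
  have "\<exists>v'. eval (u' # f # env1) e v' k3 \<and> ext v v'"
    using eval_App.IH(3)[of "u' # f # env1"] f u f1 by (auto simp: nth_Cons split: nat.splits)
  then show ?case using f u f1 eval.eval_App by blast
next
  case (eval_Empty env)
  then show ?case using eval.eval_Empty ext_Empty by blast
next
  case (eval_Cell env e1 v1 k1 e2 v2 k2)
  then show ?case by (meson eval.eval_Cell ext_Cell)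
next
  case (eval_Case_Empty env e k1 e1 v k2 e2)
  then show ?case by (metis eval.eval_Case_Empty ext_EmptyE)
next
  case (eval_Case_Cell env e x y k1 e2 v k2 e1)
  obtain x' y' where f: "eval env' e (VCell x' y') k1" "ext x x'" "ext y y'"
    using eval_Case_Cell.IH(1)[OF eval_Case_Cell.prems] by (auto elim: ext_CellE)
  have "\<exists>v'. eval (x' # y' # env') e2 v' k2 \<and> ext v v'"
    using eval_Case_Cell.IH(2)[of "x' # y' # env'"] f eval_Case_Cell.prems
    by (auto simp: nth_Cons split: nat.splits)
  then show ?case using f eval.eval_Case_Cell by blast
qed

primrec is_data :: "val \<Rightarrow> bool" where
  "is_data VEmpty \<longleftrightarrow> True"
| "is_data (VCell a b) \<longleftrightarrow> is_data a \<and> is_data b"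
| "is_data (VClos env e) \<longleftrightarrow> False"

lemma ext_data: "ext v v' \<Longrightarrow> is_data v \<Longrightarrow> v' = v"
  by (induction rule: ext.induct) auto

lemma ext_refl_data: "is_data v \<Longrightarrow> ext v v"
  by (induction v) (auto intro: ext.intros)

text \<open>Allows a complete program, specified only for the environment \<open>[x]\<close>, to be
  called as a subroutine. The Set Cover program is used in this way.\<close>

lemma eval_weaken:
  assumes "eval [x] e v k" "is_data x" "is_data v"
  shows "eval (x # env) e v k"
  using eval_ext[OF assms(1), of "x # env"] assms ext_data ext_refl_data by fastforce

section \<open>Encodable types\<close>

text \<open>Leaves weigh 2 and cells nothing. Sizes then add up exactly under pairing and consing,
  and every size is at least 2, so that a power of the size can absorb constants.\<close>

primrec val_size :: "val \<Rightarrow> nat" where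
  "val_size VEmpty = 2"
| "val_size (VCell a b) = val_size a + val_size b"
| "val_size (VClos env e) = 2"

lemma val_size_ge: "2 \<le> val_size v"
  by (induction v) auto

text \<open>Injectivity lets a comparison of trees decide equality of the encoded objects. Freedom
  from closures is what literals, the comparison of trees and \<open>eval_weaken\<close>
  require.\<close>

class enc =
  fixes enc :: "'a \<Rightarrow> val"
  assumes enc_inj: "enc x = enc y \<Longrightarrow> x = y"
    and enc_data: "is_data (enc x)"

definition sz :: "'a::enc \<Rightarrow> nat" where
  "sz x = val_size (enc x)"

lemma sz_ge: "2 \<le> sz x"
  unfolding sz_def by (rule val_size_ge)

lemma enc_eq_iff: "enc x = enc y \<longleftrightarrow> x = y"
  using enc_inj by blast

instantiation unit :: enc
begin
definition enc_unit :: "unit \<Rightarrow> val" where "enc_unit u = VEmpty"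
instance by standard (auto simp: enc_unit_def)
end

instantiation bool :: enc
begin
definition enc_bool' : "enc (b::bool) = enc_bool b"
instance by standard (auto simp: enc_bool' enc_bool_def split: if_splits)
end

instantiation prod :: (enc, enc) enc
begin
definition enc_prod: "enc p = VCell (enc (fst p)) (enc (snd p))"
instance by standard (auto simp: enc_prod enc_eq_iff enc_data prod_eq_iff)
end

lemma enc_list_inj:
  "(\<And>x y. f x = f y \<Longrightarrow> x = y) \<Longrightarrow> enc_list (map f xs) = enc_list (map f ys) \<Longrightarrow> xs = ys"
proof (induction xs arbitrary: ys)
  case Nil
  then show ?case by (cases ys) auto
next
  case (Cons x xs ys)
  obtain y zs where ys: "ys = y # zs" using Cons.prems(2) by (cases ys) auto
  have "f x = f y" "enc_list (map f xs) = enc_list (map f zs)" using Cons.prems(2) unfolding ys by simp_all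
  then show ?case using Cons.prems(1) Cons.IH[OF Cons.prems(1)] ys by blast
qed

instantiation list :: (enc) enc
begin
definition enc_list': "enc xs = enc_list (map enc xs)"
instance
proof
  fix xs ys :: "'a list"
  show "enc xs = enc ys \<Longrightarrow> xs = ys"
    unfolding enc_list' by (rule enc_list_inj[OF enc_inj])
  show "is_data (enc xs)"
    unfolding enc_list' by (induction xs) (auto simp: enc_data)
qed
end

lemma enc_nat_eq: "enc_nat n = enc (replicate n ())"
  unfolding enc_nat_def enc_list' by (simp add: enc_unit_def)

instantiation nat :: enc
begin
definition enc_nat': "enc (n::nat) = enc_nat n"
instance
proof
  fix m n :: nat
  show "enc m = enc n \<Longrightarrow> m = n"
    unfolding enc_nat' enc_nat_eq enc_eq_iff by (metis length_replicate)
  show "is_data (enc n)" unfolding enc_nat' enc_nat_eq by (rule enc_data)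
qed
end

lemma enc_Nil: "enc [] = VEmpty" and enc_Cons: "enc (x # xs) = VCell (enc x) (enc xs)"
  by (auto simp: enc_list')

lemma enc_Pair: "enc (a, b) = VCell (enc a) (enc b)"
  by (simp add: enc_prod)

lemma enc_0: "enc (0::nat) = VEmpty" and enc_Suc: "enc (Suc n) = VCell VEmpty (enc n)"
  by (auto simp: enc_nat' enc_nat_def)

lemma enc_True: "enc True = VCell VEmpty VEmpty" and enc_False: "enc False = VEmpty"
  by (auto simp: enc_bool' enc_bool_def)

lemma enc_replicate_unit: "enc (replicate n ()) = enc n"
  by (simp add: enc_nat' enc_nat_eq)

lemma sz_Nil[simp]: "sz [] = 2" and sz_Cons[simp]: "sz (x # xs) = sz x + sz xs"
  and sz_Pair[simp]: "sz (a, b) = sz a + sz b" and sz_unit[simp]: "sz () = 2"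
  and sz_nat[simp]: "sz (n::nat) = 2 * n + 2"
  and sz_True[simp]: "sz True = 4" and sz_False[simp]: "sz False = 2"
proof -
  show "sz n = 2 * n + 2" by (induction n) (auto simp: sz_def enc_0 enc_Suc)
qed (auto simp: sz_def enc_Nil enc_Cons enc_Pair enc_unit_def enc_True enc_False)

lemma sz_prod: "sz p = sz (fst p) + sz (snd p)"
  by (cases p) simp

lemma sz_bool_le: "sz (b::bool) \<le> 4"
  by (cases b) auto

lemma sz_append: "sz (xs @ ys) + 2 = sz xs + sz ys"
  by (induction xs) auto

lemma sz_list: "sz xs = 2 + (\<Sum>x\<leftarrow>xs. sz x)"
  by (induction xs) auto

lemma sz_mem: "x \<in> set xs \<Longrightarrow> sz x + 2 \<le> sz xs"
  by (induction xs) (auto simp: sz_ge le_SucI intro: le_trans[OF _ add_le_mono[OF sz_ge order_refl]])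

lemma sz_length: "2 * length xs + 2 \<le> sz xs"
proof (induction xs)
  case (Cons a xs)
  then show ?case using sz_ge[of a] by simp
qed simp

lemma sz_list_le: "(\<And>x. x \<in> set xs \<Longrightarrow> sz x \<le> B) \<Longrightarrow> sz xs \<le> 2 + length xs * B"
proof (induction xs)
  case (Cons a xs)
  then show ?case using Cons.prems[of a] by fastforce
qed simp

section \<open>Computable functions and their running time\<close>

text \<open>The rest of the environment is arbitrary, so that a program can be placed under binders
  without renumbering. Restricting to a domain makes invariants of the input available to the time
  bound.\<close>

definition computes :: "'a::enc set \<Rightarrow> ('a \<Rightarrow> 'b::enc) \<Rightarrow> ('a \<Rightarrow> nat) \<Rightarrow> bool" where
  "computes D f T \<longleftrightarrow> (\<exists>e. \<forall>c\<in>D. \<forall>env. runs (enc c # env) e (enc (f c)) (T c))"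

lemma computes_mono:
  assumes "computes D f T" "D' \<subseteq> D" "\<And>c. c \<in> D' \<Longrightarrow> T c \<le> T' c" "\<And>c. c \<in> D' \<Longrightarrow> f' c = f c"
  shows "computes D' f' T'"
  using assms unfolding computes_def by (metis in_mono runs_mono)

text \<open>A program sees encodings only. This identifies a pair with a cons cell, and a number
  with a list of units.\<close>

lemma computes_recode:
  assumes "computes D f T" "\<And>c. c \<in> D \<Longrightarrow> enc (f' c) = enc (f c)"
  shows "computes D f' T"
  using assms unfolding computes_def by auto

lemma computes_id: "computes D (\<lambda>c. c) (\<lambda>_. 1)"
  unfolding computes_def using runs_Var_0 by blast

text \<open>Each node of the tree costs one step, and a binary tree with \<open>k\<close> leaves,
  hence of size \<open>2 * k\<close>, has \<open>2 * k - 1\<close> nodes.\<close>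

lemma runs_literal: "is_data v \<Longrightarrow> \<exists>e. \<forall>env. runs env e v (val_size v - 1)"
proof (induction v)
  case VEmpty
  then show ?case using runs_Empty by auto
next
  case (VCell a b)
  then obtain e1 e2 where "\<And>env. runs env e1 a (val_size a - 1)" "\<And>env. runs env e2 b (val_size b - 1)"
    by auto
  then have "runs env (Cell e1 e2) (VCell a b) (val_size (VCell a b) - 1)" for env
    using runs_mono[OF runs_Cell, of env e1 a "val_size a - 1" e2 b "val_size b - 1" "val_size (VCell a b) - 1"]
      val_size_ge[of a] val_size_ge[of b] by auto
  then show ?case by blast
qed auto

lemma computes_const: "computes D (\<lambda>_. k) (\<lambda>_. sz k)"
  using runs_literal[OF enc_data[of k]] unfolding computes_def sz_def
  by (meson diff_le_self runs_mono)

lemma computes_comp: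
  assumes "computes D f Tf" "computes D' g Tg" "\<And>c. c \<in> D \<Longrightarrow> f c \<in> D'"
  shows "computes D (\<lambda>c. g (f c)) (\<lambda>c. Tf c + Tg (f c) + 2)"
proof -
  obtain e1 e2 where e1: "\<And>c env. c \<in> D \<Longrightarrow> runs (enc c # env) e1 (enc (f c)) (Tf c)"
    and e2: "\<And>c env. c \<in> D' \<Longrightarrow> runs (enc c # env) e2 (enc (g c)) (Tg c)"
    using assms unfolding computes_def by blast
  have "\<forall>c\<in>D. \<forall>env. runs (enc c # env) (App (Fun e2) e1) (enc (g (f c))) (Tf c + Tg (f c) + 2)"
    using runs_let[OF e1 e2] assms(3) by blast
  then show ?thesis unfolding computes_def by blast
qed

lemma computes_Pair:
  assumes "computes D f Tf" "computes D g Tg"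
  shows "computes D (\<lambda>c. (f c, g c)) (\<lambda>c. Tf c + Tg c + 1)"
proof -
  obtain e1 e2 where e1: "\<And>c env. c \<in> D \<Longrightarrow> runs (enc c # env) e1 (enc (f c)) (Tf c)"
    and e2: "\<And>c env. c \<in> D \<Longrightarrow> runs (enc c # env) e2 (enc (g c)) (Tg c)"
    using assms unfolding computes_def by blast
  have "\<forall>c\<in>D. \<forall>env. runs (enc c # env) (Cell e1 e2) (enc (f c, g c)) (Tf c + Tg c + 1)"
    unfolding enc_Pair using runs_Cell[OF e1 e2] by blast
  then show ?thesis unfolding computes_def by blast
qed

lemma computes_fst: "computes UNIV fst (\<lambda>_. 3)"
  unfolding computes_def
  by (auto intro!: exI[of _ "Case (Var 0) Empty (Var 0)"] runs_mono[OF runs_Case_Cell] runs_Var_0 simp: enc_prod)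

lemma computes_snd: "computes UNIV snd (\<lambda>_. 3)"
  unfolding computes_def
  by (auto intro!: exI[of _ "Case (Var 0) Empty (Var (Suc 0))"] runs_mono[OF runs_Case_Cell] runs_Var_0 runs_Var_1
      simp: enc_prod)

lemma computes_tl: "computes UNIV tl (\<lambda>_. 3)"
proof -
  have "runs (enc c # env) (Case (Var 0) Empty (Var (Suc 0))) (enc (tl c)) 3" for c :: "'a::enc list" and env
  proof (cases c)
    case Nil
    then show ?thesis
      using runs_Case_Empty[OF runs_Var_0 runs_Empty, of env "Var (Suc 0)"] by (simp add: numeral_eq_Suc enc_Nil)
  next
    case (Cons x xs)
    then show ?thesis
      using runs_Case_Cell[OF runs_Var_0 runs_Var_1, of "enc x" "enc xs" env Empty] by (simp add: numeral_eq_Suc enc_Cons)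
  qed
  then show ?thesis unfolding computes_def by blast
qed

lemma computes_Nil: "computes UNIV (\<lambda>xs. xs = []) (\<lambda>_. 5)"
proof -
  have "runs (enc c # env) (Case (Var 0) (Cell Empty Empty) Empty) (enc (c = [])) 5" for c :: "'a::enc list" and env
  proof (cases c)
    case Nil
    then show ?thesis
      using runs_Case_Empty[OF runs_Var_0 runs_Cell[OF runs_Empty runs_Empty], of env Empty]
      by (simp add: numeral_eq_Suc enc_Nil enc_True)
  next
    case (Cons x xs)
    then show ?thesis
      using runs_mono[OF runs_Case_Cell[OF runs_Var_0 runs_Empty, of "enc x" "enc xs" env "Cell Empty Empty"], of 5]
      by (simp add: numeral_eq_Suc enc_Cons enc_False)
  qed
  then show ?thesis unfolding computes_def by blast
qed

lemma computes_if:
  assumes "computes D b Tb" "computes {c\<in>D. b c} f Tf" "computes {c\<in>D. \<not> b c} g Tg"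
  shows "computes D (\<lambda>c. if b c then f c else g c) (\<lambda>c. Tb c + (if b c then Tf c else Tg c) + 5)"
proof -
  obtain e1 e2 e3 where e1: "\<And>c env. c \<in> D \<Longrightarrow> runs (enc c # env) e1 (enc (b c)) (Tb c)"
    and e2: "\<And>c env. c \<in> D \<Longrightarrow> b c \<Longrightarrow> runs (enc c # env) e2 (enc (f c)) (Tf c)"
    and e3: "\<And>c env. c \<in> D \<Longrightarrow> \<not> b c \<Longrightarrow> runs (enc c # env) e3 (enc (g c)) (Tg c)"
    using assms unfolding computes_def by (metis (mono_tags, lifting) mem_Collect_eq)
  \<comment> \<open>The cell branch pushes head and tail of the encoded \<open>True\<close>, so the
    input has moved to index 2; the let binding brings it back to index 0.\<close>
  have "runs (enc c # env) (Case e1 e3 (App (Fun e2) (Var 2))) (enc (if b c then f c else g c))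
      (Tb c + (if b c then Tf c else Tg c) + 5)" if "c \<in> D" for c env
  proof (cases "b c")
    case True
    then have "runs (enc c # env) e1 (VCell VEmpty VEmpty) (Tb c)" using e1[OF that, of env] by (simp add: enc_True)
    from runs_Case_Cell[OF this runs_let[OF runs_Var_2 e2[OF that True]], of e3] show ?thesis
      using True by (auto elim!: runs_mono)
  next
    case False
    then have "runs (enc c # env) e1 VEmpty (Tb c)" using e1[OF that, of env] by (simp add: enc_False)
    then show ?thesis
      using runs_mono[OF runs_Case_Empty[OF _ e3[OF that False]]] False by fastforce
  qed
  then show ?thesis unfolding computes_def by blast
qed

text \<open>The step function and its bound are required only at states that the loop reaches, so
  that an invariant of the particular loop can be used.\<close>

lemma computes_fold:
  fixes f :: "'x::enc \<times> 's::enc \<times> 'c::enc \<Rightarrow> 's"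
  assumes xs: "computes D xs Tx" and s: "computes D s0 Ts" and f: "computes E f Tf"
    and step: "\<And>c i. c \<in> D \<Longrightarrow> i < length (xs c) \<Longrightarrow>
      (xs c ! i, fold (\<lambda>x s. f (x, s, c)) (take i (xs c)) (s0 c), c) \<in> E \<and>
      Tf (xs c ! i, fold (\<lambda>x s. f (x, s, c)) (take i (xs c)) (s0 c), c) \<le> B c"
  shows "computes D (\<lambda>c. fold (\<lambda>x s. f (x, s, c)) (xs c) (s0 c))
    (\<lambda>c. Tx c + Ts c + (length (xs c) + 1) * (B c + 30))"
proof -
  obtain e1 e2 e3 where e1: "\<And>c env. c \<in> D \<Longrightarrow> runs (enc c # env) e1 (enc (xs c)) (Tx c)"
    and e2: "\<And>c env. c \<in> D \<Longrightarrow> runs (enc c # env) e2 (enc (s0 c)) (Ts c)"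
    and e3: "\<And>c env. c \<in> E \<Longrightarrow> runs (enc c # env) e3 (enc (f c)) (Tf c)"
    using assms unfolding computes_def by meson
  \<comment> \<open>the argument of the loop is (remaining list, (state, context))\<close>
  define loop where "loop =
    Case (Var 0) Empty
      (Case (Var 0)
         (Case (Var 1) Empty (Var 0))
         (Case (Var 3) Empty
            (App (Var 7) (Cell (Var 3) (Cell (App (Fun e3) (Cell (Var 2) (Cell (Var 0) (Var 1)))) (Var 1))))))"
  \<comment> \<open>The subtracted 6 leaves room for the 5 steps that build the initial argument and
    enter the loop; 30 per round pays for taking the argument apart and rebuilding it.\<close>
  have loop: "runs (enc (ys, s, c) # VClos env loop # env) loop
      (enc (fold (\<lambda>x s. f (x, s, c)) ys s)) ((length ys + 1) * (b + 30) - 6)"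
    if "\<And>i. i < length ys \<Longrightarrow> (ys ! i, fold (\<lambda>x s. f (x, s, c)) (take i ys) s, c) \<in> E \<and>
      Tf (ys ! i, fold (\<lambda>x s. f (x, s, c)) (take i ys) s, c) \<le> b" for ys s c env b
    using that
  proof (induction ys arbitrary: s)
    case Nil
    have "runs (enc ([] :: 'x list, s, c) # VClos env loop # env) loop (enc s) (1 + (1 + (1 + 1 + 1) + 1) + 1)"
      apply (subst (2) loop_def)
      apply (rule runs_Case_Cell[where x = VEmpty and y = "enc (s, c)"])
       apply (rule runs_Var; simp add: enc_Pair enc_Nil)
      apply (rule runs_Case_Empty)
       apply (rule runs_Var; simp)
      apply (rule runs_Case_Cell[where x = "enc s" and y = "enc c"])
       apply (rule runs_Var; simp add: enc_Pair)
      apply (rule runs_Var; simp)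
      done
    then show ?case by (auto elim!: runs_mono)
  next
    case (Cons y ys)
    have y: "(y, s, c) \<in> E" "Tf (y, s, c) \<le> b" using Cons.prems[of 0] by auto
    have IH: "runs (enc (ys, f (y, s, c), c) # VClos env loop # env) loop
        (enc (fold (\<lambda>x s. f (x, s, c)) ys (f (y, s, c)))) ((length ys + 1) * (b + 30) - 6)"
      by (rule Cons.IH) (use Cons.prems[of "Suc _"] in auto)
    let ?env = "enc s # enc c # enc y # enc ys # enc (y # ys) # enc (s, c) # enc (y # ys, s, c) # VClos env loop # env"
    have st: "runs ?env (App (Fun e3) (Cell (Var 2) (Cell (Var 0) (Var 1)))) (enc (f (y, s, c))) (5 + Tf (y, s, c) + 2)"
    proof (rule runs_let[OF _ e3[OF y(1)]])
      have "runs ?env (Cell (Var 2) (Cell (Var 0) (Var 1))) (VCell (enc y) (VCell (enc s) (enc c))) (1 + (1 + 1 + 1) + 1)"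
        by (intro runs_Cell runs_Var) auto
      then show "runs ?env (Cell (Var 2) (Cell (Var 0) (Var 1))) (enc (y, s, c)) 5"
        by (simp add: enc_Pair numeral_eq_Suc)
    qed
    have arg: "runs ?env (Cell (Var 3) (Cell (App (Fun e3) (Cell (Var 2) (Cell (Var 0) (Var 1)))) (Var 1)))
        (enc (ys, f (y, s, c), c)) (1 + (5 + Tf (y, s, c) + 2 + 1 + 1) + 1)"
      apply (subst enc_Pair[of ys])
      apply (subst enc_Pair[of "f (y, s, c)"])
      apply (intro runs_Cell st)
       apply (rule runs_Var; simp)+
      done
    have "runs (enc (y # ys, s, c) # VClos env loop # env) loop
      (enc (fold (\<lambda>x s. f (x, s, c)) ys (f (y, s, c))))
      (1 + (1 + (1 + (1 + (1 + (5 + Tf (y, s, c) + 2 + 1 + 1) + 1) + ((length ys + 1) * (b + 30) - 6) + 1) + 1) + 1) + 1)"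
      apply (subst (2) loop_def)
      apply (rule runs_Case_Cell[where x = "enc (y # ys)" and y = "enc (s, c)"])
       apply (rule runs_Var; simp add: enc_Pair)
      apply (rule runs_Case_Cell[where x = "enc y" and y = "enc ys"])
       apply (rule runs_Var; simp add: enc_Cons)
      apply (rule runs_Case_Cell[where x = "enc s" and y = "enc c"])
       apply (rule runs_Var; simp add: enc_Pair)
      apply (rule runs_App[OF _ arg IH])
      apply (rule runs_Var; simp)
      done
    then show ?case
      using y(2) by (auto elim!: runs_mono simp: algebra_simps)
  qed
  have "runs (enc c # env) (App (Fun loop) (Cell e1 (Cell e2 (Var 0))))
      (enc (fold (\<lambda>x s. f (x, s, c)) (xs c) (s0 c))) (Tx c + Ts c + (length (xs c) + 1) * (B c + 30))"
    if c: "c \<in> D" for c env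
  proof -
    have "runs (enc c # env) (Cell e1 (Cell e2 (Var 0))) (enc (xs c, s0 c, c)) (Tx c + (Ts c + 1 + 1) + 1)"
      unfolding enc_Pair by (intro runs_Cell e1 e2 c runs_Var_0)
    from runs_let[OF this loop[where ys = "xs c" and s = "s0 c" and c = c and b = "B c"]] step[OF c]
    show ?thesis by (auto elim!: runs_mono)
  qed
  then show ?thesis unfolding computes_def by blast
qed

text \<open>The traversal follows the shape of the first tree and stops at the first disagreement,
  so the second tree does not influence the bound.\<close>

lemma runs_equality:
  "\<exists>e. \<forall>u v env. is_data u \<longrightarrow> is_data v \<longrightarrow>
    runs (VCell u v # env) e (enc (u = v)) (30 * val_size u)"
proof -
  define loop where "loop =
    Case (Var 0) Empty
      (Case (Var 0)
         (Case (Var 1) (Cell Empty Empty) Empty)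
         (Case (Var 3) Empty
            (Case (App (Var 7) (Cell (Var 2) (Var 0))) Empty (App (Var 9) (Cell (Var 5) (Var 3))))))"
  \<comment> \<open>Since 20 is subtracted for each of the two subtrees but only once for the cell,
    20 steps are available for the work at the cell itself.\<close>
  have loop: "runs (VCell u v # VClos env loop # env) loop (enc (u = v)) (30 * val_size u - 20)"
    if "is_data u" "is_data v" for u v env
    using that
  proof (induction u arbitrary: v)
    case VEmpty
    have "runs (VEmpty # v # VCell VEmpty v # VClos env loop # env) (Case (Var 1) (Cell Empty Empty) Empty)
        (enc (VEmpty = v)) 5"
    proof (cases v)
      case VEmpty
      then show ?thesis
        using runs_Case_Empty[OF runs_Var_1 runs_Cell[OF runs_Empty runs_Empty], of VEmpty
            "VCell VEmpty VEmpty # VClos env loop # env" Empty]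
        by (simp add: numeral_eq_Suc enc_True)
    next
      case (VCell a b)
      then show ?thesis
        using runs_mono[OF runs_Case_Cell[OF runs_Var_1 runs_Empty, of VEmpty a b
            "VCell VEmpty v # VClos env loop # env" "Cell Empty Empty"], of 5]
        by (simp add: numeral_eq_Suc enc_False)
    qed (use VEmpty.prems in simp)
    then have "runs (VCell VEmpty v # VClos env loop # env) loop (enc (VEmpty = v)) (1 + (1 + 5 + 1) + 1)"
      by (subst (2) loop_def) (intro runs_Case_Cell[where x = VEmpty and y = v] runs_Case_Empty runs_Var; simp)
    then show ?case by (auto elim!: runs_mono)
  next
    case (VCell a b)
    note IH1 = VCell.IH(1) and IH2 = VCell.IH(2)
    have da: "is_data a" "is_data b" using VCell.prems by auto
    let ?env = "\<lambda>v. a # b # VCell a b # v # VCell (VCell a b) v # VClos env loop # env"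
    have main: "runs (?env v) (Case (Var 3) Empty
            (Case (App (Var 7) (Cell (Var 2) (Var 0))) Empty (App (Var 9) (Cell (Var 5) (Var 3)))))
        (enc (VCell a b = v)) (30 * val_size a - 20 + (30 * val_size b - 20) + 15)"
    proof (cases v)
      case VEmpty
      then show ?thesis
        by (auto intro!: runs_mono[OF runs_Case_Empty] runs_Var runs_Empty simp: enc_False)
    next
      case (VCell c d)
      have dc: "is_data c" "is_data d" using VCell VCell.prems \<open>is_data v\<close> by auto
      let ?env2 = "c # d # ?env v"
      have "runs ?env2 (Cell (Var 2) (Var 0)) (VCell a c) (1 + 1 + 1)"
        by (intro runs_Cell runs_Var) auto
      from runs_App[OF runs_Var this IH1[OF da(1) dc(1)], of 7]
      have 1: "runs ?env2 (App (Var 7) (Cell (Var 2) (Var 0))) (enc (a = c)) (1 + 3 + (30 * val_size a - 20) + 1)"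
        by (simp add: numeral_eq_Suc)
      have "runs (?env v) (Case (Var 3) Empty
            (Case (App (Var 7) (Cell (Var 2) (Var 0))) Empty (App (Var 9) (Cell (Var 5) (Var 3)))))
        (enc (VCell a b = v)) (1 + ((1 + 3 + (30 * val_size a - 20) + 1) + (1 + 3 + (30 * val_size b - 20) + 1) + 1) + 1)"
      proof (rule runs_Case_Cell[where x = c and y = d])
        show "runs (?env v) (Var 3) (VCell c d) 1" using VCell by (intro runs_Var) auto
        show "runs ?env2 (Case (App (Var 7) (Cell (Var 2) (Var 0))) Empty (App (Var 9) (Cell (Var 5) (Var 3))))
          (enc (VCell a b = v)) ((1 + 3 + (30 * val_size a - 20) + 1) + (1 + 3 + (30 * val_size b - 20) + 1) + 1)"
        proof (cases "a = c")
          case False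
          then show ?thesis
            using 1 VCell runs_mono[OF runs_Case_Empty[OF _ runs_Empty]] by (fastforce simp: enc_False)
        next
          case True
          let ?env3 = "VEmpty # VEmpty # ?env2"
          have "runs ?env3 (Cell (Var 5) (Var 3)) (VCell b d) (1 + 1 + 1)"
            by (intro runs_Cell runs_Var) auto
          from runs_App[OF runs_Var this IH2[OF da(2) dc(2)], of 9]
          have 2: "runs ?env3 (App (Var 9) (Cell (Var 5) (Var 3))) (enc (b = d)) (1 + 3 + (30 * val_size b - 20) + 1)"
            by (simp add: numeral_eq_Suc)
          show ?thesis
            using runs_Case_Cell[OF 1[unfolded eqTrueI[OF True] enc_True] 2] True VCell by auto
        qed
      qed
      then show ?thesis by (auto elim!: runs_mono)
    qed (use \<open>is_data v\<close> in simp)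
    have "runs (VCell (VCell a b) v # VClos env loop # env) loop (enc (VCell a b = v))
       (1 + (1 + (30 * val_size a - 20 + (30 * val_size b - 20) + 15) + 1) + 1)"
      apply (subst (2) loop_def)
      apply (rule runs_Case_Cell[where x = "VCell a b" and y = v])
       apply (rule runs_Var; simp)
      apply (rule runs_Case_Cell[where x = a and y = b])
       apply (rule runs_Var; simp)
      apply (rule main)
      done
    then show ?case
      using val_size_ge[of a] val_size_ge[of b] by (auto elim!: runs_mono)
  qed simp
  have "runs (VCell u v # env) (App (Fun loop) (Var 0)) (enc (u = v)) (30 * val_size u)"
    if "is_data u" "is_data v" for u v env
    by (rule runs_mono[OF runs_let[OF runs_Var_0 loop[OF that]]]) (use val_size_ge[of u] in simp)
  then show ?thesis by blast
qed

lemma computes_eq: "computes UNIV (\<lambda>p. fst p = snd p) (\<lambda>p. 30 * sz (fst p))"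
proof -
  obtain e where e: "\<And>u v env. is_data u \<Longrightarrow> is_data v \<Longrightarrow> runs (VCell u v # env) e (enc (u = v)) (30 * val_size u)"
    using runs_equality by blast
  show ?thesis
    unfolding computes_def
  proof (intro exI[of _ e] ballI allI)
    fix p :: "'a \<times> 'a" and env
    show "runs (enc p # env) e (enc (fst p = snd p)) (30 * sz (fst p))"
      using e[OF enc_data enc_data, of "fst p" "snd p" env] by (simp add: enc_prod enc_eq_iff sz_def)
  qed
qed

section \<open>Polynomial-time functions\<close>

text \<open>Pure powers suffice as bounds: sizes are at least 2, so constants and sums are absorbed
  by a larger exponent.\<close>

definition pb :: "'a::enc set \<Rightarrow> ('a \<Rightarrow> nat) \<Rightarrow> bool" where
  "pb D t \<longleftrightarrow> (\<exists>a. \<forall>c\<in>D. t c \<le> sz c ^ a)"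

text \<open>The size of the output needs a bound of its own. Values share subterms, so repeated
  doubling by \<open>Cell (Var 0) (Var 0)\<close> builds a tree exponentially larger than the
  running time, and composition would fail.\<close>

definition pt_on :: "'a::enc set \<Rightarrow> ('a \<Rightarrow> 'b::enc) \<Rightarrow> bool" where
  "pt_on D f \<longleftrightarrow> (\<exists>T. computes D f T \<and> pb D T) \<and> pb D (\<lambda>c. sz (f c))"

lemma sz_pow_mono: "a \<le> b \<Longrightarrow> sz c ^ a \<le> sz c ^ b"
  using sz_ge[of c] by (intro power_increasing) auto

lemma pb_mono: "pb D t \<Longrightarrow> D' \<subseteq> D \<Longrightarrow> (\<And>c. c \<in> D' \<Longrightarrow> t' c \<le> t c) \<Longrightarrow> pb D' t'"
  unfolding pb_def by (meson in_mono le_trans)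

lemma pb_const: "pb D (\<lambda>_. k)"
proof -
  have "k \<le> sz c ^ k" for c :: 'a
  proof -
    have "k \<le> 2 ^ k" by (simp add: less_imp_le)
    also have "\<dots> \<le> sz c ^ k" using sz_ge[of c] by (intro power_mono) auto
    finally show ?thesis .
  qed
  then show ?thesis unfolding pb_def by blast
qed

lemma pb_mult: "pb D s \<Longrightarrow> pb D t \<Longrightarrow> pb D (\<lambda>c. s c * t c)"
  unfolding pb_def by (metis mult_le_mono power_add)

lemma pb_add:
  assumes "pb D s" "pb D t"
  shows "pb D (\<lambda>c. s c + t c)"
proof -
  obtain a b where ab: "\<And>c. c \<in> D \<Longrightarrow> s c \<le> sz c ^ a" "\<And>c. c \<in> D \<Longrightarrow> t c \<le> sz c ^ b"
    using assms unfolding pb_def by blast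
  have "s c + t c \<le> sz c ^ (a + b + 1)" if "c \<in> D" for c
  proof -
    have "s c + t c \<le> sz c ^ a + sz c ^ b" using ab that add_mono by blast
    also have "\<dots> \<le> sz c ^ (a + b) + sz c ^ (a + b)" by (intro add_mono sz_pow_mono) auto
    also have "\<dots> \<le> sz c * sz c ^ (a + b)" using sz_ge[of c] by (metis mult_2 mult_le_mono1)
    finally show ?thesis by simp
  qed
  then show ?thesis unfolding pb_def by blast
qed

lemma pb_power: "pb D t \<Longrightarrow> pb D (\<lambda>c. t c ^ k)"
  unfolding pb_def by (metis power_mono power_mult zero_le)

lemma pb_sz: "pb D sz"
  unfolding pb_def by (intro exI[of _ 1]) auto

lemma pb_comp:
  assumes "pb D' t" "pb D (\<lambda>c. sz (f c))" "\<And>c. c \<in> D \<Longrightarrow> f c \<in> D'"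
  shows "pb D (\<lambda>c. t (f c))"
proof -
  obtain a where a: "\<And>c. c \<in> D' \<Longrightarrow> t c \<le> sz c ^ a" using assms unfolding pb_def by blast
  show ?thesis by (rule pb_mono[OF pb_power[OF assms(2), of a]]) (use a assms(3) in auto)
qed

lemmas pb_intros = pb_const pb_mult pb_add pb_power

text \<open>An element is smaller than its list. A bound on a loop body in terms of element and
  context thus becomes a bound in terms of the context alone.\<close>

lemma pb_elements:
  assumes "pb {p. snd p \<in> D \<and> fst p \<in> set (xs (snd p))} t" "pb D (\<lambda>c. sz (xs c))"
  obtains B where "pb D B" "\<And>c x. c \<in> D \<Longrightarrow> x \<in> set (xs c) \<Longrightarrow> t (x, c) \<le> B c"
proof -
  obtain a where a: "\<And>c x. c \<in> D \<Longrightarrow> x \<in> set (xs c) \<Longrightarrow> t (x, c) \<le> sz (x, c) ^ a"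
    using assms(1) unfolding pb_def by force
  show ?thesis
  proof (rule that)
    show "pb D (\<lambda>c. (sz (xs c) + sz c) ^ a)" by (intro pb_intros assms pb_sz)
    fix c x assume *: "c \<in> D" "x \<in> set (xs c)"
    have "t (x, c) \<le> sz (x, c) ^ a" using a * by blast
    also have "\<dots> \<le> (sz (xs c) + sz c) ^ a"
      using sz_mem[OF *(2)] by (intro power_mono) auto
    finally show "t (x, c) \<le> (sz (xs c) + sz c) ^ a" .
  qed
qed

lemma pt_onI: "computes D f T \<Longrightarrow> pb D T \<Longrightarrow> pb D (\<lambda>c. sz (f c)) \<Longrightarrow> pt_on D f"
  unfolding pt_on_def by blast

lemma pt_onE:
  assumes "pt_on D f"
  obtains T where "computes D f T" "pb D T" "pb D (\<lambda>c. sz (f c))"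
  using assms unfolding pt_on_def by blast

lemma pt_sz: "pt_on D f \<Longrightarrow> pb D (\<lambda>c. sz (f c))"
  unfolding pt_on_def by blast

lemma pt_mono: "pt_on D f \<Longrightarrow> D' \<subseteq> D \<Longrightarrow> (\<And>c. c \<in> D' \<Longrightarrow> f' c = f c) \<Longrightarrow> pt_on D' f'"
  by (elim pt_onE, rule pt_onI) (auto elim: pb_mono computes_mono)

lemma pt_cong: "pt_on D f \<Longrightarrow> (\<And>c. c \<in> D \<Longrightarrow> f' c = f c) \<Longrightarrow> pt_on D f'"
  using pt_mono by blast

lemma pt_recode:
  assumes "pt_on D f" "\<And>c. c \<in> D \<Longrightarrow> enc (f' c) = enc (f c)"
  shows "pt_on D f'"
  using assms
  by (elim pt_onE, intro pt_onI) (auto elim: pb_mono computes_recode simp: sz_def)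

named_theorems pt

lemma pt_id[pt]: "pt_on D (\<lambda>c. c)"
  by (rule pt_onI[OF computes_id]) (intro pb_intros pb_sz)+

lemma pt_const[pt]: "pt_on D (\<lambda>_. k)"
  by (rule pt_onI[OF computes_const]) (intro pb_intros)+

lemma pt_comp:
  assumes "pt_on D' g" "pt_on D f" "\<And>c. c \<in> D \<Longrightarrow> f c \<in> D'"
  shows "pt_on D (\<lambda>c. g (f c))"
proof -
  obtain Tg where g: "computes D' g Tg" "pb D' Tg" "pb D' (\<lambda>c. sz (g c))" using assms(1) by (rule pt_onE)
  obtain Tf where f: "computes D f Tf" "pb D Tf" "pb D (\<lambda>c. sz (f c))" using assms(2) by (rule pt_onE)
  show ?thesis
  proof (rule pt_onI)
    show "computes D (\<lambda>c. g (f c)) (\<lambda>c. Tf c + Tg (f c) + 2)"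
      by (rule computes_comp[OF f(1) g(1) assms(3)])
    show "pb D (\<lambda>c. Tf c + Tg (f c) + 2)"
      by (intro pb_intros f pb_comp[OF g(2) f(3) assms(3)])
    show "pb D (\<lambda>c. sz (g (f c)))" by (rule pb_comp[OF g(3) f(3) assms(3)])
  qed
qed

lemma pt_comp_UNIV: "pt_on UNIV g \<Longrightarrow> pt_on D f \<Longrightarrow> pt_on D (\<lambda>c. g (f c))"
  by (rule pt_comp) auto

lemma pt_Pair[pt]: "pt_on D f \<Longrightarrow> pt_on D g \<Longrightarrow> pt_on D (\<lambda>c. (f c, g c))"
  by (elim pt_onE, rule pt_onI[OF computes_Pair], assumption, assumption)
    (unfold sz_Pair, (intro pb_intros; assumption)+)

lemma pt_comp2:
  assumes "pt_on UNIV (\<lambda>p. g (fst p) (snd p))" "pt_on D f1" "pt_on D f2"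
  shows "pt_on D (\<lambda>c. g (f1 c) (f2 c))"
  using pt_comp_UNIV[OF assms(1) pt_Pair[OF assms(2,3)]] by simp

lemma pt_comp3:
  assumes "pt_on UNIV (\<lambda>p. g (fst p) (fst (snd p)) (snd (snd p)))" "pt_on D f1" "pt_on D f2" "pt_on D f3"
  shows "pt_on D (\<lambda>c. g (f1 c) (f2 c) (f3 c))"
  using pt_comp_UNIV[OF assms(1) pt_Pair[OF assms(2) pt_Pair[OF assms(3,4)]]] by simp

lemma pt_comp4:
  assumes "pt_on UNIV (\<lambda>p. g (fst p) (fst (snd p)) (fst (snd (snd p))) (snd (snd (snd p))))"
    "pt_on D f1" "pt_on D f2" "pt_on D f3" "pt_on D f4"
  shows "pt_on D (\<lambda>c. g (f1 c) (f2 c) (f3 c) (f4 c))"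
  using pt_comp_UNIV[OF assms(1) pt_Pair[OF assms(2) pt_Pair[OF assms(3) pt_Pair[OF assms(4,5)]]]] by simp

lemma sz_tl: "sz (tl xs) \<le> sz xs"
  by (cases xs) auto

lemma pt_fst[pt]: "pt_on D f \<Longrightarrow> pt_on D (\<lambda>c. fst (f c))"
  by (rule pt_comp_UNIV[of fst], rule pt_onI[OF computes_fst])
    (auto intro: pb_intros pb_mono[OF pb_sz] simp: sz_prod)

lemma pt_snd[pt]: "pt_on D f \<Longrightarrow> pt_on D (\<lambda>c. snd (f c))"
  by (rule pt_comp_UNIV[of snd], rule pt_onI[OF computes_snd])
    (auto intro: pb_intros pb_mono[OF pb_sz] simp: sz_prod)

lemma pt_tl[pt]: "pt_on D f \<Longrightarrow> pt_on D (\<lambda>c. tl (f c))"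
  by (rule pt_comp_UNIV[of tl], rule pt_onI[OF computes_tl])
    (auto intro: pb_intros pb_mono[OF pb_sz] simp: sz_tl)

lemma pb_sz_bool: "pb D (\<lambda>c. sz (b c :: bool))"
  by (rule pb_mono[OF pb_const[where k = 4]]) (auto simp: sz_bool_le)

lemma pt_null[pt]: "pt_on D f \<Longrightarrow> pt_on D (\<lambda>c. f c = [])"
  by (rule pt_comp_UNIV[of "\<lambda>xs. xs = []"], rule pt_onI[OF computes_Nil]) (intro pb_intros pb_sz_bool)+

lemma pt_eq[pt]:
  assumes "pt_on D f" "pt_on D g"
  shows "pt_on D (\<lambda>c. f c = g c)"
proof (rule pt_comp2[OF _ assms])
  show "pt_on UNIV (\<lambda>p. fst p = (snd p :: 'b))"
    by (rule pt_onI[OF computes_eq]) (intro pb_intros pb_sz_bool pt_sz pt)+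
qed

lemma pt_if[pt]:
  assumes "pt_on D b" "pt_on D f" "pt_on D g"
  shows "pt_on D (\<lambda>c. if b c then f c else g c)"
proof -
  obtain Tb where b: "computes D b Tb" "pb D Tb" using assms(1) by (rule pt_onE)
  obtain Tf where f: "computes D f Tf" "pb D Tf" "pb D (\<lambda>c. sz (f c))" using assms(2) by (rule pt_onE)
  obtain Tg where g: "computes D g Tg" "pb D Tg" "pb D (\<lambda>c. sz (g c))" using assms(3) by (rule pt_onE)
  show ?thesis
    apply (rule pt_onI[OF computes_if[OF b(1) computes_mono[OF f(1)] computes_mono[OF g(1)]]])
           apply (auto intro: pb_mono[OF pb_add[OF pb_add[OF b(2) pb_add[OF f(2) g(2)]] pb_const[where k = 5]]]
          pb_mono[OF pb_add[OF f(3) g(3)]])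
    done
qed

lemma pt_Cons[pt]: "pt_on D f \<Longrightarrow> pt_on D g \<Longrightarrow> pt_on D (\<lambda>c. f c # g c)"
  by (rule pt_recode[of D "\<lambda>c. (f c, g c)"]) (auto intro: pt simp: enc_Cons enc_Pair)

lemma pt_not[pt]: "pt_on D b \<Longrightarrow> pt_on D (\<lambda>c. \<not> b c)"
  by (rule pt_cong[of D "\<lambda>c. if b c then False else True"], intro pt) auto

lemma pt_conj[pt]: "pt_on D b \<Longrightarrow> pt_on D b' \<Longrightarrow> pt_on D (\<lambda>c. b c \<and> b' c)"
  by (rule pt_cong[of D "\<lambda>c. if b c then b' c else False"], intro pt) auto

lemma pt_disj[pt]: "pt_on D b \<Longrightarrow> pt_on D b' \<Longrightarrow> pt_on D (\<lambda>c. b c \<or> b' c)"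
  by (rule pt_cong[of D "\<lambda>c. if b c then True else b' c"], intro pt) auto

lemma pt_Suc[pt]: "pt_on D f \<Longrightarrow> pt_on D (\<lambda>c. Suc (f c))"
  by (rule pt_recode[of D "\<lambda>c. ((), f c)"]) (auto intro: pt simp: enc_Suc enc_Pair enc_unit_def)

text \<open>A number has the same encoding as a list of that many units, so one can fold over it.\<close>

lemma pt_units: "pt_on D f \<Longrightarrow> pt_on D (\<lambda>c. replicate (f c) ())"
  by (rule pt_recode[of D f]) (auto simp: enc_replicate_unit)

lemma pt_of_units: "pt_on D (\<lambda>c. replicate (f c) ()) \<Longrightarrow> pt_on D f"
  by (erule pt_recode) (simp add: enc_replicate_unit)

text \<open>A polynomial step does not make a polynomial loop, because the state may double in every
  round. Hence the sizes of all intermediate states are a separate hypothesis.\<close>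

lemma pt_fold:
  assumes xs: "pt_on D xs" and s: "pt_on D s0" and f: "pt_on E (\<lambda>p. f (fst p) (fst (snd p)) (snd (snd p)))"
    and step: "\<And>c i. c \<in> D \<Longrightarrow> i < length (xs c) \<Longrightarrow>
      (xs c ! i, fold (\<lambda>x s. f x s c) (take i (xs c)) (s0 c), c) \<in> E"
    and Bd: "pb D Bd"
    and size: "\<And>c i. c \<in> D \<Longrightarrow> i \<le> length (xs c) \<Longrightarrow>
      sz (fold (\<lambda>x s. f x s c) (take i (xs c)) (s0 c)) \<le> Bd c"
  shows "pt_on D (\<lambda>c. fold (\<lambda>x s. f x s c) (xs c) (s0 c))"
proof -
  obtain Tx where tx: "computes D xs Tx" "pb D Tx" "pb D (\<lambda>c. sz (xs c))" using xs by (rule pt_onE)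
  obtain Ts where ts: "computes D s0 Ts" "pb D Ts" using s by (rule pt_onE)
  obtain Tf where tf: "computes E (\<lambda>p. f (fst p) (fst (snd p)) (snd (snd p))) Tf" "pb E Tf" using f by (rule pt_onE)
  obtain a where a: "\<And>c. c \<in> E \<Longrightarrow> Tf c \<le> sz c ^ a" using tf unfolding pb_def by blast
  define B where "B = (\<lambda>c. (sz (xs c) + (Bd c + sz c)) ^ a)"
  have st: "(xs c ! i, fold (\<lambda>x s. f x s c) (take i (xs c)) (s0 c), c) \<in> E \<and>
      Tf (xs c ! i, fold (\<lambda>x s. f x s c) (take i (xs c)) (s0 c), c) \<le> B c"
    if "c \<in> D" "i < length (xs c)" for c i
  proof -
    let ?p = "(xs c ! i, fold (\<lambda>x s. f x s c) (take i (xs c)) (s0 c), c)"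
    have "Tf ?p \<le> sz ?p ^ a" using a step that by blast
    also have "\<dots> \<le> B c"
      unfolding B_def sz_Pair
      using sz_mem[OF nth_mem[OF that(2)]] size[OF that(1), of i] that(2)
      by (intro power_mono add_mono) auto
    finally show ?thesis using step that by blast
  qed
  have "pb D B" unfolding B_def by (intro pb_intros tx Bd pb_sz)
  have len: "pb D (\<lambda>c. length (xs c))"
    by (rule pb_mono[OF tx(3)]) (use sz_length in \<open>auto intro: le_trans[OF _ sz_length]\<close>)
  have *: "computes D (\<lambda>c. fold (\<lambda>x s. f x s c) (xs c) (s0 c))
    (\<lambda>c. Tx c + Ts c + (length (xs c) + 1) * (B c + 30))"
    using computes_fold[OF tx(1) ts(1) tf(1), of B] st by simp
  show ?thesis
  proof (rule pt_onI[OF *])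
    show "pb D (\<lambda>c. Tx c + Ts c + (length (xs c) + 1) * (B c + 30))"
      by (intro pb_intros tx ts len \<open>pb D B\<close>)
    show "pb D (\<lambda>c. sz (fold (\<lambda>x s. f x s c) (xs c) (s0 c)))"
      by (rule pb_mono[OF Bd order_refl]) (use size in force)
  qed
qed

section \<open>Polynomial-time list operations\<close>

lemma fold_Cons_rev: "fold (\<lambda>x s. x # s) xs ys = rev xs @ ys"
  by (induction xs arbitrary: ys) auto

lemma sz_rev: "sz (rev xs) = sz xs"
  by (simp add: sz_list rev_map[symmetric])

lemma sz_take: "sz (take i xs) \<le> sz xs"
  using sz_append[of "take i xs" "drop i xs"] sz_ge[of "drop i xs"] by simp

lemma pt_rev_append: "pt_on D xs \<Longrightarrow> pt_on D ys \<Longrightarrow> pt_on D (\<lambda>c. rev (xs c) @ ys c)"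
  unfolding fold_Cons_rev[symmetric]
proof (rule pt_fold[where E = UNIV and Bd = "\<lambda>c. sz (xs c) + sz (ys c)"], assumption, assumption)
  assume "pt_on D xs" "pt_on D ys"
  then show "pb D (\<lambda>c. sz (xs c) + sz (ys c))" by (intro pb_intros pt_sz)
  fix c i
  show "sz (fold (\<lambda>x s. x # s) (take i (xs c)) (ys c)) \<le> sz (xs c) + sz (ys c)"
    unfolding fold_Cons_rev
    using sz_append[of "rev (take i (xs c))" "ys c"] sz_take[of i "xs c"] by (simp add: sz_rev)
qed (auto intro!: pt)

lemma pt_rev[pt]: "pt_on D xs \<Longrightarrow> pt_on D (\<lambda>c. rev (xs c))"
  using pt_rev_append[OF _ pt_const, of D xs "[]"] by simp

lemma pt_append[pt]: "pt_on D xs \<Longrightarrow> pt_on D ys \<Longrightarrow> pt_on D (\<lambda>c. xs c @ ys c)"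
  using pt_rev_append[OF pt_rev, of D xs ys] by simp

lemma fold_append: "fold (\<lambda>x s. s @ f x) xs ys = ys @ concat (map f xs)"
  by (induction xs arbitrary: ys) auto

lemma sz_concat_le: "sz (concat xss) \<le> sz xss"
proof (induction xss)
  case (Cons xs xss)
  then show ?case using sz_append[of xs "concat xss"] by simp
qed simp

text \<open>The body may refer to the context, so it is treated as a function of the pair of element
  and context, and only for elements that occur. This rule, with \<open>pt_map\<close> and
  \<open>pt_filter\<close>, covers the comprehensions in the algorithm.\<close>

lemma pt_concat_map[pt]:
  assumes xs: "pt_on D xs" and f: "pt_on {p. snd p \<in> D \<and> fst p \<in> set (xs (snd p))} (\<lambda>p. f (fst p) (snd p))"
  shows "pt_on D (\<lambda>c. concat (map (\<lambda>x. f x c) (xs c)))"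
proof -
  let ?E = "{p. snd p \<in> D \<and> fst p \<in> set (xs (snd p))}"
  obtain B where B: "pb D B" "\<And>c x. c \<in> D \<Longrightarrow> x \<in> set (xs c) \<Longrightarrow> sz (f x c) \<le> B c"
    using pb_elements[OF pt_sz[OF f] pt_sz[OF xs]] by auto
  have "pt_on D (\<lambda>c. fold (\<lambda>x s. s @ f x c) (xs c) [])"
  proof (rule pt_fold[OF xs pt_const, where E = "{p. (fst p, snd (snd p)) \<in> ?E}"])
    have "pt_on {p. (fst p, snd (snd p)) \<in> ?E} (\<lambda>p. f (fst p) (snd (snd p)))"
      using pt_comp[OF f pt_Pair[OF pt_fst[OF pt_id] pt_snd[OF pt_snd[OF pt_id]]],
          of "{p. (fst p, snd (snd p)) \<in> ?E}"] by simp
    then show "pt_on {p. (fst p, snd (snd p)) \<in> ?E} (\<lambda>p. fst (snd p) @ f (fst p) (snd (snd p)))"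
      by (intro pt)
    show "pb D (\<lambda>c. 2 + sz (xs c) * B c)" by (intro pb_intros B pt_sz xs)
    fix c i assume c: "c \<in> D" "i \<le> length (xs c)"
    have "sz (concat (map (\<lambda>x. f x c) (take i (xs c)))) \<le> sz (map (\<lambda>x. f x c) (take i (xs c)))"
      by (rule sz_concat_le)
    also have "\<dots> \<le> 2 + length (map (\<lambda>x. f x c) (take i (xs c))) * B c"
      by (rule sz_list_le) (use B c in \<open>auto dest: in_set_takeD\<close>)
    also have "\<dots> \<le> 2 + sz (xs c) * B c"
      using sz_length[of "xs c"] c by (intro add_mono mult_le_mono) auto
    finally show "sz (fold (\<lambda>x s. s @ f x c) (take i (xs c)) []) \<le> 2 + sz (xs c) * B c"
      by (simp add: fold_append)
  qed auto
  then show ?thesis by (simp add: fold_append)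
qed

lemma pt_map[pt]:
  assumes xs: "pt_on D xs" and f: "pt_on {p. snd p \<in> D \<and> fst p \<in> set (xs (snd p))} (\<lambda>p. f (fst p) (snd p))"
  shows "pt_on D (\<lambda>c. map (\<lambda>x. f x c) (xs c))"
proof -
  have "concat (map (\<lambda>x. [f x c]) ys) = map (\<lambda>x. f x c) ys" for c ys
    by (induction ys) auto
  then show ?thesis using pt_concat_map[OF xs pt_Cons[OF f pt_const], of "[]"] by simp
qed

lemma pt_filter[pt]:
  assumes xs: "pt_on D xs" and f: "pt_on {p. snd p \<in> D \<and> fst p \<in> set (xs (snd p))} (\<lambda>p. P (fst p) (snd p))"
  shows "pt_on D (\<lambda>c. filter (\<lambda>x. P x c) (xs c))"
proof -
  have "concat (map (\<lambda>x. if P x c then [x] else []) ys) = filter (\<lambda>x. P x c) ys" for c ys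
    by (induction ys) auto
  then show ?thesis
    using pt_concat_map[OF xs pt_if[OF f pt_Cons[OF pt_fst[OF pt_id] pt_const] pt_const], of "[]" "[]"] by simp
qed

lemma pt_Bex[pt]:
  assumes xs: "pt_on D xs" and f: "pt_on {p. snd p \<in> D \<and> fst p \<in> set (xs (snd p))} (\<lambda>p. P (fst p) (snd p))"
  shows "pt_on D (\<lambda>c. \<exists>x\<in>set (xs c). P x c)"
  by (rule pt_cong[of D "\<lambda>c. \<not> (filter (\<lambda>x. P x c) (xs c) = [])"], intro pt assms)
    (auto simp: filter_empty_conv)

lemma pt_mem[pt]:
  assumes "pt_on D x" "pt_on D xs"
  shows "pt_on D (\<lambda>c. x c \<in> set (xs c))"
proof -
  have "pt_on D (\<lambda>c. \<exists>y\<in>set (xs c). y = x c)"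
    by (rule pt_Bex[OF assms(2)], rule pt_eq[OF pt_fst[OF pt_id] pt_comp[OF assms(1) pt_snd[OF pt_id]]]) auto
  then show ?thesis by simp
qed

section \<open>Arithmetic on unary numbers, enumeration and removal of repetitions\<close>

lemma pt_length[pt]: "pt_on D xs \<Longrightarrow> pt_on D (\<lambda>c. length (xs c))"
  using pt_map[OF _ pt_const, of D xs "()"] by (intro pt_of_units) (simp add: map_replicate_const)

lemma pt_add[pt]:
  fixes f g :: "'a::enc \<Rightarrow> nat"
  assumes "pt_on D f" "pt_on D g"
  shows "pt_on D (\<lambda>c. f c + g c)"
  by (rule pt_of_units, unfold replicate_add, intro pt_append pt_units assms)

lemma fold_tl: "fold (\<lambda>_ s. tl s) xs ys = drop (length xs) ys"
  by (induction xs arbitrary: ys) (auto simp: drop_Suc)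

lemma sz_drop: "sz (drop i xs) \<le> sz xs"
  using sz_append[of "take i xs" "drop i xs"] sz_ge[of "take i xs"] by simp

lemma pt_drop[pt]:
  assumes "pt_on D n" "pt_on D xs"
  shows "pt_on D (\<lambda>c. drop (n c) (xs c))"
proof -
  have "pt_on D (\<lambda>c. fold (\<lambda>_ s. tl s) (replicate (n c) ()) (xs c))"
    by (rule pt_fold[where E = UNIV and Bd = "\<lambda>c. sz (xs c)"], intro pt_units assms, rule assms, intro pt,
        rule UNIV_I, intro pt_sz assms, unfold fold_tl, rule sz_drop)
  then show ?thesis unfolding fold_tl by simp
qed

lemma pt_diff[pt]:
  fixes f g :: "'a::enc \<Rightarrow> nat"
  assumes "pt_on D f" "pt_on D g"
  shows "pt_on D (\<lambda>c. f c - g c)"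
proof (rule pt_of_units)
  have "pt_on D (\<lambda>c. drop (g c) (replicate (f c) ()))" by (intro pt_drop pt_units assms)
  then show "pt_on D (\<lambda>c. replicate (f c - g c) ())" by simp
qed

lemma pt_le[pt]: "pt_on D f \<Longrightarrow> pt_on D g \<Longrightarrow> pt_on D (\<lambda>c. f c \<le> (g c :: nat))"
  by (rule pt_cong[of D "\<lambda>c. f c - g c = 0"], intro pt) auto

lemma pt_max[pt]: "pt_on D f \<Longrightarrow> pt_on D g \<Longrightarrow> pt_on D (\<lambda>c. max (f c) (g c :: nat))"
  unfolding max_def by (intro pt)

lemma pt_sum_list[pt]:
  fixes xs :: "'a::enc \<Rightarrow> nat list"
  assumes "pt_on D xs"
  shows "pt_on D (\<lambda>c. sum_list (xs c))"
proof (rule pt_of_units)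
  have *: "concat (map (\<lambda>n. replicate n ()) ys) = replicate (sum_list ys) ()" for ys
    by (induction ys) (auto simp: replicate_add)
  have "pt_on D (\<lambda>c. concat (map (\<lambda>n. replicate n ()) (xs c)))"
    by (intro pt_concat_map assms pt_units pt_fst pt_id)
  then show "pt_on D (\<lambda>c. replicate (sum_list (xs c)) ())" by (simp add: *)
qed

definition max_list :: "nat list \<Rightarrow> nat" where
  "max_list xs = fold max xs 0"

lemma max_list_Cons: "fold max xs (a::nat) = Max (insert a (set xs))"
  using Max.set_eq_fold[of a xs] by (simp del: Max.set_eq_fold)

lemma max_list_ge: "x \<in> set xs \<Longrightarrow> x \<le> max_list xs"
  unfolding max_list_def max_list_Cons by simp

lemma max_list_mem: "max_list xs \<in> insert 0 (set xs)"
  unfolding max_list_def max_list_Cons by (rule Max_in) auto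

lemma pt_max_list[pt]:
  assumes "pt_on D xs"
  shows "pt_on D (\<lambda>c. max_list (xs c))"
  unfolding max_list_def
proof (rule pt_fold[where f = "\<lambda>x s c. max x s" and E = UNIV and Bd = "\<lambda>c. sz (xs c) + 2"])
  show "pb D (\<lambda>c. sz (xs c) + 2)" by (intro pb_intros pt_sz assms)
  fix c i
  have "max_list (take i (xs c)) \<in> insert 0 (set (xs c))"
    using max_list_mem[of "take i (xs c)"] by (auto dest: in_set_takeD)
  then show "sz (fold max (take i (xs c)) 0) \<le> sz (xs c) + 2"
    using sz_mem[of "max_list (take i (xs c))" "xs c"] unfolding max_list_def by auto
qed (auto intro!: pt assms)

text \<open>Descending, because the loop that produces it pushes its counter onto the front.\<close>

definition dn :: "nat \<Rightarrow> nat list" where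
  "dn n = rev [0..<n]"

lemma fold_count:
  "fold (\<lambda>_ s. (Suc (fst s), fst s # snd s)) xs (0, []) = (length xs, rev [0..<length xs])"
  by (induction xs rule: rev_induct) auto

lemma pt_dn[pt]:
  assumes "pt_on D n"
  shows "pt_on D (\<lambda>c. dn (n c))"
proof -
  have "pt_on D (\<lambda>c. fold (\<lambda>_ s. (Suc (fst s), fst s # snd s)) (replicate (n c) ()) (0, []))"
  proof (rule pt_fold[where E = UNIV and Bd = "\<lambda>c. sz (n c) + (2 + sz (n c) * sz (n c))"])
    show "pb D (\<lambda>c. sz (n c) + (2 + sz (n c) * sz (n c)))" by (intro pb_intros pt_sz assms)
    fix c i assume i: "i \<le> length (replicate (n c) ())"
    have "sz (rev [0..<i]) \<le> 2 + length (rev [0..<i]) * sz (n c)"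
      by (rule sz_list_le) (use i in auto)
    also have "\<dots> \<le> 2 + sz (n c) * sz (n c)" using i by (intro add_mono mult_le_mono) auto
    finally show "sz (fold (\<lambda>_ s. (Suc (fst s), fst s # snd s)) (take i (replicate (n c) ())) (0, []))
        \<le> sz (n c) + (2 + sz (n c) * sz (n c))"
      using i unfolding fold_count by (simp add: min_def)
  qed (auto intro!: pt pt_units assms)
  from pt_snd[OF this] show ?thesis unfolding fold_count by (simp add: dn_def)
qed

lemma set_dn[simp]: "set (dn n) = {..<n}" and distinct_dn[simp]: "distinct (dn n)"
  and length_dn[simp]: "length (dn n) = n"
  by (auto simp: dn_def)

text \<open>A fold in place of \<open>remdups\<close>, so that \<open>pt_fold\<close> applies
  directly.\<close>

definition dedup :: "'a list \<Rightarrow> 'a list" where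
  "dedup xs = fold (\<lambda>x s. if x \<in> set s then s else x # s) xs []"

lemma set_dedup[simp]: "set (dedup xs) = set xs" and distinct_dedup[simp]: "distinct (dedup xs)"
proof -
  have "set (dedup xs) = set xs \<and> distinct (dedup xs)"
    unfolding dedup_def by (induction xs rule: rev_induct) auto
  then show "set (dedup xs) = set xs" "distinct (dedup xs)" by auto
qed

lemma sz_dedup: "sz (dedup xs) \<le> sz xs"
proof (induction xs rule: rev_induct)
  case (snoc x xs)
  have "dedup (xs @ [x]) = (if x \<in> set (dedup xs) then dedup xs else x # dedup xs)"
    unfolding dedup_def by simp
  then have "sz (dedup (xs @ [x])) \<le> sz x + sz (dedup xs)" by auto
  then show ?case using snoc sz_append[of xs "[x]"] by simp
qed (simp add: dedup_def)

lemma pt_dedup[pt]: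
  assumes "pt_on D xs"
  shows "pt_on D (\<lambda>c. dedup (xs c))"
  unfolding dedup_def
proof (rule pt_fold[where f = "\<lambda>x s c. if x \<in> set s then s else x # s" and E = UNIV and Bd = "\<lambda>c. sz (xs c)"])
  show "pb D (\<lambda>c. sz (xs c))" by (intro pt_sz assms)
  fix c i
  show "sz (fold (\<lambda>x s. if x \<in> set s then s else x # s) (take i (xs c)) []) \<le> sz (xs c)"
    using le_trans[OF sz_dedup sz_take] unfolding dedup_def by blast
qed (auto intro!: pt assms)

lemma computes_hd: "computes {xs. xs \<noteq> []} hd (\<lambda>_. 3)"
  unfolding computes_def
  by (rule exI[of _ "Case (Var 0) Empty (Var 0)"])
    (auto intro!: runs_mono[OF runs_Case_Cell[OF runs_Var_0 runs_Var_0]] simp: enc_Cons neq_Nil_conv)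

lemma pt_hd: "pt_on D f \<Longrightarrow> (\<And>c. c \<in> D \<Longrightarrow> f c \<noteq> []) \<Longrightarrow> pt_on D (\<lambda>c. hd (f c))"
  by (rule pt_comp[of "{xs. xs \<noteq> []}" hd], rule pt_onI[OF computes_hd])
    (auto intro: pb_intros pb_mono[OF pb_sz] simp: neq_Nil_conv)

text \<open>Each branch is needed only on the inputs that reach it, which admits \<open>hd\<close>
  behind a test for the empty list.\<close>

lemma pt_if_dom:
  assumes "pt_on D b" "pt_on {c\<in>D. b c} f" "pt_on {c\<in>D. \<not> b c} g"
  shows "pt_on D (\<lambda>c. if b c then f c else g c)"
proof -
  obtain Tb where b: "computes D b Tb" "pb D Tb" using assms(1) by (rule pt_onE)
  obtain Tf where f: "computes {c\<in>D. b c} f Tf" "pb {c\<in>D. b c} Tf" "pb {c\<in>D. b c} (\<lambda>c. sz (f c))"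
    using assms(2) by (rule pt_onE)
  obtain Tg where g: "computes {c\<in>D. \<not> b c} g Tg" "pb {c\<in>D. \<not> b c} Tg" "pb {c\<in>D. \<not> b c} (\<lambda>c. sz (g c))"
    using assms(3) by (rule pt_onE)
  have pb_If: "pb D (\<lambda>c. if b c then s c else t c)"
    if s: "pb {c\<in>D. b c} s" and t: "pb {c\<in>D. \<not> b c} t" for s t
  proof -
    have "pb D (\<lambda>c. (if b c then s c else 0) + (if b c then 0 else t c))"
      using s t unfolding pb_def by (intro pb_add[unfolded pb_def]) (auto simp: Ball_def)
    then show ?thesis by (rule pb_mono) auto
  qed
  show ?thesis
  proof (rule pt_onI[OF computes_if[OF b(1) f(1) g(1)]])
    show "pb D (\<lambda>c. Tb c + (if b c then Tf c else Tg c) + 5)"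
      by (intro pb_add b pb_const pb_If f g)
    show "pb D (\<lambda>c. sz (if b c then f c else g c))"
      by (rule pb_mono[OF pb_If[OF f(3) g(3)]]) auto
  qed
qed

lemma fold_zip:
  "fold (\<lambda>x s. (tl (fst s), if fst s = [] then snd s else (x, hd (fst s)) # snd s)) xs (ys, zs)
    = (drop (length xs) ys, rev (zip xs ys) @ zs)"
proof (induction xs arbitrary: ys zs)
  case (Cons x xs)
  then show ?case by (cases ys) auto
qed simp

lemma sz_zip: "sz (zip xs ys) \<le> sz xs + sz ys"
proof (induction xs arbitrary: ys)
  case (Cons x xs)
  show ?case
  proof (cases ys)
    case (Cons y ys')
    then show ?thesis using Cons.IH[of ys'] by simp
  qed simp
qed simp

lemma pt_zip[pt]:
  assumes "pt_on D xs" "pt_on D ys"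
  shows "pt_on D (\<lambda>c. zip (xs c) (ys c))"
proof -
  have "pt_on D (\<lambda>c. fold (\<lambda>x s. (tl (fst s), if fst s = [] then snd s else (x, hd (fst s)) # snd s)) (xs c) (ys c, []))"
  proof (rule pt_fold[where E = UNIV and Bd = "\<lambda>c. sz (ys c) + (sz (xs c) + sz (ys c))"])
    show "pb D (\<lambda>c. sz (ys c) + (sz (xs c) + sz (ys c)))" by (intro pb_intros pt_sz assms)
    show "pt_on UNIV (\<lambda>p :: 'b \<times> ('c list \<times> ('b \<times> 'c) list) \<times> 'a. (tl (fst (fst (snd p))),
      if fst (fst (snd p)) = [] then snd (fst (snd p)) else (fst p, hd (fst (fst (snd p)))) # snd (fst (snd p))))"
      by (intro pt pt_if_dom pt_hd) auto
    fix c i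
    show "sz (fold (\<lambda>x s. (tl (fst s), if fst s = [] then snd s else (x, hd (fst s)) # snd s)) (take i (xs c)) (ys c, []))
      \<le> sz (ys c) + (sz (xs c) + sz (ys c))"
      unfolding fold_zip
      using sz_drop[of "length (take i (xs c))" "ys c"] sz_zip[of "take i (xs c)" "ys c"] sz_take[of i "xs c"]
      by (simp add: sz_rev)
  qed (intro pt assms UNIV_I)+
  from pt_rev[OF pt_snd[OF this]] show ?thesis unfolding fold_zip by simp
qed

lemma pt_mult[pt]:
  fixes f g :: "'a::enc \<Rightarrow> nat"
  assumes "pt_on D f" "pt_on D g"
  shows "pt_on D (\<lambda>c. f c * g c)"
proof -
  have "pt_on D (\<lambda>c. sum_list (map (\<lambda>_. g c) (dn (f c))))"
    by (intro pt assms pt_comp[OF assms(2) pt_snd[OF pt_id]]) auto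
  moreover have "sum_list (map (\<lambda>_. m) (dn n)) = n * m" for m n :: nat
    by (simp add: map_replicate_const sum_list_replicate)
  ultimately show ?thesis by simp
qed

text \<open>The quotient counts the positive multiples of \<open>g\<close> up to \<open>p\<close>.
  Products, comparisons and a filter are already available as programs.\<close>

lemma div_eq_length_filter: "0 < g \<Longrightarrow> length (filter (\<lambda>i. Suc i * g \<le> p) (dn p)) = p div g"
proof -
  assume g: "0 < g"
  have "length (filter (\<lambda>i. Suc i * g \<le> p) (dn p)) = card (set (filter (\<lambda>i. Suc i * g \<le> p) (dn p)))"
    by (rule distinct_card[symmetric]) simp
  also have "set (filter (\<lambda>i. Suc i * g \<le> p) (dn p)) = {..<p div g}"
  proof -
    have "i < p" if "Suc i * g \<le> p" for i
    proof -
      have "Suc i * 1 \<le> Suc i * g" using g by (intro mult_le_mono2) simp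
      then have "Suc i \<le> Suc i * g" by (simp del: mult_Suc)
      then show ?thesis using that by (meson Suc_le_lessD le_trans)
    qed
    then show ?thesis using g by (auto simp: less_eq_div_iff_mult_less_eq Suc_le_eq[symmetric] simp del: mult_Suc)
  qed
  finally show ?thesis by simp
qed

lemma pt_div_const:
  fixes f :: "'a::enc \<Rightarrow> nat"
  assumes "pt_on D f" "0 < g"
  shows "pt_on D (\<lambda>c. f c div g)"
  unfolding div_eq_length_filter[OF assms(2), symmetric]
  by (intro pt assms pt_comp[OF assms(1) pt_snd[OF pt_id]]) auto

lemma pt_snd_ctx: "pt_on D f \<Longrightarrow> pt_on {p. snd p \<in> D \<and> Q p} (\<lambda>p. f (snd p))"
  by (rule pt_comp[OF _ pt_snd[OF pt_id]]) auto

text \<open>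
  The exponent below depends on the loop body only.  It is therefore available before any of the
  parameters on which the length of the intermediate states depends is fixed.
\<close>

lemma fold_exponent:
  assumes xs: "pt_on UNIV xs" and s: "pt_on UNIV s0"
    and f: "pt_on UNIV (\<lambda>p. f (fst p) (fst (snd p)) (snd (snd p)))"
  shows "\<exists>a. \<forall>D B. (\<forall>c\<in>D. sz c \<le> B c \<and> (\<forall>i\<le>length (xs c). sz (fold (\<lambda>x s. f x s c) (take i (xs c)) (s0 c)) \<le> B c))
    \<longrightarrow> computes D (\<lambda>c. fold (\<lambda>x s. f x s c) (xs c) (s0 c)) (\<lambda>c. B c ^ a)"
proof -
  obtain Tx where tx: "computes UNIV xs Tx" "pb UNIV Tx" "pb UNIV (\<lambda>c. sz (xs c))" using xs by (rule pt_onE)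
  obtain Ts where ts: "computes UNIV s0 Ts" "pb UNIV Ts" using s by (rule pt_onE)
  obtain Tf where tf: "computes UNIV (\<lambda>p. f (fst p) (fst (snd p)) (snd (snd p))) Tf" "pb UNIV Tf" using f by (rule pt_onE)
  obtain a where a: "\<And>c. Tf c \<le> sz c ^ a" using tf unfolding pb_def by blast
  obtain a1 where a1: "\<And>c. Tx c \<le> sz c ^ a1" using tx unfolding pb_def by blast
  obtain a2 where a2: "\<And>c. sz (xs c) \<le> sz c ^ a2" using tx unfolding pb_def by blast
  obtain a3 where a3: "\<And>c. Ts c \<le> sz c ^ a3" using ts unfolding pb_def by blast
  \<comment> \<open>a bound for the cost as a function of a size bound, itself viewed as a polynomial in an encodable number\<close>
  define R where "R = (\<lambda>b::nat. b ^ a1 + b ^ a3 + (b ^ a2 + 1) * ((b ^ a2 + (b + b)) ^ a + 30))"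
  have "pb UNIV R" unfolding R_def
    by (intro pb_intros pb_mono[OF pb_sz]) auto
  then obtain a4 where a4: "\<And>b. R b \<le> sz b ^ a4" unfolding pb_def by blast
  have main: "computes D (\<lambda>c. fold (\<lambda>x s. f x s c) (xs c) (s0 c)) (\<lambda>c. B c ^ (3 * a4))"
    if B: "\<And>c. c \<in> D \<Longrightarrow> sz c \<le> B c"
      and it: "\<And>c i. c \<in> D \<Longrightarrow> i \<le> length (xs c) \<Longrightarrow> sz (fold (\<lambda>x s. f x s c) (take i (xs c)) (s0 c)) \<le> B c" for D B
  proof -
    have xsB: "sz (xs c) \<le> B c ^ a2" if "c \<in> D" for c
      using a2[of c] power_mono[OF B[OF that], of a2] by (meson le_trans zero_le)
    have "computes D (\<lambda>c. fold (\<lambda>x s. f x s c) (xs c) (s0 c))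
        (\<lambda>c. Tx c + Ts c + (length (xs c) + 1) * ((B c ^ a2 + (B c + B c)) ^ a + 30))"
    proof -
      have "computes D xs Tx" "computes D s0 Ts" using tx ts by (auto elim: computes_mono)
      moreover have "Tf (xs c ! i, fold (\<lambda>x s. f x s c) (take i (xs c)) (s0 c), c) \<le> (B c ^ a2 + (B c + B c)) ^ a"
        if "c \<in> D" "i < length (xs c)" for c i
      proof (rule le_trans[OF a], rule power_mono)
        show "sz (xs c ! i, fold (\<lambda>x s. f x s c) (take i (xs c)) (s0 c), c) \<le> B c ^ a2 + (B c + B c)"
          using B[OF that(1)] it[OF that(1), of i] xsB[OF that(1)] sz_mem[OF nth_mem[OF that(2)]] that(2) by simp
      qed simp
      ultimately show ?thesis
        using computes_fold[of D xs Tx s0 Ts UNIV _ Tf "\<lambda>c. (B c ^ a2 + (B c + B c)) ^ a", OF _ _ tf(1)] by simp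
    qed
    then show ?thesis
    proof (rule computes_mono)
      fix c assume c: "c \<in> D"
      have "2 \<le> B c" using B[OF c] sz_ge[of c] by linarith
      have "length (xs c) \<le> B c ^ a2" using xsB[OF c] sz_length[of "xs c"] by linarith
      moreover have "Tx c \<le> B c ^ a1" "Ts c \<le> B c ^ a3"
        using a1[of c] a3[of c] power_mono[OF B[OF c], of a1] power_mono[OF B[OF c], of a3] by (meson le_trans zero_le)+
      ultimately have "Tx c + Ts c + (length (xs c) + 1) * ((B c ^ a2 + (B c + B c)) ^ a + 30) \<le> R (B c)"
        unfolding R_def by (intro add_mono mult_le_mono) auto
      also have "\<dots> \<le> sz (B c) ^ a4" by (rule a4)
      \<comment> \<open>A number \<open>b\<close> has size \<open>2 * b + 2\<close>, at most
        \<open>b ^ 3\<close> once \<open>b\<close> is at least 2; hence the factor 3 in the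
        exponent.\<close>
      also have "\<dots> \<le> (B c ^ 3) ^ a4"
      proof (intro power_mono)
        have "2 * B c + 2 \<le> 4 * B c" using \<open>2 \<le> B c\<close> by simp
        also have "\<dots> \<le> (B c * B c) * B c" using \<open>2 \<le> B c\<close> mult_le_mono[of 2 "B c" 2 "B c"] by (intro mult_le_mono1) simp
        finally show "sz (B c) \<le> B c ^ 3" by (simp add: power3_eq_cube)
      qed simp
      finally show "Tx c + Ts c + (length (xs c) + 1) * ((B c ^ a2 + (B c + B c)) ^ a + 30) \<le> B c ^ (3 * a4)"
        by (simp add: power_mult)
    qed auto
  qed
  show ?thesis by (rule exI[of _ "3 * a4"]) (use main in blast)
qed

lemma fold_Bex: "fold (\<lambda>x s. if s then True else P x) xs b \<longleftrightarrow> b \<or> (\<exists>x\<in>set xs. P x)"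
  by (induction xs arbitrary: b) auto

text \<open>\<open>pt_Bex\<close> does not suffice for the search, whose innermost test runs the Set
  Cover program; the time of the test is therefore an explicit parameter.\<close>

lemma computes_Bex:
  assumes xs: "computes D xs Tx"
    and P: "computes {p. snd p \<in> D \<and> fst p \<in> set (xs (snd p))} (\<lambda>p. P (fst p) (snd p)) Tp"
    and B: "\<And>c x. c \<in> D \<Longrightarrow> x \<in> set (xs c) \<Longrightarrow> Tp (x, c) \<le> B c"
  shows "computes D (\<lambda>c. \<exists>x\<in>set (xs c). P x c) (\<lambda>c. Tx c + (length (xs c) + 2) * (B c + 70))"
proof -
  let ?E = "{p. snd p \<in> D \<and> fst p \<in> set (xs (snd p))}"
  let ?F = "{p :: _ \<times> bool \<times> _. (fst p, snd (snd p)) \<in> ?E}"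
  have fst_snd: "computes ?F (\<lambda>p. fst (snd p)) (\<lambda>_. 8)" and snd_snd: "computes ?F (\<lambda>p. snd (snd p)) (\<lambda>_. 8)"
    by (rule computes_mono[OF computes_comp[OF computes_snd computes_fst]]
        computes_mono[OF computes_comp[OF computes_snd computes_snd]]; simp)+
  have "computes ?F (\<lambda>p. (fst p, snd (snd p))) (\<lambda>_. 12)"
    by (rule computes_mono[OF computes_Pair[OF computes_mono[OF computes_fst] snd_snd]]) auto
  from computes_comp[OF this P] have "computes ?F (\<lambda>p. P (fst p) (snd (snd p))) (\<lambda>p. 12 + Tp (fst p, snd (snd p)) + 2)"
    by simp
  then have "computes {c \<in> ?F. \<not> fst (snd c)} (\<lambda>p. P (fst p) (snd (snd p))) (\<lambda>p. 12 + Tp (fst p, snd (snd p)) + 2)"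
    by (rule computes_mono) auto
  from computes_if[OF fst_snd computes_const[of _ True] this]
  have *: "computes ?F (\<lambda>p. if fst (snd p) then True else P (fst p) (snd (snd p)))
      (\<lambda>p. 31 + Tp (fst p, snd (snd p)))"
    by (rule computes_mono) (simp_all del: split_paired_All)
  have "computes D (\<lambda>c. fold (\<lambda>x s. if s then True else P x c) (xs c) False)
      (\<lambda>c. Tx c + sz False + (length (xs c) + 1) * ((B c + 31) + 30))"
    using computes_fold[OF xs computes_const[of D False] *, where B = "\<lambda>c. B c + 31", unfolded fst_conv snd_conv] B
    by simp
  then show ?thesis unfolding fold_Bex by (rule computes_mono) (auto simp: algebra_simps)
qed

section \<open>The algorithm\<close>

text \<open>The input lists an edge in one of its two orders, and it is not known in which.\<close>

definition edge :: "nat list list \<Rightarrow> nat \<Rightarrow> nat \<Rightarrow> bool" where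
  "edge Es a b \<longleftrightarrow> [a, b] \<in> set Es \<or> [b, a] \<in> set Es"

text \<open>The ranges force \<open>c < b < a\<close>, so each triangle is represented by exactly
  one list.\<close>

definition tris :: "nat \<Rightarrow> nat list list \<Rightarrow> nat list list" where
  "tris n Es = dedup (concat (map (\<lambda>a. concat (map (\<lambda>b. concat (map (\<lambda>c.
     if edge Es a b \<and> edge Es a c \<and> edge Es b c then [[a, b, c]] else []) (dn b))) (dn a))) (dn n)))"

definition grow :: "nat \<Rightarrow> nat list list \<Rightarrow> nat list \<Rightarrow> nat list \<Rightarrow> nat list" where
  "grow n Es Qs X = filter (\<lambda>u. u \<notin> set Qs \<and> (u \<in> set X \<or> (\<exists>x\<in>set X. edge Es x u))) (dn n)"

text \<open>A shortest path has at most as many edges as there are ordered pairs of vertices, hence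
  \<open>n * n\<close> rounds. The result is always a sublist of \<open>dn n\<close>, which makes it
  canonical. A triangle inside the hub gets the empty component.\<close>

definition component_of :: "nat \<Rightarrow> nat list list \<Rightarrow> nat list \<Rightarrow> nat list \<Rightarrow> nat list" where
  "component_of n Es Qs t = fold (\<lambda>_ X. grow n Es Qs X) (dn (n * n))
     (filter (\<lambda>u. u \<in> set t \<and> u \<notin> set Qs) (dn n))"

definition key_of :: "nat list list \<Rightarrow> nat list \<Rightarrow> nat list \<Rightarrow> nat list \<Rightarrow> nat list" where
  "key_of Es Qs K t = filter (\<lambda>q. q \<in> set t \<or> (\<exists>x\<in>set K. edge Es q x)) Qs"

definition ident :: "nat \<Rightarrow> nat list list \<Rightarrow> nat list \<Rightarrow> nat list \<Rightarrow> nat list \<times> nat list" where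
  "ident n Es Qs t = (component_of n Es Qs t, key_of Es Qs (component_of n Es Qs t) t)"

text \<open>The component distinguishes classes but is not stored, so several classes may carry the
  same key.\<close>

definition classes :: "nat \<Rightarrow> nat list list \<Rightarrow> nat list \<Rightarrow> (nat list \<times> nat list list) list" where
  "classes n Es Qs = map (\<lambda>i. (snd i, filter (\<lambda>t. ident n Es Qs t = i) (tris n Es)))
     (dedup (map (\<lambda>t. ident n Es Qs t) (tris n Es)))"

text \<open>
  A move occupies the vertices in its first component and gains its second component.  The flag
  of a step is set where the vertices outside of the hub are forgotten.
\<close>

type_synonym move = "nat list \<times> nat"
type_synonym state = "nat list \<times> nat"

definition steps :: "move list \<Rightarrow> (bool \<times> move) list" where
  "steps ms = map (\<lambda>m. (False, m)) ms @ [(True, ([], 0))]"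

text \<open>At a flagged step states are reduced to their hub vertices in the order of
  \<open>Qs\<close>, and those with more than \<open>k\<close> of them are dropped. Vertices outside
  the hub do not recur in later classes, so nothing relevant is lost, and the number of states no
  longer depends on the number of classes.\<close>

definition dp_step :: "bool \<times> move \<Rightarrow> state list \<Rightarrow> nat list \<Rightarrow> nat \<Rightarrow> state list" where
  "dp_step x S Qs k =
     (if fst x
      then dedup (filter (\<lambda>s. length (fst s) \<le> k) (map (\<lambda>s. (filter (\<lambda>q. q \<in> set (fst s)) Qs, snd s)) S))
      else S @ concat (map (\<lambda>s. if \<exists>u\<in>set (fst (snd x)). u \<in> set (fst s) then []
                                else [(fst (snd x) @ fst s, snd (snd x) + snd s)]) S))"

definition dp :: "nat list \<Rightarrow> nat \<Rightarrow> move list list \<Rightarrow> state list" where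
  "dp Qs k mss = fold (\<lambda>x S. dp_step x S Qs k) (concat (map (\<lambda>ms. steps ms) mss)) [([], 0)]"

text \<open>Waste moves let a block contain hub vertices that none of its triangles uses.\<close>

definition waste :: "nat list \<Rightarrow> move list list" where
  "waste Qs = map (\<lambda>q. [([q], 0)]) Qs"

text \<open>Addition modulo \<open>r\<close>, for arguments below \<open>r\<close>.\<close>

definition shift :: "nat \<Rightarrow> nat \<Rightarrow> nat \<Rightarrow> nat" where
  "shift r c a = (if r \<le> a + c then a + c - r else a + c)"

text \<open>
  Every labelling is extended by each of its \<open>r\<close> shifted copies in turn, so that two given positions
  receive the same label in at most a fraction \<open>1/r\<close> of the labellings.
\<close>

definition double_labels :: "nat \<Rightarrow> nat list list \<Rightarrow> nat list list" where
  "double_labels r L = concat (map (\<lambda>lab. map (\<lambda>c. lab @ map (\<lambda>a. shift r c a) lab) (dn r)) L)"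

text \<open>The list \<open>Is\<close> only supplies enough rounds: doubling stops as soon as the
  labellings are long enough to label every key.\<close>

definition labels :: "nat list list \<Rightarrow> nat \<Rightarrow> nat list list" where
  "labels Is r = fold (\<lambda>_ L. if \<exists>lab\<in>set L. length Is \<le> length lab then L else double_labels r L) Is [[0]]"

definition vectors :: "(bool \<times> nat \<times> nat) list \<Rightarrow> nat \<Rightarrow> (bool \<times> nat \<times> nat) list list" where
  "vectors os r = fold (\<lambda>_ L. concat (map (\<lambda>x. map (\<lambda>g. x # g) L) os)) (dn r) [[]]"

text \<open>
  A guess \<open>(b, s, w)\<close> for a bucket says whether the bucket is overfull, how many hub vertices it is assigned, and
  how many triangles it contributes beyond those that avoid the hub.
\<close>

definition choices :: "nat \<Rightarrow> (bool \<times> nat \<times> nat) list" where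
  "choices m = concat (map (\<lambda>b. concat (map (\<lambda>s. map (\<lambda>w. (b, s, w)) (dn (Suc m))) (dn (Suc m)))) [True, False])"

definition bucket :: "(nat list \<times> nat list list) list \<Rightarrow> nat list list \<Rightarrow> nat list \<Rightarrow> nat \<Rightarrow> move list list" where
  "bucket cls Is lab j = concat (map (\<lambda>c. if (fst c, j) \<in> set (zip Is lab) then [map (\<lambda>t. (t, 1)) (snd c)] else []) cls)"

text \<open>The triangles of an overfull bucket belong to \<open>tail\<close>, so its block is
  empty.\<close>

definition block :: "(nat list \<times> nat list list) list \<Rightarrow> nat list list \<Rightarrow> nat list \<Rightarrow> nat \<times> bool \<times> nat \<times> nat \<Rightarrow> move list list" where
  "block cls Is lab x = (if fst (snd x) then [] else bucket cls Is lab (fst x))"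

definition tail :: "(nat list \<times> nat list list) list \<Rightarrow> nat list list \<Rightarrow> nat list \<Rightarrow> (nat \<times> bool \<times> nat \<times> nat) list \<Rightarrow> move list list" where
  "tail cls Is lab xs = concat (map (\<lambda>c. if \<exists>x\<in>set xs. fst (snd x) \<and> (fst c, fst x) \<in> set (zip Is lab)
     then [map (\<lambda>t. (t, 1)) (snd c)] else []) cls)"

text \<open>With the limit 0 only packings that avoid the hub survive, so this is the largest number
  of triangles that the moves yield for free.\<close>

definition base :: "nat list \<Rightarrow> move list list \<Rightarrow> nat" where
  "base Qs mss = max_list (map (\<lambda>s. snd s) (dp Qs 0 mss))"

definition need :: "nat list \<Rightarrow> (nat list \<times> nat list list) list \<Rightarrow> nat list list \<Rightarrow> nat list \<Rightarrow> (nat \<times> bool \<times> nat \<times> nat) list \<Rightarrow> nat" where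
  "need Qs cls Is lab xs = sum_list (map (\<lambda>x. base Qs (block cls Is lab x) + snd (snd (snd x))) xs)"

text \<open>The sizes must agree exactly with the guess, which the waste moves make possible; the
  gain only has to reach it.\<close>

definition block_sets :: "nat \<Rightarrow> nat list \<Rightarrow> (nat list \<times> nat list list) list \<Rightarrow> nat list list \<Rightarrow> nat list \<Rightarrow> (nat \<times> bool \<times> nat \<times> nat) list \<Rightarrow> (nat list \<times> nat) list" where
  "block_sets m Qs cls Is lab xs = concat (map (\<lambda>x. map (\<lambda>s. (fst s, fst x))
     (filter (\<lambda>s. length (fst s) = fst (snd (snd x)) \<and> base Qs (block cls Is lab x) + snd (snd (snd x)) \<le> snd s)
       (dp Qs m (block cls Is lab x @ waste Qs)))) xs)"

definition positions :: "nat list \<Rightarrow> nat list \<Rightarrow> nat list" where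
  "positions Qs U = map (\<lambda>x. snd x) (filter (\<lambda>x. fst x \<in> set U) (zip Qs (rev (dn (length Qs)))))"

text \<open>Hub vertices are numbered by their positions in \<open>Qs\<close>, followed by two
  tokens per bucket. \<open>dedup\<close> is there because the same hub set may be reached with
  several gains, while a family is listed without repetition.\<close>

definition cover_family :: "nat list \<Rightarrow> nat \<Rightarrow> (nat list \<times> nat) list \<Rightarrow> nat list \<Rightarrow> nat list list" where
  "cover_family Qs r Ss T = map (\<lambda>x. [x]) (dn (length Qs + r + r)) @
     dedup (map (\<lambda>s. positions Qs (fst s) @ [length Qs + snd s, length Qs + r + snd s])
       (filter (\<lambda>s. \<not> (\<exists>q\<in>set (fst s). q \<in> set T)) Ss))"

section \<open>Polynomial-time building blocks, and uniform exponents for the three exponential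
  loops\<close>

lemma pt_edge[pt]:
  assumes "pt_on D Es" "pt_on D a" "pt_on D b"
  shows "pt_on D (\<lambda>c. edge (Es c) (a c) (b c))"
  unfolding edge_def by (intro pt assms)

lemma pt_tris[pt]:
  assumes "pt_on D n" "pt_on D Es"
  shows "pt_on D (\<lambda>c. tris (n c) (Es c))"
  by (rule pt_comp2[OF _ assms]) (unfold tris_def, intro pt)

text \<open>Every iterate is a sublist of \<open>dn n\<close>, so the state of the loop does not
  grow.\<close>

lemma pt_component_of[pt]:
  assumes "pt_on D n" "pt_on D Es" "pt_on D Qs" "pt_on D t"
  shows "pt_on D (\<lambda>c. component_of (n c) (Es c) (Qs c) (t c))"
proof (rule pt_comp4[OF _ assms], unfold component_of_def,
    rule pt_fold[where E = UNIV and Bd = "\<lambda>c. sz (dn (fst c))"])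
  have *: "sz (filter P xs) \<le> sz xs" for P and xs :: "nat list"
    by (induction xs) auto
  fix c :: "nat \<times> nat list list \<times> nat list \<times> nat list" and i
  have ex: "\<exists>P. fold (\<lambda>_ X. grow (fst c) (fst (snd c)) (fst (snd (snd c))) X) xs (filter P0 (dn (fst c))) = filter P (dn (fst c))"
    for P0 and xs :: "nat list"
    by (induction xs arbitrary: P0) (auto simp: grow_def)
  show "sz (fold (\<lambda>_ X. grow (fst c) (fst (snd c)) (fst (snd (snd c))) X) (take i (dn (fst c * fst c)))
      (filter (\<lambda>u. u \<in> set (snd (snd (snd c))) \<and> u \<notin> set (fst (snd (snd c)))) (dn (fst c)))) \<le> sz (dn (fst c))"
  proof -
    obtain P where "fold (\<lambda>_ X. grow (fst c) (fst (snd c)) (fst (snd (snd c))) X) (take i (dn (fst c * fst c)))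
      (filter (\<lambda>u. u \<in> set (snd (snd (snd c))) \<and> u \<notin> set (fst (snd (snd c)))) (dn (fst c))) = filter P (dn (fst c))"
      using ex by blast
    then show ?thesis using *[of P "dn (fst c)"] by (simp only:)
  qed
qed (unfold grow_def, (intro pt pt_sz UNIV_I)+)

lemma pt_key_of[pt]:
  assumes "pt_on D Es" "pt_on D Qs" "pt_on D K" "pt_on D t"
  shows "pt_on D (\<lambda>c. key_of (Es c) (Qs c) (K c) (t c))"
  by (rule pt_comp4[OF _ assms]) (unfold key_of_def, intro pt)

lemma pt_ident[pt]:
  assumes "pt_on D n" "pt_on D Es" "pt_on D Qs" "pt_on D t"
  shows "pt_on D (\<lambda>c. ident (n c) (Es c) (Qs c) (t c))"
  unfolding ident_def by (intro pt assms)

lemma pt_classes[pt]: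
  assumes "pt_on D n" "pt_on D Es" "pt_on D Qs"
  shows "pt_on D (\<lambda>c. classes (n c) (Es c) (Qs c))"
  by (rule pt_comp3[OF _ assms]) (unfold classes_def, intro pt)

lemma pt_steps[pt]: "pt_on D ms \<Longrightarrow> pt_on D (\<lambda>c. steps (ms c))"
  by (rule pt_comp_UNIV[of steps]) (unfold steps_def, intro pt)

lemma pt_dp_step[pt]:
  assumes "pt_on D x" "pt_on D S" "pt_on D Qs" "pt_on D k"
  shows "pt_on D (\<lambda>c. dp_step (x c) (S c) (Qs c) (k c))"
  by (rule pt_comp4[OF _ assms]) (unfold dp_step_def, intro pt)

text \<open>The size condition of \<open>pt_fold\<close> and \<open>fold_exponent\<close> for the
  dynamic program. It includes the state lists in the middle of a class, where vertices outside the
  hub are still recorded.\<close>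

definition dp_bounded :: "nat list \<Rightarrow> nat \<Rightarrow> move list list \<Rightarrow> nat \<Rightarrow> bool" where
  "dp_bounded Qs k mss b \<longleftrightarrow> (\<forall>i\<le>length (concat (map (\<lambda>ms. steps ms) mss)).
     sz (fold (\<lambda>x S. dp_step x S Qs k) (take i (concat (map (\<lambda>ms. steps ms) mss))) [([], 0)]) \<le> b)"

lemma pt_dp:
  assumes "pt_on D Qs" "pt_on D k" "pt_on D mss" "pb D B" "\<And>c. c \<in> D \<Longrightarrow> dp_bounded (Qs c) (k c) (mss c) (B c)"
  shows "pt_on D (\<lambda>c. dp (Qs c) (k c) (mss c))"
  unfolding dp_def
proof (rule pt_fold[where E = "{p. snd (snd p) \<in> D}" and Bd = B and f = "\<lambda>x S c. dp_step x S (Qs c) (k c)"])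
  have "pt_on {p :: (bool \<times> move) \<times> state list \<times> 'a. snd (snd p) \<in> D} (\<lambda>p. Qs (snd (snd p)))"
    by (rule pt_comp[OF assms(1)]) (intro pt, simp)
  moreover have "pt_on {p :: (bool \<times> move) \<times> state list \<times> 'a. snd (snd p) \<in> D} (\<lambda>p. k (snd (snd p)))"
    by (rule pt_comp[OF assms(2)]) (intro pt, simp)
  ultimately show "pt_on {p. snd (snd p) \<in> D} (\<lambda>p. dp_step (fst p) (fst (snd p)) (Qs (snd (snd p))) (k (snd (snd p))))"
    by (intro pt)
qed (use assms in \<open>(intro pt | simp add: dp_bounded_def)+\<close>)

text \<open>The first component of \<open>c\<close> carries the number of vertices, so that
  \<open>B\<close> can refer to it.\<close>

lemma dp_exponent:
  "\<exists>a. \<forall>D B. (\<forall>c\<in>D. sz (c :: nat \<times> _) \<le> B c \<and> dp_bounded (fst (snd c)) (fst (snd (snd c))) (snd (snd (snd c))) (B c))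
    \<longrightarrow> computes D (\<lambda>c. dp (fst (snd c)) (fst (snd (snd c))) (snd (snd (snd c)))) (\<lambda>c. B c ^ a)"
  unfolding dp_def dp_bounded_def
  by (rule fold_exponent[where f = "\<lambda>x S c. dp_step x S (fst (snd c)) (fst (snd (snd c)))"]) (intro pt)+

lemma labels_exponent:
  "\<exists>a. \<forall>D B. (\<forall>c\<in>D. sz c \<le> B c \<and> (\<forall>i\<le>length (fst c). sz (fold (\<lambda>_ L. if \<exists>lab\<in>set L. length (fst c) \<le> length lab then L
      else double_labels (snd c) L) (take i (fst c)) [[0]]) \<le> B c))
    \<longrightarrow> computes D (\<lambda>c. labels (fst c) (snd c)) (\<lambda>c. B c ^ a)"
  unfolding labels_def
  by (rule fold_exponent[where f = "\<lambda>_ L c. if \<exists>lab\<in>set L. length (fst c) \<le> length lab then L else double_labels (snd c) L"])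
   (unfold double_labels_def shift_def, (intro pt)+)

lemma vectors_exponent:
  "\<exists>a. \<forall>D B. (\<forall>c\<in>D. sz c \<le> B c \<and> (\<forall>i\<le>length (dn (snd c)). sz (fold (\<lambda>_ L. concat (map (\<lambda>x. map (\<lambda>g. x # g) L) (fst c)))
      (take i (dn (snd c))) [[]]) \<le> B c))
    \<longrightarrow> computes D (\<lambda>c. vectors (fst c) (snd c)) (\<lambda>c. B c ^ a)"
  unfolding vectors_def
  by (rule fold_exponent[where f = "\<lambda>_ L c. concat (map (\<lambda>x. map (\<lambda>g. x # g) L) (fst c))"]) (intro pt)+

lemma pt_waste[pt]: "pt_on D Qs \<Longrightarrow> pt_on D (\<lambda>c. waste (Qs c))"
  by (rule pt_comp_UNIV[of waste]) (unfold waste_def, intro pt)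

lemma pt_bucket[pt]:
  assumes "pt_on D cls" "pt_on D Is" "pt_on D lab" "pt_on D j"
  shows "pt_on D (\<lambda>c. bucket (cls c) (Is c) (lab c) (j c))"
  by (rule pt_comp4[OF _ assms]) (unfold bucket_def, intro pt)

lemma pt_block[pt]:
  assumes "pt_on D cls" "pt_on D Is" "pt_on D lab" "pt_on D x"
  shows "pt_on D (\<lambda>c. block (cls c) (Is c) (lab c) (x c))"
  by (rule pt_comp4[OF _ assms]) (unfold block_def, intro pt)

lemma pt_tail[pt]:
  assumes "pt_on D cls" "pt_on D Is" "pt_on D lab" "pt_on D xs"
  shows "pt_on D (\<lambda>c. tail (cls c) (Is c) (lab c) (xs c))"
  by (rule pt_comp4[OF _ assms]) (unfold tail_def, intro pt)

lemma pt_positions[pt]: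
  assumes "pt_on D Qs" "pt_on D U"
  shows "pt_on D (\<lambda>c. positions (Qs c) (U c))"
  by (rule pt_comp2[OF _ assms]) (unfold positions_def, intro pt)

lemma pt_cover_family[pt]:
  assumes "pt_on D Qs" "pt_on D r" "pt_on D Ss" "pt_on D T"
  shows "pt_on D (\<lambda>c. cover_family (Qs c) (r c) (Ss c) (T c))"
  by (rule pt_comp4[OF _ assms]) (unfold cover_family_def, intro pt)

section \<open>Correctness of the dynamic program\<close>

definition covered :: "move set \<Rightarrow> nat set" where
  "covered P = (\<Union>m\<in>P. set (fst m))"

definition compatible :: "move set \<Rightarrow> bool" where
  "compatible P \<longleftrightarrow> pairwise (\<lambda>m m'. disjnt (set (fst m)) (set (fst m'))) P"

definition gain :: "move set \<Rightarrow> nat" where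
  "gain P = (\<Sum>m\<in>P. snd m)"

definition restrict_to :: "nat list \<Rightarrow> nat set \<Rightarrow> nat list" where
  "restrict_to Qs A = filter (\<lambda>q. q \<in> A) Qs"

lemma set_restrict_to[simp]: "set (restrict_to Qs A) = set Qs \<inter> A"
  by (auto simp: restrict_to_def)

lemma length_restrict_to: "distinct Qs \<Longrightarrow> length (restrict_to Qs A) = card (set Qs \<inter> A)"
  by (metis set_restrict_to distinct_card distinct_filter restrict_to_def)

lemma restrict_to_eq_iff: "restrict_to Qs A = restrict_to Qs B \<longleftrightarrow> set Qs \<inter> A = set Qs \<inter> B"
  by (metis (no_types, lifting) Int_iff filter_cong restrict_to_def set_restrict_to)

lemma covered_Un: "covered (P \<union> P') = covered P \<union> covered P'"
  and covered_empty[simp]: "covered {} = {}"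
  and covered_insert: "covered (insert m P) = set (fst m) \<union> covered P"
  by (auto simp: covered_def)

lemma compatible_insert:
  "compatible (insert m P) \<longleftrightarrow> compatible P \<and> (\<forall>m'\<in>P. m' \<noteq> m \<longrightarrow> disjnt (set (fst m)) (set (fst m')))"
  unfolding compatible_def pairwise_insert by (auto simp: disjnt_sym)

lemma compatible_mono: "compatible P \<Longrightarrow> P' \<subseteq> P \<Longrightarrow> compatible P'"
  unfolding compatible_def by (rule pairwise_subset)

lemma compatible_Un:
  assumes "compatible P" "compatible P'" "covered P \<inter> covered P' = {}"
  shows "compatible (P \<union> P')"
  using assms unfolding compatible_def pairwise_def covered_def disjnt_def by blast

lemma compatible_disjoint:
  assumes "compatible (P \<union> P')" "P \<inter> P' = {}"
  shows "covered P \<inter> covered P' = {}"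
proof (rule ccontr)
  assume "covered P \<inter> covered P' \<noteq> {}"
  then obtain x m m' where "m \<in> P" "m' \<in> P'" "x \<in> set (fst m)" "x \<in> set (fst m')"
    unfolding covered_def by blast
  moreover from this have "m \<noteq> m'" using assms(2) by blast
  ultimately show False
    using assms(1) unfolding compatible_def pairwise_def disjnt_def by blast
qed

abbreviation extend_all :: "nat list \<Rightarrow> nat \<Rightarrow> move list \<Rightarrow> state list \<Rightarrow> state list" where
  "extend_all Qs k ms S \<equiv> fold (\<lambda>x S. dp_step x S Qs k) (map (\<lambda>m. (False, m)) ms) S"

text \<open>Within one class nothing is forgotten, so the states are extended by arbitrary disjoint
  collections of moves. Moves have to be nonempty: a move that is disjoint from a collection is then
  not a member of it, and the gains of the set add up.\<close>

lemma extend_all_iff: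
  assumes "\<forall>m\<in>set ms. fst m \<noteq> []"
  shows "(\<lambda>s. (set (fst s), snd s)) ` set (extend_all Qs k ms S) =
    {(covered P \<union> set (fst s), gain P + snd s) |P s. s \<in> set S \<and> P \<subseteq> set ms \<and> compatible P \<and> covered P \<inter> set (fst s) = {}}"
  using assms
proof (induction ms rule: rev_induct)
  case Nil
  then show ?case by (force simp: gain_def compatible_def)
next
  case (snoc m ms)
  let ?f = "\<lambda>s. (set (fst s), snd s)"
  let ?A = "?f ` set (extend_all Qs k ms S)"
  have m: "fst m \<noteq> []" using snoc.prems by simp
  have IH: "?A = {(covered P \<union> set (fst s), gain P + snd s) |P s. s \<in> set S \<and> P \<subseteq> set ms \<and> compatible P \<and> covered P \<inter> set (fst s) = {}}"
    using snoc by simp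
  have "?f ` set (extend_all Qs k (ms @ [m]) S) =
      ?A \<union> {(set (fst m) \<union> U, snd m + v) |U v. (U, v) \<in> ?A \<and> set (fst m) \<inter> U = {}}"
  proof -
    let ?S = "extend_all Qs k ms S"
    have "set (dp_step (False, m) ?S Qs k) =
        set ?S \<union> (\<lambda>s. (fst m @ fst s, snd m + snd s)) ` {s \<in> set ?S. set (fst m) \<inter> set (fst s) = {}}"
      unfolding dp_step_def by (auto split: if_splits)
    then have "?f ` set (extend_all Qs k (ms @ [m]) S) =
        ?A \<union> (\<lambda>s. (set (fst m) \<union> fst (?f s), snd m + snd (?f s))) ` {s \<in> set ?S. set (fst m) \<inter> fst (?f s) = {}}"
      by (simp add: image_Un image_image)
    also have "(\<lambda>s. (set (fst m) \<union> fst (?f s), snd m + snd (?f s))) ` {s \<in> set ?S. set (fst m) \<inter> fst (?f s) = {}}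
        = (\<lambda>s. (set (fst m) \<union> fst s, snd m + snd s)) ` {s \<in> ?A. set (fst m) \<inter> fst s = {}}"
      by blast
    also have "\<dots> = {(set (fst m) \<union> U, snd m + v) |U v. (U, v) \<in> ?A \<and> set (fst m) \<inter> U = {}}"
    proof -
      have "(\<lambda>s. (M \<union> fst s, b + snd s)) ` {s \<in> A. M \<inter> fst s = {}} = {(M \<union> U, b + v) |U v. (U, v) \<in> A \<and> M \<inter> U = {}}"
        (is "?I = ?C") for M :: "nat set" and b :: nat and A
      proof (intro equalityI subsetI)
        fix x assume "x \<in> ?I"
        then obtain s where s: "s \<in> A" "M \<inter> fst s = {}" "x = (M \<union> fst s, b + snd s)" by blast
        then have "(fst s, snd s) \<in> A" by simp
        then show "x \<in> ?C" using s(2,3) by blast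
      next
        fix x assume "x \<in> ?C"
        then obtain U v where s: "(U, v) \<in> A" "M \<inter> U = {}" "x = (M \<union> U, b + v)" by blast
        then show "x \<in> ?I" by (intro image_eqI[of _ _ "(U, v)"]) auto
      qed
      then show ?thesis .
    qed
    finally show ?thesis .
  qed
  also have "\<dots> = {(covered P \<union> set (fst s), gain P + snd s) |P s. s \<in> set S \<and> P \<subseteq> set (ms @ [m]) \<and> compatible P \<and> covered P \<inter> set (fst s) = {}}"
    (is "_ = ?R")
  proof (intro equalityI subsetI)
    fix x assume "x \<in> ?A \<union> {(set (fst m) \<union> U, snd m + v) |U v. (U, v) \<in> ?A \<and> set (fst m) \<inter> U = {}}"
    then consider "x \<in> ?A" | U v where "x = (set (fst m) \<union> U, snd m + v)" "(U, v) \<in> ?A" "set (fst m) \<inter> U = {}" by blast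
    then show "x \<in> ?R"
    proof cases
      case 1
      then show ?thesis unfolding IH by auto
    next
      case 2
      then obtain P s where P: "s \<in> set S" "P \<subseteq> set ms" "compatible P" "covered P \<inter> set (fst s) = {}"
        "U = covered P \<union> set (fst s)" "v = gain P + snd s" unfolding IH by auto
      have dis: "set (fst m) \<inter> covered P = {}" using 2 P by auto
      have "m \<notin> P"
      proof
        assume "m \<in> P"
        then have "set (fst m) \<subseteq> covered P" by (auto simp: covered_def)
        then show False using dis m by (metis inf.absorb1 set_empty)
      qed
      have "finite P" using P(2) finite_subset by blast
      then have "gain (insert m P) = snd m + gain P" using \<open>m \<notin> P\<close> by (simp add: gain_def)
      moreover have "compatible (insert m P)"
        using P(3) dis unfolding compatible_insert covered_def disjnt_def by blast
      moreover have "x = (covered (insert m P) \<union> set (fst s), snd m + gain P + snd s)"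
        using 2(1) P(5,6) by (auto simp: covered_insert)
      moreover have "insert m P \<subseteq> set (ms @ [m])" "covered (insert m P) \<inter> set (fst s) = {}"
        using 2(3) P by (auto simp: covered_insert)
      ultimately show ?thesis
        using P(1) by (intro CollectI exI[of _ "insert m P"] exI[of _ s] conjI) simp_all
    qed
  next
    fix x assume "x \<in> ?R"
    then obtain P s where P: "s \<in> set S" "P \<subseteq> set (ms @ [m])" "compatible P" "covered P \<inter> set (fst s) = {}"
      "x = (covered P \<union> set (fst s), gain P + snd s)" by blast
    show "x \<in> ?A \<union> {(set (fst m) \<union> U, snd m + v) |U v. (U, v) \<in> ?A \<and> set (fst m) \<inter> U = {}}"
    proof (cases "m \<in> P")
      case False
      then have "P \<subseteq> set ms" using P(2) by auto
      then show ?thesis using P(1,3-5) unfolding IH by blast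
    next
      case True
      define P' where "P' = P - {m}"
      have P': "P = insert m P'" "m \<notin> P'" using True by (auto simp: P'_def)
      have fin: "finite P'" using P(2) P' finite_subset by (metis List.finite_set finite_insert)
      have comp: "compatible P'" and dis: "set (fst m) \<inter> covered P' = {}"
        using P(3) P'(2) unfolding P'(1) compatible_insert by (auto simp: covered_def disjnt_def)
      have "(covered P' \<union> set (fst s), gain P' + snd s) \<in> ?A"
      proof -
        have "P' \<subseteq> set ms" "covered P' \<inter> set (fst s) = {}"
          using P(2,4) P' by (auto simp: covered_insert)
        then show ?thesis unfolding IH using P(1) comp by blast
      qed
      moreover have "x = (set (fst m) \<union> (covered P' \<union> set (fst s)), snd m + (gain P' + snd s))"
        using P(5) P' fin by (auto simp: covered_insert gain_def)
      moreover have "set (fst m) \<inter> (covered P' \<union> set (fst s)) = {}"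
        using dis P(4) unfolding P'(1) covered_insert by blast
      ultimately show ?thesis by blast
    qed
  qed
  finally show ?case .
qed

text \<open>The condition compares positions rather than members, so that a move list occurring
  twice is also compared with its copy.\<close>

definition separated :: "nat set \<Rightarrow> move list list \<Rightarrow> bool" where
  "separated Q mss \<longleftrightarrow> (\<forall>ms\<in>set mss. \<forall>m\<in>set ms. fst m \<noteq> []) \<and>
     (\<forall>i<length mss. \<forall>j<length mss. i \<noteq> j \<longrightarrow>
       (\<forall>m\<in>set (mss ! i). \<forall>m'\<in>set (mss ! j). set (fst m) \<inter> set (fst m') \<subseteq> Q))"

lemma separated_snoc:
  assumes "separated Q (mss @ [ms])"
  shows "separated Q mss" "\<forall>m\<in>set ms. fst m \<noteq> []"
    "\<forall>m\<in>set (concat mss). \<forall>m'\<in>set ms. set (fst m) \<inter> set (fst m') \<subseteq> Q"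
proof -
  show "\<forall>m\<in>set ms. fst m \<noteq> []" using assms unfolding separated_def by simp
  have "\<forall>m\<in>set (mss ! i). \<forall>m'\<in>set (mss ! j). set (fst m) \<inter> set (fst m') \<subseteq> Q"
    if "i < length mss" "j < length mss" "i \<noteq> j" for i j
  proof -
    have "\<forall>m\<in>set ((mss @ [ms]) ! i). \<forall>m'\<in>set ((mss @ [ms]) ! j). set (fst m) \<inter> set (fst m') \<subseteq> Q"
      using assms that unfolding separated_def by (metis length_append_singleton less_SucI)
    then show ?thesis using that by (simp add: nth_append)
  qed
  then show "separated Q mss" using assms unfolding separated_def by simp
  show "\<forall>m\<in>set (concat mss). \<forall>m'\<in>set ms. set (fst m) \<inter> set (fst m') \<subseteq> Q"
  proof (intro ballI)
    fix m m' assume "m \<in> set (concat mss)" "m' \<in> set ms"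
    then obtain ns where "ns \<in> set mss" "m \<in> set ns" by auto
    then obtain i where i: "i < length mss" "m \<in> set (mss ! i)" by (metis in_set_conv_nth)
    have "\<forall>m\<in>set ((mss @ [ms]) ! i). \<forall>m'\<in>set ((mss @ [ms]) ! length mss). set (fst m) \<inter> set (fst m') \<subseteq> Q"
      using assms i unfolding separated_def by (metis length_append_singleton less_Suc_eq nat_neq_iff)
    then show "set (fst m) \<inter> set (fst m') \<subseteq> Q" using i \<open>m' \<in> set ms\<close> by (auto simp: nth_append)
  qed
qed

lemma dp_snoc:
  "dp Qs k (mss @ [ms]) = dp_step (True, ([], 0)) (extend_all Qs k ms (dp Qs k mss)) Qs k"
  unfolding dp_def steps_def by simp

lemma set_normalise:
  "set (dp_step (True, x) S Qs k) = {(restrict_to Qs (fst s), snd s) |s.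
     s \<in> (\<lambda>s. (set (fst s), snd s)) ` set S \<and> length (restrict_to Qs (fst s)) \<le> k}"
  unfolding dp_step_def restrict_to_def by force

text \<open>Different classes meet in the hub only, so disjointness from earlier classes can be
  tested on the remembered hub vertices. The limit \<open>k\<close> may be enforced after each class
  because the set of occupied vertices only grows.\<close>

theorem dp_iff:
  assumes "distinct Qs" "separated (set Qs) mss"
  shows "set (dp Qs k mss) = {(restrict_to Qs (covered P), gain P) |P.
    P \<subseteq> set (concat mss) \<and> compatible P \<and> card (set Qs \<inter> covered P) \<le> k}"
  using assms(2)
proof (induction mss rule: rev_induct)
  case Nil
  then show ?case by (auto simp: dp_def restrict_to_def gain_def compatible_def)
next
  case (snoc ms mss)
  note sep = separated_snoc[OF snoc.prems]
  let ?Q = "set Qs"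
  have cov: "covered P \<inter> covered P0 \<subseteq> ?Q" if "P \<subseteq> set ms" "P0 \<subseteq> set (concat mss)" for P P0
    using sep(3) that unfolding covered_def by blast
  have "set (dp Qs k (mss @ [ms])) =
    {(restrict_to Qs (covered P \<union> (?Q \<inter> covered P0)), gain P + gain P0) |P P0.
      P0 \<subseteq> set (concat mss) \<and> compatible P0 \<and> card (?Q \<inter> covered P0) \<le> k \<and>
      P \<subseteq> set ms \<and> compatible P \<and> covered P \<inter> (?Q \<inter> covered P0) = {} \<and>
      length (restrict_to Qs (covered P \<union> (?Q \<inter> covered P0))) \<le> k}"
    (is "_ = ?L0")
  proof (intro equalityI subsetI)
    fix x assume "x \<in> set (dp Qs k (mss @ [ms]))"
    then obtain P s where s: "s \<in> set (dp Qs k mss)" "P \<subseteq> set ms" "compatible P" "covered P \<inter> set (fst s) = {}"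
      "length (restrict_to Qs (covered P \<union> set (fst s))) \<le> k"
      "x = (restrict_to Qs (covered P \<union> set (fst s)), gain P + snd s)"
      unfolding dp_snoc set_normalise extend_all_iff[OF sep(2)] by auto
    obtain P0 where P0: "P0 \<subseteq> set (concat mss)" "compatible P0" "card (?Q \<inter> covered P0) \<le> k"
      "s = (restrict_to Qs (covered P0), gain P0)"
      using s(1) unfolding snoc.IH[OF sep(1)] by blast
    have eq: "set (fst s) = ?Q \<inter> covered P0" "snd s = gain P0" using P0(4) by auto
    show "x \<in> ?L0" using s(2-6) P0(1-3) unfolding eq by blast
  next
    fix x assume "x \<in> ?L0"
    then obtain P P0 where P: "P0 \<subseteq> set (concat mss)" "compatible P0" "card (?Q \<inter> covered P0) \<le> k"
      "P \<subseteq> set ms" "compatible P" "covered P \<inter> (?Q \<inter> covered P0) = {}"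
      "length (restrict_to Qs (covered P \<union> (?Q \<inter> covered P0))) \<le> k"
      "x = (restrict_to Qs (covered P \<union> (?Q \<inter> covered P0)), gain P + gain P0)" by blast
    define s where "s = (restrict_to Qs (covered P0), gain P0)"
    have "s \<in> set (dp Qs k mss)" unfolding snoc.IH[OF sep(1)] s_def using P by blast
    moreover have eq: "?Q \<inter> covered P0 = set (fst s)" "gain P0 = snd s" by (auto simp: s_def)
    ultimately have "(covered P \<union> set (fst s), gain P + snd s) \<in> (\<lambda>s. (set (fst s), snd s)) ` set (extend_all Qs k ms (dp Qs k mss))"
      unfolding extend_all_iff[OF sep(2)] using P(4-6) unfolding eq by blast
    moreover have "x = (restrict_to Qs (fst (covered P \<union> set (fst s), gain P + snd s)), snd (covered P \<union> set (fst s), gain P + snd s))"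
      "length (restrict_to Qs (fst (covered P \<union> set (fst s), gain P + snd s))) \<le> k"
      using P(7,8) eq by auto
    ultimately show "x \<in> set (dp Qs k (mss @ [ms]))"
      unfolding dp_snoc set_normalise by blast
  qed
  also have "\<dots> = {(restrict_to Qs (covered P), gain P) |P.
    P \<subseteq> set (concat (mss @ [ms])) \<and> compatible P \<and> card (?Q \<inter> covered P) \<le> k}" (is "?L = ?R")
  proof (intro equalityI subsetI)
    fix x assume "x \<in> ?L"
    then obtain P P0 where P: "P0 \<subseteq> set (concat mss)" "compatible P0" "P \<subseteq> set ms" "compatible P"
      "covered P \<inter> (?Q \<inter> covered P0) = {}" "length (restrict_to Qs (covered P \<union> (?Q \<inter> covered P0))) \<le> k"
      "x = (restrict_to Qs (covered P \<union> (?Q \<inter> covered P0)), gain P + gain P0)" by blast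
    have dis: "covered P \<inter> covered P0 = {}" using cov[OF P(3,1)] P(5) by blast
    have "P \<inter> P0 = {}"
    proof (rule ccontr)
      assume "P \<inter> P0 \<noteq> {}"
      then obtain m where "m \<in> P" "m \<in> P0" by blast
      then have "set (fst m) \<subseteq> covered P \<inter> covered P0" "fst m \<noteq> []"
        using sep(2) P(3) by (auto simp: covered_def)
      then show False using dis by simp
    qed
    then have "gain (P \<union> P0) = gain P + gain P0"
      unfolding gain_def by (intro sum.union_disjoint finite_subset[OF P(1)] finite_subset[OF P(3)]) auto
    moreover have "compatible (P \<union> P0)" using compatible_Un P(2,4) dis by blast
    moreover have "restrict_to Qs (covered (P \<union> P0)) = restrict_to Qs (covered P \<union> (?Q \<inter> covered P0))"
      unfolding restrict_to_eq_iff covered_Un by blast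
    moreover have "card (?Q \<inter> covered (P \<union> P0)) \<le> k"
    proof -
      have "?Q \<inter> covered (P \<union> P0) = ?Q \<inter> (covered P \<union> (?Q \<inter> covered P0))" unfolding covered_Un by blast
      then show ?thesis using P(6) length_restrict_to[OF assms(1)] by simp
    qed
    moreover have "P \<union> P0 \<subseteq> set (concat (mss @ [ms]))" using P(1,3) by auto
    ultimately show "x \<in> ?R" using P(7) by (intro CollectI exI[of _ "P \<union> P0"] conjI) simp_all
  next
    fix x assume "x \<in> ?R"
    then obtain P' where P': "x = (restrict_to Qs (covered P'), gain P')" "P' \<subseteq> set (concat (mss @ [ms]))"
      "compatible P'" "card (?Q \<inter> covered P') \<le> k" by blast
    \<comment> \<open>A move that occurs in earlier lists as well as in \<open>ms\<close> is
      attributed to the earlier ones, which makes the two parts disjoint.\<close>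
    define P0 where "P0 = P' \<inter> set (concat mss)"
    define P where "P = P' - P0"
    have un: "P' = P \<union> P0" "P \<inter> P0 = {}" by (auto simp: P_def P0_def)
    have sub: "P0 \<subseteq> set (concat mss)" "P \<subseteq> set ms" using P'(2) by (auto simp: P_def P0_def)
    have dis: "covered P \<inter> covered P0 = {}" using compatible_disjoint P'(3) un by blast
    have "gain P' = gain P + gain P0"
      using sub un unfolding gain_def by (metis List.finite_set finite_subset sum.union_disjoint)
    moreover have eq: "restrict_to Qs (covered P') = restrict_to Qs (covered P \<union> (?Q \<inter> covered P0))"
      unfolding restrict_to_eq_iff un covered_Un by blast
    moreover have "card (?Q \<inter> covered P0) \<le> k"
      by (rule le_trans[OF card_mono P'(4)]) (auto simp: un covered_Un)
    moreover have "length (restrict_to Qs (covered P \<union> (?Q \<inter> covered P0))) \<le> k"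
      using P'(4) length_restrict_to[OF assms(1)] by (simp flip: eq)
    moreover have "compatible P" "compatible P0" using P'(3) un compatible_mono by auto
    moreover have "covered P \<inter> (?Q \<inter> covered P0) = {}" using dis by blast
    ultimately show "x \<in> ?L" using sub P'(1) by (intro CollectI exI[of _ P] exI[of _ P0] conjI) simp_all
  qed
  finally show ?case .
qed

lemma dp_distinct: "mss \<noteq> [] \<Longrightarrow> distinct (dp Qs k mss)"
  by (cases mss rule: rev_cases) (auto simp: dp_snoc dp_step_def)

section \<open>Hashing\<close>

text \<open>A universal hash family from \<open>2 ^ l\<close> positions to \<open>r\<close> labels;
  as a list it counts repeated labellings with multiplicity.\<close>

definition good_labels :: "nat \<Rightarrow> nat \<Rightarrow> nat list list \<Rightarrow> bool" where
  "good_labels r l L \<longleftrightarrow> length L = r ^ l \<and> (\<forall>lab\<in>set L. length lab = 2 ^ l \<and> (\<forall>a\<in>set lab. a < r)) \<and>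
     (\<forall>x<2 ^ l. \<forall>y<2 ^ l. x \<noteq> y \<longrightarrow> r * length (filter (\<lambda>lab. lab ! x = lab ! y) L) \<le> length L)"

lemma shift_less: "a < r \<Longrightarrow> c < r \<Longrightarrow> shift r c a < r"
  by (auto simp: shift_def)

lemma shift_inj: "a < r \<Longrightarrow> b < r \<Longrightarrow> c < r \<Longrightarrow> shift r c a = shift r c b \<longleftrightarrow> a = b"
  by (auto simp: shift_def)

lemma shift_inj2: "a < r \<Longrightarrow> b < r \<Longrightarrow> c < r \<Longrightarrow> shift r b a = shift r c a \<longleftrightarrow> b = c"
  by (auto simp: shift_def)

lemma filter_dn_le_1:
  assumes "a < r"
  shows "length (filter (\<lambda>c. shift r c a = b) (dn r)) \<le> 1"
proof -
  have "card {c. c < r \<and> shift r c a = b} \<le> 1"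
    unfolding One_nat_def card_le_Suc0_iff_eq[OF finite_Collect_conjI[OF disjI1[OF finite_Collect_less_nat]]]
    using shift_inj2[OF assms] by auto
  moreover have "length (filter (\<lambda>c. shift r c a = b) (dn r)) = card {c. c < r \<and> shift r c a = b}"
    by (subst distinct_card[symmetric]) (auto intro: arg_cong[where f = card])
  ultimately show ?thesis by simp
qed

lemma length_double_labels: "length (double_labels r L) = r * length L"
  unfolding double_labels_def by (induction L) auto

lemma length_filter_double:
  "length (filter P (double_labels r L)) =
    (\<Sum>lab\<leftarrow>L. length (filter (\<lambda>c. P (lab @ map (\<lambda>a. shift r c a) lab)) (dn r)))"
  unfolding double_labels_def by (induction L) (auto simp: filter_map comp_def)

lemma sum_list_if: "(\<Sum>x\<leftarrow>xs. if P x then r else 0) = r * length (filter P xs)" for r :: nat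
  by (induction xs) auto

text \<open>Two positions in the same half collide after doubling exactly if they did before, since
  a shift is injective. Two positions in different halves collide for at most one of the
  \<open>r\<close> shifts, whatever their labels are.\<close>

lemma good_labels_double:
  assumes "good_labels r l L"
  shows "good_labels r (Suc l) (double_labels r L)"
proof -
  have len: "length L = r ^ l" and lab: "\<And>lab. lab \<in> set L \<Longrightarrow> length lab = 2 ^ l \<and> (\<forall>a\<in>set lab. a < r)"
    and col: "\<And>x y. x < 2 ^ l \<Longrightarrow> y < 2 ^ l \<Longrightarrow> x \<noteq> y \<Longrightarrow> r * length (filter (\<lambda>lab. lab ! x = lab ! y) L) \<le> length L"
    using assms unfolding good_labels_def by auto
  have nth: "lab ! x < r" if "lab \<in> set L" "x < 2 ^ l" for lab x
    using lab that nth_mem by metis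
  have cross: "length (filter (\<lambda>lab. lab ! x = lab ! y) (double_labels r L)) \<le> length L"
    if "x < 2 ^ l" "2 ^ l \<le> y" "y < 2 * 2 ^ l" for x y
  proof -
    have "length (filter (\<lambda>lab. lab ! x = lab ! y) (double_labels r L)) \<le> (\<Sum>lab\<leftarrow>L. 1)"
      unfolding length_filter_double
    proof (rule sum_list_mono)
      fix l1 assume l1: "l1 \<in> set L"
      have "length (filter (\<lambda>c. (l1 @ map (\<lambda>a. shift r c a) l1) ! x = (l1 @ map (\<lambda>a. shift r c a) l1) ! y) (dn r))
        = length (filter (\<lambda>c. shift r c (l1 ! (y - 2 ^ l)) = l1 ! x) (dn r))"
        using lab[OF l1] that by (intro arg_cong[where f = length] filter_cong) (auto simp: nth_append)
      also have "\<dots> \<le> 1" by (rule filter_dn_le_1) (use nth[OF l1] that in auto)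
      finally show "length (filter (\<lambda>c. (l1 @ map (\<lambda>a. shift r c a) l1) ! x = (l1 @ map (\<lambda>a. shift r c a) l1) ! y) (dn r)) \<le> 1" .
    qed
    then show ?thesis by (simp add: sum_list_triv)
  qed
  have same: "length (filter (\<lambda>lab. lab ! x = lab ! y) (double_labels r L)) = r * length (filter (\<lambda>lab. lab ! x' = lab ! y') L)"
    if "x' < 2 ^ l" "y' < 2 ^ l" and "x = x' \<and> y = y' \<or> x = x' + 2 ^ l \<and> y = y' + 2 ^ l" for x y x' y'
  proof -
    have "length (filter (\<lambda>lab. lab ! x = lab ! y) (double_labels r L)) = (\<Sum>lab\<leftarrow>L. if lab ! x' = lab ! y' then r else 0)"
      unfolding length_filter_double
    proof (intro arg_cong[where f = sum_list] map_cong refl)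
      fix l1 assume l1: "l1 \<in> set L"
      have "filter (\<lambda>c. (l1 @ map (\<lambda>a. shift r c a) l1) ! x = (l1 @ map (\<lambda>a. shift r c a) l1) ! y) (dn r)
        = filter (\<lambda>c. l1 ! x' = l1 ! y') (dn r)"
        using lab[OF l1] that nth[OF l1] by (intro filter_cong) (auto simp: nth_append shift_inj)
      then show "length (filter (\<lambda>c. (l1 @ map (\<lambda>a. shift r c a) l1) ! x = (l1 @ map (\<lambda>a. shift r c a) l1) ! y) (dn r))
        = (if l1 ! x' = l1 ! y' then r else 0)" by simp
    qed
    then show ?thesis by (simp add: sum_list_if)
  qed
  have "r * length (filter (\<lambda>lab. lab ! x = lab ! y) (double_labels r L)) \<le> r * length L"
    if "x < 2 * 2 ^ l" "y < 2 * 2 ^ l" "x \<noteq> y" for x y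
  proof -
    consider "x < 2 ^ l" "y < 2 ^ l" | "x < 2 ^ l" "2 ^ l \<le> y" | "2 ^ l \<le> x" "y < 2 ^ l" | "2 ^ l \<le> x" "2 ^ l \<le> y"
      by linarith
    then show ?thesis
    proof cases
      case 1
      then show ?thesis using same[of x y x y] col[of x y] that by simp
    next
      case 2
      then show ?thesis using cross that by simp
    next
      case 3
      then show ?thesis using cross[of y x] that by (simp add: eq_commute[of "_ ! x"])
    next
      case 4
      have "r * length (filter (\<lambda>lab. lab ! (x - 2 ^ l) = lab ! (y - 2 ^ l)) L) \<le> length L"
        by (rule col) (use 4 that in auto)
      moreover have "length (filter (\<lambda>lab. lab ! x = lab ! y) (double_labels r L))
          = r * length (filter (\<lambda>lab. lab ! (x - 2 ^ l) = lab ! (y - 2 ^ l)) L)"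
        by (rule same) (use 4 that in auto)
      ultimately show ?thesis by simp
    qed
  qed
  moreover have "\<forall>lab\<in>set (double_labels r L). length lab = 2 * 2 ^ l \<and> (\<forall>a\<in>set lab. a < r)"
    using lab unfolding double_labels_def by (auto intro: shift_less)
  ultimately show ?thesis
    using len unfolding good_labels_def by (simp add: length_double_labels)
qed

lemma good_labels_0: "0 < r \<Longrightarrow> good_labels r 0 [[0]]"
  unfolding good_labels_def by auto

text \<open>All labellings in the list have the same length, so the test of the loop decides
  \<open>N \<le> 2 ^ l\<close>. The last conjunct records that the latest doubling was still
  necessary; it bounds \<open>l\<close> and with it the size of the family.\<close>

lemma labels_iterate:
  assumes "0 < r"
  shows "\<exists>l. good_labels r l (fold (\<lambda>_ L. if \<exists>lab\<in>set L. N \<le> length lab then L else double_labels r L) xs [[0]]) \<and>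
    (N \<le> 2 ^ l \<or> l = length xs) \<and> (l = 0 \<or> 2 ^ (l - 1) < N)"
proof (induction xs rule: rev_induct)
  case Nil
  then show ?case using good_labels_0[OF assms] by auto
next
  case (snoc x xs)
  let ?L = "fold (\<lambda>_ L. if \<exists>lab\<in>set L. N \<le> length lab then L else double_labels r L) xs [[0]]"
  obtain l where l: "good_labels r l ?L" "N \<le> 2 ^ l \<or> l = length xs" "l = 0 \<or> 2 ^ (l - 1) < N"
    using snoc by blast
  have all: "length lab = 2 ^ l" if "lab \<in> set ?L" for lab
    using l(1) that unfolding good_labels_def by blast
  have "length ?L > 0" using l(1) assms unfolding good_labels_def by simp
  then have hd: "hd ?L \<in> set ?L" by simp
  have gen: "(\<exists>lab\<in>set M. N \<le> length lab) \<longleftrightarrow> N \<le> 2 ^ l"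
    if "h \<in> set M" "\<And>lab. lab \<in> set M \<Longrightarrow> length lab = 2 ^ l" for M :: "nat list list" and h
    using that by auto
  have "(\<exists>lab\<in>set ?L. N \<le> length lab) \<longleftrightarrow> N \<le> 2 ^ l" by (rule gen[OF hd all])
  then have step: "fold (\<lambda>_ L. if \<exists>lab\<in>set L. N \<le> length lab then L else double_labels r L) (xs @ [x]) [[0]]
      = (if N \<le> 2 ^ l then ?L else double_labels r ?L)" by simp
  show ?case
  proof (cases "N \<le> 2 ^ l")
    case True
    then show ?thesis unfolding step using l by (intro exI[of _ l]) simp
  next
    case False
    then show ?thesis unfolding step using l(2) good_labels_double[OF l(1)] by (intro exI[of _ "Suc l"]) simp
  qed
qed

lemma labels_good:
  assumes "0 < r"
  obtains l where "good_labels r l (labels Is r)" "length Is \<le> 2 ^ l" "l = 0 \<or> 2 ^ (l - 1) < length Is"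
proof -
  obtain l where "good_labels r l (labels Is r)" "length Is \<le> 2 ^ l \<or> l = length Is" "l = 0 \<or> 2 ^ (l - 1) < length Is"
    using labels_iterate[OF assms, of "length Is" Is] unfolding labels_def by blast
  \<comment> \<open>One round per key is enough, because \<open>2 ^ l\<close> exceeds
    \<open>l\<close>.\<close>
  moreover from this(2) have "length Is \<le> 2 ^ l" using less_imp_le[OF less_exp] by auto
  ultimately show thesis by (intro that)
qed

lemma sum_list_swap: "finite Z \<Longrightarrow> (\<Sum>x\<leftarrow>xs. card {z\<in>Z. P x z}) = (\<Sum>z\<in>Z. length (filter (\<lambda>x. P x z) xs))"
proof (induction xs)
  case (Cons x xs)
  have "(\<Sum>z\<in>Z. length (filter (\<lambda>x. P x z) (x # xs))) = (\<Sum>z\<in>Z. (if P x z then 1 else 0) + length (filter (\<lambda>x. P x z) xs))"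
    by (intro sum.cong) auto
  also have "\<dots> = card {z\<in>Z. P x z} + (\<Sum>z\<in>Z. length (filter (\<lambda>x. P x z) xs))"
    using Cons.prems by (simp add: sum.distrib sum.If_cases Int_def)
  finally show ?case using Cons by simp
qed simp

text \<open>Averaging over the family: each pair collides in at most a fraction \<open>1/r\<close>
  of the labellings, so some labelling has at most \<open>card Z / r\<close> collisions.\<close>

lemma few_collisions:
  assumes "good_labels r l L" "0 < r" "finite Z" "\<And>z. z \<in> Z \<Longrightarrow> f z < 2 ^ l \<and> g z < 2 ^ l \<and> f z \<noteq> g z"
  obtains lab where "lab \<in> set L" "r * card {z\<in>Z. lab ! f z = lab ! g z} \<le> card Z"
proof -
  note result = that
  have "L \<noteq> []" using assms(1,2) unfolding good_labels_def by auto
  show ?thesis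
  proof (rule ccontr)
    assume "\<not> thesis"
    then have *: "card Z < r * card {z\<in>Z. lab ! f z = lab ! g z}" if "lab \<in> set L" for lab
      using that result by (meson not_le)
    have "length L * card Z = (\<Sum>lab\<leftarrow>L. card Z)" by (simp add: sum_list_triv)
    also have "\<dots> < (\<Sum>lab\<leftarrow>L. r * card {z\<in>Z. lab ! f z = lab ! g z})"
      by (rule sum_list_strict_mono) (use * \<open>L \<noteq> []\<close> in auto)
    also have "\<dots> = r * (\<Sum>lab\<leftarrow>L. card {z\<in>Z. lab ! f z = lab ! g z})" by (simp add: sum_list_const_mult)
    also have "\<dots> = (\<Sum>z\<in>Z. r * length (filter (\<lambda>lab. lab ! f z = lab ! g z) L))"
      unfolding sum_list_swap[OF assms(3)] sum_distrib_left ..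
    also have "\<dots> \<le> (\<Sum>z\<in>Z. length L)"
    proof (rule sum_mono)
      fix z assume "z \<in> Z"
      then show "r * length (filter (\<lambda>lab. lab ! f z = lab ! g z) L) \<le> length L"
        using assms(1) assms(4)[of z] unfolding good_labels_def by blast
    qed
    finally show False by simp
  qed
qed

section \<open>Classes of triangles\<close>

text \<open>All that the search knows about graph and components. Keys are required to be sublists
  of \<open>Qs\<close> in its order, so that counting hub subsets counts keys.\<close>

definition class_system ::
    "nat \<Rightarrow> nat list \<Rightarrow> nat \<Rightarrow> nat \<Rightarrow> nat list set \<Rightarrow> (nat list \<times> nat list list) list \<Rightarrow> bool" where
  "class_system n Qs \<mu> M TL cls \<longleftrightarrow>
     (\<forall>t\<in>TL. length t = 3 \<and> distinct t \<and> set t \<subseteq> {..<n}) \<and> inj_on set TL \<and>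
     TL = (\<Union>c\<in>set cls. set (snd c)) \<and>
     (\<forall>c\<in>set cls. fst c = restrict_to Qs (set (fst c)) \<and> length (fst c) \<le> \<mu> \<and> length (snd c) \<le> M \<and>
        (\<forall>t\<in>set (snd c). set t \<inter> set Qs \<subseteq> set (fst c))) \<and>
     (\<forall>i<length cls. \<forall>j<length cls. i \<noteq> j \<longrightarrow>
        (\<forall>t\<in>set (snd (cls ! i)). \<forall>t'\<in>set (snd (cls ! j)). set t \<inter> set t' \<subseteq> set Qs))"

lemma fold_grow:
  assumes R: "R = {(x, y). edge Es x y \<and> x \<notin> set Qs \<and> y \<notin> set Qs}" and "R \<subseteq> {..<n} \<times> {..<n}"
    and "set X \<subseteq> {..<n} - set Qs"
  shows "set (fold (\<lambda>_ X. grow n Es Qs X) xs X) = {u. \<exists>x\<in>set X. \<exists>i\<le>length xs. (x, u) \<in> R ^^ i}"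
    "set (fold (\<lambda>_ X. grow n Es Qs X) xs X) \<subseteq> {..<n} - set Qs"
proof (induction xs rule: rev_induct)
  case Nil
  {
    case 1
    then show ?case by auto
  next
    case 2
    then show ?case using assms(3) by simp
  }
next
  case (snoc y ys)
  let ?Y = "fold (\<lambda>_ X. grow n Es Qs X) ys X"
  have Y: "set ?Y \<subseteq> {..<n} - set Qs" by (rule snoc.IH(2))
  have "set (grow n Es Qs Z) = set Z \<union> {u. \<exists>x\<in>set Z. (x, u) \<in> R}" if "set Z \<subseteq> {..<n} - set Qs" for Z
    unfolding grow_def using that assms(2) by (auto simp: R)
  from this[OF Y] have "set (grow n Es Qs ?Y) = set ?Y \<union> {u. \<exists>x\<in>set ?Y. (x, u) \<in> R}" .
  also have "\<dots> = {u. \<exists>x\<in>set X. \<exists>i\<le>Suc (length ys). (x, u) \<in> R ^^ i}"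
    unfolding snoc.IH(1)
  proof (intro equalityI subsetI)
    fix u assume "u \<in> {u. \<exists>x\<in>set X. \<exists>i\<le>Suc (length ys). (x, u) \<in> R ^^ i}"
    then obtain x i where xi: "x \<in> set X" "i \<le> Suc (length ys)" "(x, u) \<in> R ^^ i" by blast
    show "u \<in> {u. \<exists>x\<in>set X. \<exists>i\<le>length ys. (x, u) \<in> R ^^ i} \<union> {u. \<exists>x\<in>{u. \<exists>x\<in>set X. \<exists>i\<le>length ys. (x, u) \<in> R ^^ i}. (x, u) \<in> R}"
    proof (cases "i \<le> length ys")
      case True
      then show ?thesis using xi by blast
    next
      case False
      then have "i = Suc (length ys)" using xi by simp
      then obtain z where "(x, z) \<in> R ^^ length ys" "(z, u) \<in> R" using xi(3) by auto
      then show ?thesis using xi(1) by blast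
    qed
  next
    fix u assume "u \<in> {u. \<exists>x\<in>set X. \<exists>i\<le>length ys. (x, u) \<in> R ^^ i} \<union> {u. \<exists>x\<in>{u. \<exists>x\<in>set X. \<exists>i\<le>length ys. (x, u) \<in> R ^^ i}. (x, u) \<in> R}"
    then consider x i where "x \<in> set X" "i \<le> length ys" "(x, u) \<in> R ^^ i"
      | x i z where "x \<in> set X" "i \<le> length ys" "(x, z) \<in> R ^^ i" "(z, u) \<in> R" by blast
    then show "u \<in> {u. \<exists>x\<in>set X. \<exists>i\<le>Suc (length ys). (x, u) \<in> R ^^ i}"
    proof cases
      case 1
      then show ?thesis using le_SucI by blast
    next
      case 2
      then have "(x, u) \<in> R ^^ Suc i" by auto
      then show ?thesis using 2 Suc_le_mono by blast
    qed
  qed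
  finally have *: "set (grow n Es Qs ?Y) = {u. \<exists>x\<in>set X. \<exists>i\<le>Suc (length ys). (x, u) \<in> R ^^ i}" .
  {
    case 1
    then show ?case using * by simp
  next
    case 2
    then show ?case by (auto simp: grow_def)
  }
qed

lemma fold_grow_filter:
  "\<exists>P. fold (\<lambda>_ X. grow n Es Qs X) xs (filter P0 (dn n)) = filter P (dn n)"
  by (induction xs arbitrary: P0) (auto simp: grow_def)

text \<open>Both lists are filters of the same list \<open>dn n\<close>, so equal sets force equal
  lists.\<close>

lemma component_of_eqI:
  assumes "set (component_of n Es Qs t) = set (component_of n Es Qs t')"
  shows "component_of n Es Qs t = component_of n Es Qs t'"
proof -
  obtain P where P: "component_of n Es Qs t = filter P (dn n)"
    unfolding component_of_def using fold_grow_filter by blast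
  obtain P' where P': "component_of n Es Qs t' = filter P' (dn n)"
    unfolding component_of_def using fold_grow_filter by blast
  have "P x \<longleftrightarrow> P' x" if "x \<in> set (dn n)" for x using assms that unfolding P P' by auto
  then show ?thesis unfolding P P' by (intro filter_cong) auto
qed

locale hub_instance =
  fixes \<sigma> \<delta> n :: nat and E :: "nat set set" and Q :: "nat set" and Es :: "nat list list" and Qs :: "nat list"
  assumes graph: "simple_graph {..<n} E" and hub: "hub \<sigma> \<delta> {..<n} E Q"
    and Es: "lists_family Es E" and Qs: "lists_set Qs Q"
begin

lemma set_Qs: "set Qs = Q" and distinct_Qs: "distinct Qs" and Q_subset: "Q \<subseteq> {..<n}"
  using Qs hub by (auto simp: lists_set_def hub_def)

lemma edge_iff: "edge Es a b \<longleftrightarrow> {a, b} \<in> E"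
proof
  assume "edge Es a b"
  then have "set [a, b] \<in> set ` set Es \<or> set [b, a] \<in> set ` set Es" unfolding edge_def by blast
  then show "{a, b} \<in> E" using Es by (auto simp: lists_family_def lists_set_def insert_commute)
next
  assume ab: "{a, b} \<in> E"
  then have "card {a, b} = 2" using graph by (auto simp: simple_graph_def)
  then have "a \<noteq> b" by auto
  obtain xs where xs: "xs \<in> set Es" "set xs = {a, b}" "distinct xs"
    using ab Es by (auto simp: lists_family_def lists_set_def)
  then have "length xs = 2" using \<open>card {a, b} = 2\<close> distinct_card by metis
  then obtain x y where "xs = [x, y]" by (auto simp: numeral_2_eq_2 length_Suc_conv)
  then have "xs = [a, b] \<or> xs = [b, a]" using xs(2) \<open>a \<noteq> b\<close> by (auto simp: doubleton_eq_iff)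
  then show "edge Es a b" using xs(1) by (auto simp: edge_def)
qed

lemma edge_bound: "{a, b} \<in> E \<Longrightarrow> a < n \<and> b < n \<and> a \<noteq> b"
  using graph by (fastforce simp: simple_graph_def)

lemma set_tris: "set (tris n Es) = {[a, b, c] |a b c. c < b \<and> b < a \<and> a < n \<and> {a, b} \<in> E \<and> {a, c} \<in> E \<and> {b, c} \<in> E}"
  unfolding tris_def by (auto simp: edge_iff split: if_splits)

lemma tri_list: "t \<in> set (tris n Es) \<Longrightarrow> length t = 3 \<and> distinct t \<and> set t \<subseteq> {..<n} \<and> sorted_wrt (>) t"
  unfolding set_tris by auto

lemma tri_adj: "t \<in> set (tris n Es) \<Longrightarrow> x \<in> set t \<Longrightarrow> y \<in> set t \<Longrightarrow> x \<noteq> y \<Longrightarrow> {x, y} \<in> E"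
  unfolding set_tris by (auto simp: insert_commute)

lemma inj_tris: "inj_on set (set (tris n Es))"
proof (rule inj_onI)
  fix t t' assume "t \<in> set (tris n Es)" "t' \<in> set (tris n Es)" "set t = set t'"
  then have "rev t = rev t'"
    using tri_list by (intro strict_sorted_equal) (auto simp: sorted_wrt_rev)
  then show "t = t'" by simp
qed

lemma triangles_eq: "triangles {..<n} E = set ` set (tris n Es)"
proof (intro equalityI subsetI)
  fix T assume "T \<in> set ` set (tris n Es)"
  then show "T \<in> triangles {..<n} E"
    unfolding triangles_def using tri_list tri_adj by (auto simp: distinct_card)
next
  fix T assume T: "T \<in> triangles {..<n} E"
  then have T': "T \<subseteq> {..<n}" "card T = 3" "\<And>x y. x \<in> T \<Longrightarrow> y \<in> T \<Longrightarrow> x \<noteq> y \<Longrightarrow> {x, y} \<in> E"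
    by (auto simp: triangles_def)
  have fin: "finite T" using T'(1) finite_subset by blast
  let ?s = "sorted_list_of_set T"
  have "length ?s = 3" using T'(2) by simp
  moreover have "\<exists>c b a. xs = [c, b, a]" if "length xs = 3" for xs :: "nat list"
    using that by (auto simp: numeral_3_eq_3 length_Suc_conv)
  ultimately obtain c b a where s: "?s = [c, b, a]" by blast
  have "sorted_wrt (<) ?s" by (rule strict_sorted_list_of_set)
  then have "c < b" "b < a" using s by auto
  moreover have "T = {c, b, a}" using s fin by (metis list.simps(15) list.set(1) set_sorted_list_of_set)
  ultimately have "[a, b, c] \<in> set (tris n Es)" "set [a, b, c] = T"
    using T' unfolding set_tris by auto
  then show "T \<in> set ` set (tris n Es)" by blast
qed

definition R :: "(nat \<times> nat) set" where
  "R = {(x, y). {x, y} \<in> {e \<in> E. e \<inter> Q = {}}}"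

lemma R_eq: "R = {(x, y). edge Es x y \<and> x \<notin> set Qs \<and> y \<notin> set Qs}"
  by (auto simp: R_def edge_iff set_Qs)

lemma R_sub: "R \<subseteq> {..<n} \<times> {..<n}"
  unfolding R_def using edge_bound by auto

lemma R_sym: "sym (R\<^sup>*)"
  by (intro sym_rtrancl) (auto simp: R_def sym_def insert_commute)

lemma set_component_of:
  "set (component_of n Es Qs t) = {u. \<exists>x. x \<in> set t \<and> x < n \<and> x \<notin> Q \<and> (x, u) \<in> R\<^sup>*}"
    "set (component_of n Es Qs t) \<subseteq> {..<n} - Q"
proof -
  have fin: "finite R" by (rule finite_subset[OF R_sub]) simp
  have "card R \<le> n * n" using card_mono[OF _ R_sub] by (simp add: card_cartesian_product)
  have *: "(\<exists>i\<le>n * n. (x, u) \<in> R ^^ i) \<longleftrightarrow> (x, u) \<in> R\<^sup>*" for x u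
  proof
    show "\<exists>i\<le>n * n. (x, u) \<in> R ^^ i \<Longrightarrow> (x, u) \<in> R\<^sup>*" using relpow_imp_rtrancl by blast
    assume "(x, u) \<in> R\<^sup>*"
    then obtain i where "i \<le> card R" "(x, u) \<in> R ^^ i" unfolding rtrancl_finite_eq_relpow[OF fin] by blast
    then show "\<exists>i\<le>n * n. (x, u) \<in> R ^^ i" using \<open>card R \<le> n * n\<close> le_trans by blast
  qed
  show "set (component_of n Es Qs t) = {u. \<exists>x. x \<in> set t \<and> x < n \<and> x \<notin> Q \<and> (x, u) \<in> R\<^sup>*}"
    unfolding component_of_def by (subst fold_grow(1)[OF R_eq R_sub]) (auto simp: * set_Qs)
  show "set (component_of n Es Qs t) \<subseteq> {..<n} - Q"
    unfolding component_of_def set_Qs[symmetric] by (rule fold_grow(2)[OF R_eq R_sub]) auto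
qed

text \<open>The vertices of a triangle outside the hub are adjacent to one another, hence lie in one
  component, and any one of them determines it.\<close>

lemma component_of_vertex:
  assumes "t \<in> set (tris n Es)" "x \<in> set t" "x \<notin> Q"
  shows "set (component_of n Es Qs t) = {u. (x, u) \<in> R\<^sup>*}"
proof -
  have "(x, y) \<in> R\<^sup>*" if "y \<in> set t" "y \<notin> Q" for y
    using tri_adj[OF assms(1,2) that(1)] assms(3) that(2) by (cases "x = y") (auto simp: R_def)
  then show ?thesis
    unfolding set_component_of(1) using assms tri_list[OF assms(1)] symD[OF R_sym]
    by (auto intro: rtrancl_trans)
qed

lemma component_bounds:
  assumes "t \<in> set (tris n Es)" "x \<in> set t" "x \<notin> Q"
  shows "card (set (component_of n Es Qs t)) \<le> \<sigma>"
    "card {q \<in> Q. \<exists>x\<in>set (component_of n Es Qs t). {q, x} \<in> E} \<le> \<delta>"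
proof -
  let ?K = "set (component_of n Es Qs t)"
  have x: "x \<in> {..<n} - Q" using assms tri_list by auto
  have "?K = connected_in ({..<n} - Q) {e \<in> E. e \<inter> Q = {}} `` {x}"
    using set_component_of(2)[of t] x unfolding component_of_vertex[OF assms] connected_in_def R_def by auto
  then have "?K \<in> components ({..<n} - Q) {e \<in> E. e \<inter> Q = {}}"
    unfolding components_def using x by (auto intro: quotientI)
  then show "card ?K \<le> \<sigma>" "card {q \<in> Q. \<exists>x\<in>?K. {q, x} \<in> E} \<le> \<delta>"
    using hub unfolding hub_def by auto
qed

text \<open>The hub vertices of such a triangle are neighbours of \<open>x\<close>, so its key is
  the hub neighbourhood of the component and does not depend on the triangle.\<close>

lemma key_of_vertex:
  assumes "t \<in> set (tris n Es)" "x \<in> set t" "x \<notin> Q"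
  shows "key_of Es Qs (component_of n Es Qs t) t =
    filter (\<lambda>q. \<exists>x\<in>set (component_of n Es Qs t). edge Es q x) Qs"
proof -
  have "x \<in> set (component_of n Es Qs t)" unfolding component_of_vertex[OF assms] by simp
  moreover have "edge Es q x" if "q \<in> set t" "q \<in> Q" for q
    using tri_adj[OF assms(1) that(1) assms(2)] that(2) assms(3) by (auto simp: edge_iff)
  ultimately show ?thesis unfolding key_of_def by (intro filter_cong) (auto simp: set_Qs)
qed

lemma ident_eq:
  assumes "t \<in> set (tris n Es)" "t' \<in> set (tris n Es)" "x \<in> set t" "x \<in> set t'" "x \<notin> Q"
  shows "ident n Es Qs t = ident n Es Qs t'"
proof -
  have "component_of n Es Qs t = component_of n Es Qs t'"
    by (rule component_of_eqI) (simp add: component_of_vertex[OF assms(1,3,5)] component_of_vertex[OF assms(2,4,5)])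
  then show ?thesis
    unfolding ident_def using key_of_vertex[OF assms(1,3,5)] key_of_vertex[OF assms(2,4,5)] by simp
qed

text \<open>For a triangle inside the hub the key has at most the 3 vertices of the triangle;
  otherwise it is the neighbourhood of a component, bounded by \<open>\<delta>\<close>.\<close>

lemma ident_bounds:
  assumes t: "t \<in> set (tris n Es)"
  shows "set t \<inter> Q \<subseteq> set (snd (ident n Es Qs t))" "length (snd (ident n Es Qs t)) \<le> \<delta> + 3"
    "set t \<subseteq> set (fst (ident n Es Qs t)) \<union> set (snd (ident n Es Qs t))"
    "card (set (fst (ident n Es Qs t))) \<le> \<sigma>"
proof -
  let ?K = "component_of n Es Qs t" and ?k = "key_of Es Qs (component_of n Es Qs t) t"
  show 1: "set t \<inter> Q \<subseteq> set (snd (ident n Es Qs t))" by (auto simp: ident_def key_of_def set_Qs)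
  have len: "length ?k = card (set ?k)"
    unfolding key_of_def using distinct_Qs by (intro distinct_card[symmetric] distinct_filter)
  show "length (snd (ident n Es Qs t)) \<le> \<delta> + 3"
  proof (cases "set t \<subseteq> Q")
    case True
    then have "set ?K = {}" unfolding set_component_of(1) by auto
    then have "set ?k \<subseteq> set t" by (auto simp: key_of_def)
    then have "card (set ?k) \<le> card (set t)" by (intro card_mono) auto
    also have "\<dots> \<le> 3" using tri_list[OF t] card_length[of t] by simp
    finally show ?thesis using len by (simp add: ident_def)
  next
    case False
    then obtain x where x: "x \<in> set t" "x \<notin> Q" by auto
    have "set ?k = {q \<in> Q. \<exists>x\<in>set ?K. {q, x} \<in> E}"
      unfolding key_of_vertex[OF t x] by (auto simp: edge_iff set_Qs)
    then show ?thesis using component_bounds(2)[OF t x] len by (simp add: ident_def)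
  qed
  show "set t \<subseteq> set (fst (ident n Es Qs t)) \<union> set (snd (ident n Es Qs t))"
  proof
    fix x assume x: "x \<in> set t"
    show "x \<in> set (fst (ident n Es Qs t)) \<union> set (snd (ident n Es Qs t))"
    proof (cases "x \<in> Q")
      case True
      then show ?thesis using 1 x by blast
    next
      case False
      then show ?thesis using component_of_vertex[OF t x False] by (simp add: ident_def)
    qed
  qed
  show "card (set (fst (ident n Es Qs t))) \<le> \<sigma>"
  proof (cases "set t \<subseteq> Q")
    case True
    then have "set ?K = {}" unfolding set_component_of(1) by auto
    then show ?thesis by (simp add: ident_def)
  next
    case False
    then obtain x where x: "x \<in> set t" "x \<notin> Q" by auto
    then show ?thesis using component_bounds(1)[OF t x] by (simp add: ident_def)
  qed
qed

text \<open>The triangles of a class lie in the union of component and key, which has at most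
  \<open>\<sigma> + \<delta> + 3\<close> vertices. Counting all its subsets gives the bound on the
  size of a class.\<close>

theorem class_system_classes:
  "class_system n Qs (\<delta> + 3) (2 ^ (\<sigma> + \<delta> + 3)) (set (tris n Es)) (classes n Es Qs)"
proof -
  let ?TL = "set (tris n Es)" and ?id = "ident n Es Qs"
  define Is where "Is = dedup (map ?id (tris n Es))"
  have cls: "classes n Es Qs = map (\<lambda>i. (snd i, filter (\<lambda>t. ?id t = i) (tris n Es))) Is"
    unfolding classes_def Is_def by simp
  have Is: "distinct Is" "set Is = ?id ` ?TL" by (auto simp: Is_def)
  have cl: "fst c = restrict_to Qs (set (fst c)) \<and> length (fst c) \<le> \<delta> + 3 \<and> length (snd c) \<le> 2 ^ (\<sigma> + \<delta> + 3) \<and>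
        (\<forall>t\<in>set (snd c). set t \<inter> set Qs \<subseteq> set (fst c))" if c: "c \<in> set (classes n Es Qs)" for c
  proof -
    obtain t0 where t0: "t0 \<in> ?TL" "c = (snd (?id t0), filter (\<lambda>t. ?id t = ?id t0) (tris n Es))"
      using c unfolding cls set_map Is(2) image_image by blast
    let ?A = "set (fst (?id t0)) \<union> set (snd (?id t0))"
    have "length (snd c) = card (set (snd c))"
    proof -
      have "distinct (tris n Es)" by (simp add: tris_def)
      then show ?thesis unfolding t0(2) snd_conv by (intro distinct_card[symmetric] distinct_filter)
    qed
    also have "\<dots> = card (set ` set (snd c))"
      by (rule card_image[symmetric], rule inj_on_subset[OF inj_tris]) (auto simp: t0(2))
    also have "\<dots> \<le> card (Pow ?A)"
      by (rule card_mono) (use ident_bounds(3) in \<open>fastforce simp: t0(2)\<close>)+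
    also have "\<dots> = 2 ^ card ?A" by (simp add: card_Pow)
    also have "\<dots> \<le> 2 ^ (\<sigma> + (\<delta> + 3))"
    proof (rule power_increasing)
      show "card ?A \<le> \<sigma> + (\<delta> + 3)"
        using card_Un_le[of "set (fst (?id t0))" "set (snd (?id t0))"] ident_bounds(4)[OF t0(1)]
          ident_bounds(2)[OF t0(1)] card_length[of "snd (?id t0)"] by linarith
    qed simp
    finally have "length (snd c) \<le> 2 ^ (\<sigma> + \<delta> + 3)" by (simp add: add.assoc)
    moreover have "fst c = restrict_to Qs (set (fst c))"
      unfolding t0(2) ident_def key_of_def restrict_to_def by (auto intro!: filter_cong)
    moreover have "\<forall>t\<in>set (snd c). set t \<inter> set Qs \<subseteq> set (fst c)"
      using ident_bounds(1) unfolding t0(2) set_Qs by fastforce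
    ultimately show ?thesis using ident_bounds(2)[OF t0(1)] by (simp add: t0(2))
  qed
  have "set t \<inter> set t' \<subseteq> set Qs"
    if ij: "i < length (classes n Es Qs)" "j < length (classes n Es Qs)" "i \<noteq> j"
      and t: "t \<in> set (snd (classes n Es Qs ! i))" "t' \<in> set (snd (classes n Es Qs ! j))" for i j t t'
  proof
    fix x assume x: "x \<in> set t \<inter> set t'"
    have "?id t = Is ! i" "?id t' = Is ! j" "t \<in> ?TL" "t' \<in> ?TL" using t ij by (auto simp: cls)
    moreover have "Is ! i \<noteq> Is ! j" using Is(1) ij by (simp add: cls nth_eq_iff_index_eq)
    ultimately show "x \<in> set Qs" using ident_eq[of t t' x] x by (auto simp: set_Qs)
  qed
  moreover have "?TL = (\<Union>c\<in>set (classes n Es Qs). set (snd c))" by (auto simp: cls Is)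
  ultimately show ?thesis
    unfolding class_system_def using tri_list inj_tris cl by auto
qed

end

section \<open>Packings, blocks and covers\<close>

definition disjoint_upto :: "nat \<Rightarrow> (nat \<Rightarrow> 'a set) \<Rightarrow> bool" where
  "disjoint_upto r S \<longleftrightarrow> (\<forall>i<r. \<forall>j<r. i \<noteq> j \<longrightarrow> S i \<inter> S j = {})"

lemma card_disjoint_upto:
  "disjoint_upto r S \<Longrightarrow> (\<And>j. j < r \<Longrightarrow> finite (S j)) \<Longrightarrow> card (\<Union>j<r. S j) = (\<Sum>j<r. card (S j))"
  by (rule card_UN_disjoint) (auto simp: disjoint_upto_def)

text \<open>Greedy distribution: while an element is left over, not all \<open>r\<close> parts can
  have \<open>m\<close> elements, so one has room. It serves to spread the hub vertices that no
  triangle occupies over the buckets.\<close>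

lemma extend_to_partition:
  fixes A :: "nat \<Rightarrow> 'a set"
  assumes "finite X" "\<And>j. j < r \<Longrightarrow> A j \<subseteq> X \<and> card (A j) \<le> m" "disjoint_upto r A" "card X \<le> r * m"
  obtains S where "\<And>j. j < r \<Longrightarrow> A j \<subseteq> S j \<and> S j \<subseteq> X \<and> card (S j) \<le> m" "disjoint_upto r S"
    "(\<Union>j<r. S j) = X"
proof -
  have "\<exists>S. (\<forall>j<r. A j \<subseteq> S j \<and> S j \<subseteq> X \<and> card (S j) \<le> m) \<and> disjoint_upto r S \<and>
      (\<Union>j<r. S j) = (\<Union>j<r. A j) \<union> Y" if "finite Y" "Y \<subseteq> X" for Y
    using that
  proof (induction Y rule: finite_induct)
    case empty
    then show ?case using assms by (intro exI[of _ A]) auto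
  next
    case (insert y Y)
    then obtain S where S: "\<forall>j<r. A j \<subseteq> S j \<and> S j \<subseteq> X \<and> card (S j) \<le> m" "disjoint_upto r S"
      "(\<Union>j<r. S j) = (\<Union>j<r. A j) \<union> Y" by auto
    show ?case
    proof (cases "y \<in> (\<Union>j<r. S j)")
      case True
      then show ?thesis using S by (intro exI[of _ S]) auto
    next
      case False
      have fin: "finite (S j)" if "j < r" for j using S(1) that assms(1) finite_subset by blast
      have "\<exists>i<r. card (S i) < m"
      proof (rule ccontr)
        assume "\<not> (\<exists>i<r. card (S i) < m)"
        then have "card (S i) = m" if "i < r" for i using S(1) that by (meson le_less)
        then have "card (\<Union>j<r. S j) = r * m"
          using card_disjoint_upto[OF S(2) fin] by simp
        moreover have "(\<Union>j<r. S j) \<subset> X" using S(1) False insert.prems by blast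
        ultimately show False using psubset_card_mono[OF assms(1), of "\<Union>j<r. S j"] assms(4) by simp
      qed
      then obtain i where i: "i < r" "card (S i) < m" by blast
      let ?S = "S(i := insert y (S i))"
      have "disjoint_upto r ?S"
        using S(2) False i(1) unfolding disjoint_upto_def by auto
      moreover have "\<forall>j<r. A j \<subseteq> ?S j \<and> ?S j \<subseteq> X \<and> card (?S j) \<le> m"
        using S(1) i insert.prems fin[OF i(1)] by (auto simp: card_insert_if)
      moreover have "(\<Union>j<r. ?S j) = (\<Union>j<r. A j) \<union> insert y Y"
        using S(3) i(1) by (auto split: if_splits)
      ultimately show ?thesis by blast
    qed
  qed
  from this[OF assms(1) order_refl] obtain S where S: "(\<forall>j<r. A j \<subseteq> S j \<and> S j \<subseteq> X \<and> card (S j) \<le> m) \<and>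
    disjoint_upto r S \<and> (\<Union>j<r. S j) = (\<Union>j<r. A j) \<union> X" ..
  show ?thesis
  proof (rule that)
    have "(\<Union>j<r. A j) \<subseteq> X" using assms(2) by blast
    then show "(\<Union>j<r. S j) = X" using S by blast
  qed (use S in blast)+
qed

text \<open>
  Every token pair must be covered, and the budget leaves exactly one set per pair; a single set
  covering a whole pair is a block set.
\<close>

lemma cover_blocks:
  fixes \<A> :: "(nat set \<times> nat) set"
  assumes sub: "\<S> \<subseteq> {{x} |x. x < p + r + r} \<union> {A \<union> {p + j, p + r + j} |A j. (A, j) \<in> \<A>}"
    and \<A>: "\<And>A j. (A, j) \<in> \<A> \<Longrightarrow> A \<subseteq> {..<p} - T \<and> j < r" and T: "T \<subseteq> {..<p}"
    and cov: "\<Union>\<S> = {..<p + r + r}" and fin: "finite \<S>" and card: "card \<S> \<le> r + card T"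
  obtains f where "\<And>j. j < r \<Longrightarrow> (f j, j) \<in> \<A>" "{..<p} - T \<subseteq> (\<Union>j<r. f j)"
proof -
  define \<T> where "\<T> = (\<lambda>x. {x}) ` T"
  \<comment> \<open>Block sets avoid \<open>T\<close>, so its elements can be covered by singletons
    only. This uses up \<open>card T\<close> of the budget and leaves \<open>r\<close>.\<close>
  have "\<T> \<subseteq> \<S>"
  proof
    fix X assume "X \<in> \<T>"
    then obtain x where x: "X = {x}" "x \<in> T" by (auto simp: \<T>_def)
    then have "x < p" using T by auto
    then have "x \<in> \<Union>\<S>" using cov by simp
    then obtain X' where "X' \<in> \<S>" "x \<in> X'" by blast
    moreover have "X' = {x}"
    proof -
      have "X' \<noteq> A \<union> {p + j, p + r + j}" if "(A, j) \<in> \<A>" for A j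
        using \<A>[OF that] x(2) \<open>x < p\<close> \<open>x \<in> X'\<close> by auto
      then show ?thesis using sub \<open>X' \<in> \<S>\<close> \<open>x \<in> X'\<close> by blast
    qed
    ultimately show "X \<in> \<S>" using x by simp
  qed
  have "finite T" using T finite_subset by blast
  then have "card \<T> = card T" unfolding \<T>_def by (intro card_image) auto
  define \<S>' where "\<S>' = \<S> - \<T>"
  have S': "card \<S>' \<le> r" "finite \<S>'"
    using card card_Diff_subset[OF finite_subset[OF \<open>\<T> \<subseteq> \<S>\<close> fin] \<open>\<T> \<subseteq> \<S>\<close>] \<open>card \<T> = card T\<close> fin by (auto simp: \<S>'_def)
  define H where "H = (\<lambda>j. {X \<in> \<S>. p + j \<in> X \<or> p + r + j \<in> X})"
  have H_sub: "H j \<subseteq> \<S>'" if "j < r" for j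
    using that T by (auto simp: H_def \<S>'_def \<T>_def)
  have H_fin: "finite (H j)" for j using fin by (auto simp: H_def)
  have H_dis: "disjoint_upto r H"
  proof -
    have "j = j'" if "X \<in> H j" "X \<in> H j'" "j < r" "j' < r" for X j j'
    proof -
      have "X \<in> \<S>" using that by (auto simp: H_def)
      then consider x where "X = {x}" | A i where "(A, i) \<in> \<A>" "X = A \<union> {p + i, p + r + i}" using sub by blast
      then show ?thesis
      proof cases
        case 1
        then show ?thesis using that by (auto simp: H_def)
      next
        case 2
        then have "A \<subseteq> {..<p}" "i < r" using \<A> by auto
        then show ?thesis using that 2 by (auto simp: H_def)
      qed
    qed
    then show ?thesis unfolding disjoint_upto_def by blast
  qed
  have H_ne: "card (H j) \<ge> 1" if "j < r" for j
  proof -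
    have "p + j \<in> \<Union>\<S>" using cov that by simp
    then have "H j \<noteq> {}" by (auto simp: H_def)
    then show ?thesis using H_fin by (simp add: Suc_le_eq card_gt_0_iff)
  qed
  have un: "card (\<Union>j<r. H j) = (\<Sum>j<r. card (H j))"
    by (rule card_disjoint_upto[OF H_dis H_fin])
  have "(\<Union>j<r. H j) \<subseteq> \<S>'" using H_sub by auto
  then have le: "(\<Sum>j<r. card (H j)) \<le> r" using card_mono[OF S'(2)] S'(1) un by (metis le_trans)
  have one: "card (H j) = 1" if "j < r" for j
  proof (rule ccontr)
    assume "card (H j) \<noteq> 1"
    then have "1 < card (H j)" using H_ne[OF that] by simp
    then have "(\<Sum>j<r. 1) < (\<Sum>j<r. card (H j))"
      using that H_ne by (intro sum_strict_mono_ex1) auto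
    then show False using le by simp
  qed
  have "(\<Union>j<r. H j) = \<S>'"
    by (rule card_seteq[OF S'(2)]) (use H_sub S'(1) un one in auto)
  have "\<exists>A. (A, j) \<in> \<A> \<and> H j = {A \<union> {p + j, p + r + j}}" if j: "j < r" for j
  proof -
    obtain X where X: "H j = {X}" using one[OF j] by (auto simp: card_1_singleton_iff)
    have "p + j \<in> \<Union>\<S>" "p + r + j \<in> \<Union>\<S>" using cov j by auto
    then have "p + j \<in> X" "p + r + j \<in> X" using X by (auto simp: H_def)
    moreover have "X \<in> \<S>" using X by (auto simp: H_def)
    \<comment> \<open>The only set that touches the pair contains two different tokens and hence is
      no singleton.\<close>
    moreover have "p + j \<noteq> p + r + j" using j by simp
    ultimately obtain A i where A: "(A, i) \<in> \<A>" "X = A \<union> {p + i, p + r + i}" using sub by blast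
    then have "A \<subseteq> {..<p}" "i < r" using \<A> by auto
    then have "i = j" using A \<open>p + j \<in> X\<close> j by auto
    then show ?thesis using A X by blast
  qed
  then obtain f where f: "\<And>j. j < r \<Longrightarrow> (f j, j) \<in> \<A> \<and> H j = {f j \<union> {p + j, p + r + j}}" by metis
  show thesis
  proof (rule that)
    show "\<And>j. j < r \<Longrightarrow> (f j, j) \<in> \<A>" using f by blast
    show "{..<p} - T \<subseteq> (\<Union>j<r. f j)"
    proof
      fix x assume x: "x \<in> {..<p} - T"
      then have "x \<in> \<Union>\<S>" using cov by simp
      then obtain X where X: "X \<in> \<S>" "x \<in> X" by blast
      have "X \<notin> \<T>" using X x by (auto simp: \<T>_def)
      then have "X \<in> (\<Union>j<r. H j)" using X \<open>(\<Union>j<r. H j) = \<S>'\<close> by (simp add: \<S>'_def)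
      then obtain j where "j < r" "X = f j \<union> {p + j, p + r + j}" using f by auto
      then show "x \<in> (\<Union>j<r. f j)" using X x by auto
    qed
  qed
qed

lemma positions_eq: "positions Qs U = filter (\<lambda>i. Qs ! i \<in> set U) [0..<length Qs]"
proof -
  have "zip Qs [0..<length Qs] = map (\<lambda>i. (Qs ! i, i)) [0..<length Qs]"
    by (rule nth_equalityI) auto
  then show ?thesis by (simp add: positions_def dn_def filter_map comp_def)
qed

lemma set_positions: "set (positions Qs U) = {i. i < length Qs \<and> Qs ! i \<in> set U}"
  by (auto simp: positions_eq)

lemma nth_image_positions: "(\<lambda>i. Qs ! i) ` set (positions Qs U) = set Qs \<inter> set U"
  unfolding set_positions by (auto simp: in_set_conv_nth[of _ Qs])

lemma card_positions: "distinct Qs \<Longrightarrow> card (set (positions Qs U)) = card (set Qs \<inter> set U)"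
  unfolding nth_image_positions[symmetric]
  by (rule card_image[symmetric]) (auto simp: set_positions inj_on_def nth_eq_iff_index_eq)

section \<open>Packings of triangles as compatible sets of moves\<close>

definition packs :: "nat list set \<Rightarrow> bool" where
  "packs Y \<longleftrightarrow> pairwise (\<lambda>t t'. disjnt (set t) (set t')) Y"

definition cov :: "nat list set \<Rightarrow> nat set" where
  "cov Y = (\<Union>t\<in>Y. set t)"

definition moves :: "(nat list \<times> nat list list) list \<Rightarrow> move list list" where
  "moves cs = map (\<lambda>c. map (\<lambda>t. (t, 1)) (snd c)) cs"

lemma concat_map_if: "concat (map (\<lambda>c. if P c then [f c] else []) xs) = map f (filter P xs)"
  by (induction xs) auto

lemma bucket_eq: "bucket cls Is lab j = moves (filter (\<lambda>c. (fst c, j) \<in> set (zip Is lab)) cls)"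
  unfolding bucket_def moves_def by (rule concat_map_if)

lemma tail_eq: "tail cls Is lab xs = moves (filter (\<lambda>c. \<exists>x\<in>set xs. fst (snd x) \<and> (fst c, fst x) \<in> set (zip Is lab)) cls)"
  unfolding tail_def moves_def by (rule concat_map_if)

text \<open>The condition is symmetric in the two positions, so ordered pairs suffice; in the form
  of \<open>sorted_wrt\<close> it passes to filtered and appended lists.\<close>

lemma separated_iff:
  "separated Q mss \<longleftrightarrow> (\<forall>ms\<in>set mss. \<forall>m\<in>set ms. fst m \<noteq> []) \<and>
    sorted_wrt (\<lambda>ms ms'. \<forall>m\<in>set ms. \<forall>m'\<in>set ms'. set (fst m) \<inter> set (fst m') \<subseteq> Q) mss"
  (is "_ \<longleftrightarrow> ?ne \<and> ?s")
proof
  assume s: "separated Q mss"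
  have ?s unfolding sorted_wrt_iff_nth_less
  proof (intro allI impI)
    fix i j assume "i < j" "j < length mss"
    then have "i < length mss" "j < length mss" "i \<noteq> j" by auto
    then show "\<forall>m\<in>set (mss ! i). \<forall>m'\<in>set (mss ! j). set (fst m) \<inter> set (fst m') \<subseteq> Q"
      using s unfolding separated_def by blast
  qed
  then show "?ne \<and> ?s" using s unfolding separated_def by blast
next
  assume *: "?ne \<and> ?s"
  have "\<forall>m\<in>set (mss ! i). \<forall>m'\<in>set (mss ! j). set (fst m) \<inter> set (fst m') \<subseteq> Q"
    if "i < length mss" "j < length mss" "i \<noteq> j" for i j
  proof (cases "i < j")
    case True
    then show ?thesis using * that unfolding sorted_wrt_iff_nth_less by blast
  next
    case False
    then have "\<forall>m\<in>set (mss ! j). \<forall>m'\<in>set (mss ! i). set (fst m) \<inter> set (fst m') \<subseteq> Q"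
      using * that unfolding sorted_wrt_iff_nth_less by (metis nat_neq_iff)
    then show ?thesis by (metis Int_commute)
  qed
  then show "separated Q mss" using * unfolding separated_def by blast
qed

locale class_system_loc =
  fixes n :: nat and Qs :: "nat list" and \<mu> M :: nat and TL :: "nat list set" and cls :: "(nat list \<times> nat list list) list"
  assumes system: "class_system n Qs \<mu> M TL cls" and distinct_Qs: "distinct Qs" and Qs_sub: "set Qs \<subseteq> {..<n}"
begin

abbreviation Q :: "nat set" where "Q \<equiv> set Qs"

definition TLof :: "(nat list \<times> nat list list \<Rightarrow> bool) \<Rightarrow> nat list set" where
  "TLof P = (\<Union>c\<in>{c \<in> set cls. P c}. set (snd c))"

lemma tri: "t \<in> TL \<Longrightarrow> length t = 3 \<and> distinct t \<and> set t \<subseteq> {..<n}"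
  and inj_TL: "inj_on set TL" and TL_eq: "TL = TLof (\<lambda>_. True)"
  and cl_key: "c \<in> set cls \<Longrightarrow> fst c = restrict_to Qs (set (fst c)) \<and> length (fst c) \<le> \<mu> \<and> length (snd c) \<le> M"
  and cl_Q: "c \<in> set cls \<Longrightarrow> t \<in> set (snd c) \<Longrightarrow> set t \<inter> Q \<subseteq> set (fst c)"
  using system unfolding class_system_def TLof_def by auto

lemma tri_ne: "t \<in> TL \<Longrightarrow> set t \<noteq> {}"
  using tri by fastforce

lemma TLof_sub: "TLof P \<subseteq> TL"
  unfolding TL_eq by (auto simp: TLof_def)

lemma finite_TL: "finite TL"
  unfolding TL_eq TLof_def by auto

lemma finite_sub: "Y \<subseteq> TLof P \<Longrightarrow> finite Y"
  using TLof_sub finite_TL finite_subset by (meson subset_trans)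

lemma cl_sep: "c \<in> set cls \<Longrightarrow> c' \<in> set cls \<Longrightarrow> c \<noteq> c' \<Longrightarrow> t \<in> set (snd c) \<Longrightarrow> t' \<in> set (snd c') \<Longrightarrow> set t \<inter> set t' \<subseteq> Q"
  using system unfolding class_system_def by (metis in_set_conv_nth)

lemma cls_sorted: "sorted_wrt (\<lambda>c c'. \<forall>t\<in>set (snd c). \<forall>t'\<in>set (snd c'). set t \<inter> set t' \<subseteq> Q) cls"
  unfolding sorted_wrt_iff_nth_less
proof (intro allI impI)
  fix i j assume "i < j" "j < length cls"
  then show "\<forall>t\<in>set (snd (cls ! i)). \<forall>t'\<in>set (snd (cls ! j)). set t \<inter> set t' \<subseteq> Q"
    using system less_trans[of i j "length cls"] unfolding class_system_def by (metis nat_neq_iff)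
qed

lemma separated_moves: "separated Q (moves (filter P cls))"
  unfolding separated_iff
proof
  show "\<forall>ms\<in>set (moves (filter P cls)). \<forall>m\<in>set ms. fst m \<noteq> []"
    using tri_ne unfolding TL_eq by (fastforce simp: moves_def TLof_def)
  show "sorted_wrt (\<lambda>ms ms'. \<forall>m\<in>set ms. \<forall>m'\<in>set ms'. set (fst m) \<inter> set (fst m') \<subseteq> Q) (moves (filter P cls))"
    using sorted_wrt_filter[OF cls_sorted, of P] by (simp add: moves_def sorted_wrt_map)
qed

text \<open>Waste moves lie inside the hub, where the condition allows any overlap.\<close>

lemma separated_waste: "separated Q (moves (filter P cls) @ waste Qs)"
proof -
  have "sorted_wrt (\<lambda>ms ms'. \<forall>m\<in>set ms. \<forall>m'\<in>set ms'. set (fst m) \<inter> set (fst m') \<subseteq> Q) (waste Qs)"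
    unfolding waste_def sorted_wrt_map by (rule sorted_wrt_mono_rel[of _ "\<lambda>_ _. True"]) (auto simp: sorted_wrt_iff_nth_less)
  then show ?thesis
    using separated_moves[of P] unfolding separated_iff sorted_wrt_append by (auto simp: waste_def)
qed

lemma set_concat_moves: "set (concat (moves (filter P cls))) = (\<lambda>t. (t, 1)) ` TLof P"
  by (auto simp: moves_def TLof_def)

lemma tri_moves:
  assumes "Y \<subseteq> TLof P"
  shows "covered ((\<lambda>t. (t, 1)) ` Y) = cov Y" "compatible ((\<lambda>t. (t, 1)) ` Y) \<longleftrightarrow> packs Y" "gain ((\<lambda>t. (t, 1)) ` Y) = card Y"
  by (auto simp: covered_def cov_def compatible_def packs_def pairwise_image gain_def sum.reindex inj_on_def pairwise_def)

lemma dp_moves: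
  "set (dp Qs k (moves (filter P cls))) =
    {(restrict_to Qs (cov Y), card Y) |Y. Y \<subseteq> TLof P \<and> packs Y \<and> card (Q \<inter> cov Y) \<le> k}"
  unfolding dp_iff[OF distinct_Qs separated_moves] set_concat_moves
proof (intro equalityI subsetI)
  fix x assume "x \<in> {(restrict_to Qs (covered X), gain X) |X. X \<subseteq> (\<lambda>t. (t, 1)) ` TLof P \<and> compatible X \<and> card (Q \<inter> covered X) \<le> k}"
  then obtain X where X: "X \<subseteq> (\<lambda>t. (t, 1)) ` TLof P" "compatible X" "card (Q \<inter> covered X) \<le> k"
    "x = (restrict_to Qs (covered X), gain X)" by blast
  then obtain Y where Y: "Y \<subseteq> TLof P" "X = (\<lambda>t. (t, 1)) ` Y" by (auto simp: subset_image_iff)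
  then show "x \<in> {(restrict_to Qs (cov Y), card Y) |Y. Y \<subseteq> TLof P \<and> packs Y \<and> card (Q \<inter> cov Y) \<le> k}"
    using X(2-4) tri_moves[OF Y(1)] by auto
next
  fix x assume "x \<in> {(restrict_to Qs (cov Y), card Y) |Y. Y \<subseteq> TLof P \<and> packs Y \<and> card (Q \<inter> cov Y) \<le> k}"
  then obtain Y where Y: "Y \<subseteq> TLof P" "packs Y" "card (Q \<inter> cov Y) \<le> k" "x = (restrict_to Qs (cov Y), card Y)" by blast
  then show "x \<in> {(restrict_to Qs (covered X), gain X) |X. X \<subseteq> (\<lambda>t. (t, 1)) ` TLof P \<and> compatible X \<and> card (Q \<inter> covered X) \<le> k}"
    using tri_moves[OF Y(1)] by (intro CollectI exI[of _ "(\<lambda>t. (t, 1)) ` Y"]) auto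
qed

lemma set_waste: "set (concat (waste Qs)) = (\<lambda>q. ([q], 0)) ` Q"
  by (auto simp: waste_def)

text \<open>Removing the waste moves leaves the gain unchanged and only shrinks the occupied set.
  Hence \<open>U\<close> is an upper bound for the hub vertices that the packing uses.\<close>

lemma dp_waste_sound:
  assumes "(U, v) \<in> set (dp Qs k (moves (filter P cls) @ waste Qs))"
  shows "\<exists>Y\<subseteq>TLof P. packs Y \<and> card Y = v \<and> Q \<inter> cov Y \<subseteq> set U \<and> U = restrict_to Qs (set U) \<and> length U \<le> k"
proof -
  obtain X where X: "X \<subseteq> set (concat (moves (filter P cls) @ waste Qs))" "compatible X"
    "card (Q \<inter> covered X) \<le> k" "U = restrict_to Qs (covered X)" "v = gain X"
    using assms unfolding dp_iff[OF distinct_Qs separated_waste] by blast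
  define Y where "Y = {t \<in> TLof P. (t, 1) \<in> X}"
  define Z where "Z = X - (\<lambda>t. (t, 1)) ` Y"
  have Z: "Z \<subseteq> (\<lambda>q. ([q], 0)) ` Q"
    using X(1) set_concat_moves[of P] set_waste by (auto simp: Z_def Y_def)
  have "finite Y" using finite_sub[of Y P] by (auto simp: Y_def)
  have XY: "X = (\<lambda>t. (t, 1)) ` Y \<union> Z" by (auto simp: Z_def Y_def)
  have "gain X = gain ((\<lambda>t. (t, 1)) ` Y) + gain Z"
    unfolding gain_def XY
    by (rule sum.union_disjoint) (use \<open>finite Y\<close> finite_subset[OF Z] in \<open>auto simp: Z_def\<close>)
  moreover have "gain Z = 0" unfolding gain_def by (rule sum.neutral) (use Z in auto)
  ultimately have "card Y = v" using tri_moves(3)[of Y P] X(5) by (auto simp: Y_def)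
  moreover have "packs Y"
    using compatible_mono[OF X(2), of "(\<lambda>t. (t, 1)) ` Y"] tri_moves(2)[of Y P] by (auto simp: Y_def)
  moreover have "cov Y \<subseteq> covered X" by (auto simp: cov_def covered_def Y_def)
  moreover have "length U \<le> k" using X(3,4) length_restrict_to[OF distinct_Qs] by simp
  moreover have "U = restrict_to Qs (set U)" using X(4) by (simp add: restrict_to_eq_iff)
  ultimately show ?thesis using X(4) by (intro exI[of _ Y]) (auto simp: Y_def)
qed

text \<open>One waste move for each vertex of \<open>A\<close> that the packing does not occupy
  fills the set up to exactly \<open>A\<close>.\<close>

lemma dp_waste_complete:
  assumes "Y \<subseteq> TLof P" "packs Y" "Q \<inter> cov Y \<subseteq> A" "A \<subseteq> Q" "card A \<le> k"
  shows "(restrict_to Qs A, card Y) \<in> set (dp Qs k (moves (filter P cls) @ waste Qs))"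
proof -
  define Z where "Z = (\<lambda>q. ([q], 0 :: nat)) ` (A - cov Y)"
  define X where "X = (\<lambda>t. (t, 1)) ` Y \<union> Z"
  have covZ: "covered Z = A - cov Y" by (auto simp: Z_def covered_def)
  have covX: "covered X = cov Y \<union> A"
    unfolding X_def covered_Un tri_moves(1)[OF assms(1)] covZ by blast
  have "compatible Z" by (auto simp: Z_def compatible_def pairwise_def disjnt_def)
  then have "compatible X"
    unfolding X_def using tri_moves[OF assms(1)] assms(2) covZ by (intro compatible_Un) auto
  moreover have "gain X = card Y"
  proof -
    have "finite A" using assms(4) finite_subset by blast
    then have "gain X = gain ((\<lambda>t. (t, 1)) ` Y) + gain Z"
      unfolding gain_def X_def
      by (intro sum.union_disjoint) (use finite_sub[OF assms(1)] in \<open>auto simp: Z_def\<close>)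
    moreover have "gain Z = 0" unfolding gain_def by (rule sum.neutral) (auto simp: Z_def)
    ultimately show ?thesis using tri_moves(3)[OF assms(1)] by simp
  qed
  moreover have "Q \<inter> covered X = A" using covX assms(3,4) by auto
  moreover have "X \<subseteq> set (concat (moves (filter P cls) @ waste Qs))"
    using set_concat_moves[of P] set_waste assms(1,4) by (auto simp: X_def Z_def)
  moreover have "restrict_to Qs (covered X) = restrict_to Qs A"
    unfolding restrict_to_eq_iff using \<open>Q \<inter> covered X = A\<close> assms(4) by blast
  ultimately show ?thesis
    unfolding dp_iff[OF distinct_Qs separated_waste] using assms(5)
    by (intro CollectI exI[of _ X] conjI) auto
qed

lemma base_ge:
  assumes "Y \<subseteq> TLof P" "packs Y" "Q \<inter> cov Y = {}"
  shows "card Y \<le> base Qs (moves (filter P cls))"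
proof -
  have "(restrict_to Qs (cov Y), card Y) \<in> set (dp Qs 0 (moves (filter P cls)))"
    unfolding dp_moves using assms by auto
  then show ?thesis unfolding base_def by (intro max_list_ge) force
qed

lemma base_attained:
  "\<exists>Y\<subseteq>TLof P. packs Y \<and> Q \<inter> cov Y = {} \<and> card Y = base Qs (moves (filter P cls))"
proof -
  \<comment> \<open>The default 0 of \<open>max_list\<close> does no harm, since the empty packing
    attains it.\<close>
  have *: "base Qs (moves (filter P cls)) \<in> insert 0 (snd ` set (dp Qs 0 (moves (filter P cls))))"
    unfolding base_def using max_list_mem[of "map (\<lambda>s. snd s) (dp Qs 0 (moves (filter P cls)))"] by simp
  show ?thesis
  proof (cases "base Qs (moves (filter P cls)) = 0")
    case True
    then show ?thesis by (intro exI[of _ "{}"]) (auto simp: packs_def cov_def)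
  next
    case False
    then obtain Y where "Y \<subseteq> TLof P" "packs Y" "card (Q \<inter> cov Y) \<le> 0" "card Y = base Qs (moves (filter P cls))"
      using * unfolding dp_moves by force
    then show ?thesis by auto
  qed
qed

end

lemma list_as_map: "distinct ks \<Longrightarrow> length g = length ks \<Longrightarrow> \<exists>f. g = map f ks"
  by (intro exI[of _ "\<lambda>k. the (map_of (zip ks g) k)"] nth_equalityI) (auto simp: map_of_zip_nth)

lemma sum_list_dn: "(\<Sum>x\<leftarrow>map (\<lambda>j. (j, f j)) (dn r). h x) = (\<Sum>j<r. h (j, f j))"
  by (simp add: comp_def sum_list_distinct_conv_sum_set)

lemma set_vectors: "set (vectors os r) = {g. length g = r \<and> set g \<subseteq> set os}"
proof -
  have "set (fold (\<lambda>_ L. concat (map (\<lambda>x. map (\<lambda>g. x # g) L) os)) ks [[]]) = {g. length g = length ks \<and> set g \<subseteq> set os}"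
    for ks :: "nat list"
  proof (induction ks rule: rev_induct)
    case (snoc k ks)
    show ?case
    proof (intro set_eqI)
      fix g
      show "g \<in> set (fold (\<lambda>_ L. concat (map (\<lambda>x. map (\<lambda>g. x # g) L) os)) (ks @ [k]) [[]]) \<longleftrightarrow>
          g \<in> {g. length g = length (ks @ [k]) \<and> set g \<subseteq> set os}"
        using snoc.IH by (cases g) auto
    qed
  qed auto
  from this[of "dn r"] show ?thesis by (simp add: vectors_def)
qed

lemma set_choices: "(b, s, w) \<in> set (choices m) \<longleftrightarrow> s \<le> m \<and> w \<le> m"
  unfolding choices_def by (cases b) (auto simp: image_iff)

text \<open>Converse of \<open>card_disjoint_upto\<close>. If two of the sets shared an element,
  deleting it from one of them would keep the union and lower the sum of the cardinalities below the
  size of the union.\<close>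

lemma disjoint_uptoI:
  fixes A :: "nat \<Rightarrow> 'a set"
  assumes "\<And>j. j < r \<Longrightarrow> finite (A j)" "(\<Sum>j<r. card (A j)) \<le> card (\<Union>j<r. A j)"
  shows "disjoint_upto r A"
  unfolding disjoint_upto_def
proof (intro allI impI, rule ccontr)
  fix i j assume ij: "i < r" "j < r" "i \<noteq> j" and "A i \<inter> A j \<noteq> {}"
  then obtain x where x: "x \<in> A i" "x \<in> A j" by blast
  let ?A = "A(i := A i - {x})"
  have "(\<Union>j<r. A j) = (\<Union>j<r. ?A j)" using ij x by (auto split: if_splits)
  then have "card (\<Union>j<r. A j) \<le> (\<Sum>j<r. card (?A j))" using card_UN_le[of "{..<r}" ?A] by simp
  also have "\<dots> < (\<Sum>j<r. card (A j))"
    by (rule sum_strict_mono_ex1) (use ij x assms(1) card_Diff1_less[of "A i" x] in \<open>auto intro: less_imp_le bexI[of _ i]\<close>)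
  finally show False using assms(2) by simp
qed

lemma packs_mono: "packs Y \<Longrightarrow> Y' \<subseteq> Y \<Longrightarrow> packs Y'"
  unfolding packs_def by (rule pairwise_subset)

text \<open>Disjoint lists that meet \<open>B\<close> meet it in different elements.\<close>

lemma packs_card_le:
  assumes "packs Y" "finite Y" "finite B" "\<And>t. t \<in> Y \<Longrightarrow> set t \<inter> B \<noteq> {}"
  shows "card Y \<le> card B"
proof -
  have "card Y = (\<Sum>t\<in>Y. 1)" by simp
  also have "\<dots> \<le> (\<Sum>t\<in>Y. card (set t \<inter> B))"
    by (rule sum_mono) (use assms(4) in \<open>auto simp: Suc_le_eq card_gt_0_iff\<close>)
  also have "\<dots> = card (\<Union>t\<in>Y. set t \<inter> B)"
    by (rule card_UN_disjoint[symmetric]) (use assms(1,2) in \<open>auto simp: packs_def pairwise_def disjnt_def\<close>)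
  also have "\<dots> \<le> card B" by (rule card_mono) (use assms(3) in auto)
  finally show ?thesis .
qed

lemma set_block_sets:
  "set (block_sets m Qs cls Is lab xs) = {(U, fst x) |U v x. x \<in> set xs \<and>
    (U, v) \<in> set (dp Qs m (block cls Is lab x @ waste Qs)) \<and> length U = fst (snd (snd x)) \<and>
    base Qs (block cls Is lab x) + snd (snd (snd x)) \<le> v}"
  (is "?L = ?R")
proof (intro equalityI subsetI)
  have eq: "?L = (\<Union>x\<in>set xs. (\<lambda>s. (fst s, fst x)) ` {s \<in> set (dp Qs m (block cls Is lab x @ waste Qs)).
      length (fst s) = fst (snd (snd x)) \<and> base Qs (block cls Is lab x) + snd (snd (snd x)) \<le> snd s})"
    unfolding block_sets_def by (simp only: set_concat set_map set_filter image_image)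
  {
  fix z assume "z \<in> ?L"
  then obtain x s where "x \<in> set xs" "s \<in> set (dp Qs m (block cls Is lab x @ waste Qs))" "length (fst s) = fst (snd (snd x))"
    "base Qs (block cls Is lab x) + snd (snd (snd x)) \<le> snd s" "z = (fst s, fst x)"
    unfolding eq by blast
  then show "z \<in> ?R" by (intro CollectI exI[of _ "fst s"] exI[of _ "snd s"] exI[of _ x]) simp
  }
  fix z assume "z \<in> ?R"
  then obtain U v x where "x \<in> set xs" "(U, v) \<in> set (dp Qs m (block cls Is lab x @ waste Qs))" "length U = fst (snd (snd x))"
    "base Qs (block cls Is lab x) + snd (snd (snd x)) \<le> v" "z = (U, fst x)" by blast
  then show "z \<in> ?L"
    unfolding eq by (intro UN_I[of x] image_eqI[of _ _ "(U, v)"]) auto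
qed

lemma set_cover_family:
  "set ` set (cover_family Qs r Ss T) = {{x} |x. x < length Qs + r + r} \<union>
    {A \<union> {length Qs + j, length Qs + r + j} |A j. (A, j) \<in> {(set (positions Qs U), j) |U j. (U, j) \<in> set Ss \<and> set U \<inter> set T = {}}}"
proof -
  have "set ` set (map (\<lambda>x. [x]) (dn (length Qs + r + r))) = {{x} |x. x < length Qs + r + r}"
    by (auto simp: image_image)
  moreover have "set ` set (dedup (map (\<lambda>s. positions Qs (fst s) @ [length Qs + snd s, length Qs + r + snd s])
       (filter (\<lambda>s. \<not> (\<exists>q\<in>set (fst s). q \<in> set T)) Ss))) =
    {A \<union> {length Qs + j, length Qs + r + j} |A j. (A, j) \<in> {(set (positions Qs U), j) |U j. (U, j) \<in> set Ss \<and> set U \<inter> set T = {}}}"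
    by (auto simp: image_iff) (metis disjoint_iff fst_conv snd_conv, blast)
  ultimately show ?thesis unfolding cover_family_def set_append image_Un by (simp only:)
qed

context class_system_loc
begin

abbreviation Is :: "nat list list" where "Is \<equiv> dedup (map fst cls)"

definition inb :: "nat list \<Rightarrow> nat list \<times> nat list list \<Rightarrow> nat \<Rightarrow> bool" where
  "inb lab c j \<longleftrightarrow> (fst c, j) \<in> set (zip Is lab)"

lemma inb_unique: "inb lab c i \<Longrightarrow> inb lab c j \<Longrightarrow> i = j"
proof -
  have "distinct (map fst (zip Is lab))" by (simp add: map_fst_zip_take)
  then show "inb lab c i \<Longrightarrow> inb lab c j \<Longrightarrow> i = j" unfolding inb_def by (rule eq_key_imp_eq_value)
qed

lemma block_moves: "block cls Is lab (j, b, sw) = moves (filter (\<lambda>c. \<not> b \<and> inb lab c j) cls)"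
  by (cases b) (auto simp: block_def bucket_eq inb_def moves_def)

lemma block_moves': "block cls Is lab (j, x) = moves (filter (\<lambda>c. \<not> fst x \<and> inb lab c j) cls)"
  using block_moves[of lab j "fst x" "snd x"] by simp

lemma tail_moves: "tail cls Is lab (map (\<lambda>j. (j, f j)) (dn r)) = moves (filter (\<lambda>c. \<exists>j<r. fst (f j) \<and> inb lab c j) cls)"
proof -
  have "(\<exists>x\<in>set (map (\<lambda>j. (j, f j)) (dn r)). fst (snd x) \<and> (fst c, fst x) \<in> set (zip Is lab)) \<longleftrightarrow> (\<exists>j<r. fst (f j) \<and> inb lab c j)" for c
    by (auto simp: inb_def)
  then show ?thesis unfolding tail_eq by simp
qed

lemma TLof_separate:
  assumes "t \<in> TLof P" "t' \<in> TLof P'" "\<And>c. P c \<Longrightarrow> P' c \<Longrightarrow> False"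
  shows "set t \<inter> set t' \<subseteq> Q"
  using assms cl_sep unfolding TLof_def by blast

text \<open>The cover yields one block set per bucket, together containing all hub vertices outside
  \<open>T\<close>. As the sizes leave no room for overlap, the sets are disjoint; packings of
  different blocks then share neither hub vertices nor, by separation of classes, other
  vertices.\<close>

lemma core_sound:
  assumes g: "length g = r" and xs: "xs = zip (dn r) g"
    and T: "(T, v) \<in> set (dp Qs k (tail cls Is lab xs))" and tt: "tt \<le> need Qs cls Is lab xs + v"
    and size: "sum_list (map (\<lambda>x. fst (snd (snd x))) xs) + length T = length Qs"
    and cover: "has_set_cover {..<length Qs + r + r} (set ` set (cover_family Qs r (block_sets m Qs cls Is lab xs) T)) (int (r + length T))"
  shows "\<exists>Y\<subseteq>TL. packs Y \<and> tt \<le> card Y"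
proof -
  let ?p = "length Qs"
  obtain f where f: "g = map f (dn r)" using list_as_map[of "dn r" g] g by auto
  have xs': "xs = map (\<lambda>j. (j, f j)) (dn r)" unfolding xs f by (simp add: zip_map2 zip_same_conv_map)
  define P where "P = (\<lambda>j c. \<not> fst (f j) \<and> inb lab c j)"
  define PT where "PT = (\<lambda>c. \<exists>j<r. fst (f j) \<and> inb lab c j)"
  obtain YT where YT: "YT \<subseteq> TLof PT" "packs YT" "T = restrict_to Qs (cov YT)" "v = card YT"
    using T unfolding xs' tail_moves PT_def[symmetric] dp_moves by blast
  have dT: "distinct T" using YT(3) distinct_Qs by (simp add: restrict_to_def)
  have TQ: "set T \<subseteq> Q" using YT(3) by auto
  define \<A> where "\<A> = {(set (positions Qs U), j) |U j. (U, j) \<in> set (block_sets m Qs cls Is lab xs) \<and> set U \<inter> set T = {}}"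
  have bs: "\<exists>Y\<subseteq>TLof (P j). packs Y \<and> base Qs (block cls Is lab (j, f j)) + snd (snd (f j)) \<le> card Y \<and>
      Q \<inter> cov Y \<subseteq> set U \<and> set U \<subseteq> Q \<and> card (set U) = fst (snd (f j)) \<and> j < r"
    if Uj: "(U, j) \<in> set (block_sets m Qs cls Is lab xs)" for U j
  proof -
    obtain w x where x: "x \<in> set xs" "j = fst x" and w': "(U, w) \<in> set (dp Qs m (block cls Is lab x @ waste Qs))"
      "length U = fst (snd (snd x))" "base Qs (block cls Is lab x) + snd (snd (snd x)) \<le> w"
      using Uj unfolding set_block_sets by blast
    have j: "j < r" and xj: "x = (j, f j)" using x unfolding xs' by auto
    have w: "(U, w) \<in> set (dp Qs m (moves (filter (P j) cls) @ waste Qs))"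
      "length U = fst (snd (f j))" "base Qs (block cls Is lab (j, f j)) + snd (snd (f j)) \<le> w"
      using w' unfolding xj P_def block_moves'[symmetric] by simp_all
    obtain Y where Y: "Y \<subseteq> TLof (P j)" "packs Y" "card Y = w" "Q \<inter> cov Y \<subseteq> set U" "U = restrict_to Qs (set U)"
      using dp_waste_sound[OF w(1)] by blast
    have "distinct U" using distinct_Qs by (subst Y(5)) (simp add: restrict_to_def)
    moreover have "set U \<subseteq> Q" using set_restrict_to[of Qs "set U"] unfolding Y(5)[symmetric] by blast
    ultimately
    show ?thesis using Y w j distinct_card by metis
  qed
  obtain \<S> where \<S>: "\<S> \<subseteq> set ` set (cover_family Qs r (block_sets m Qs cls Is lab xs) T)"
    "\<Union>\<S> = {..<?p + r + r}" "card \<S> \<le> r + length T"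
    using cover unfolding has_set_cover_def by auto
  have "card (set (positions Qs T)) = length T"
    using card_positions[OF distinct_Qs, of T] dT TQ by (simp add: Int_absorb1 distinct_card)
  then have card\<S>: "card \<S> \<le> r + card (set (positions Qs T))" using \<S>(3) by simp
  have \<A>: "A \<subseteq> {..<?p} - set (positions Qs T) \<and> j < r" if "(A, j) \<in> \<A>" for A j
  proof -
    obtain U where U: "(U, j) \<in> set (block_sets m Qs cls Is lab xs)" "set U \<inter> set T = {}" "A = set (positions Qs U)"
      using \<open>(A, j) \<in> \<A>\<close> unfolding \<A>_def by blast
    then show ?thesis using bs[OF U(1)] by (auto simp: set_positions)
  qed
  have posT: "set (positions Qs T) \<subseteq> {..<?p}" by (auto simp: set_positions)
  have fin\<S>: "finite \<S>" by (rule finite_subset[OF \<S>(1)]) simp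
  obtain F where F: "\<And>j. j < r \<Longrightarrow> (F j, j) \<in> \<A>" "{..<?p} - set (positions Qs T) \<subseteq> (\<Union>j<r. F j)"
  proof (rule cover_blocks[OF \<S>(1)[unfolded set_cover_family \<A>_def[symmetric]] \<A> posT \<S>(2) fin\<S> card\<S>])
    fix F assume "\<And>j. j < r \<Longrightarrow> (F j, j) \<in> \<A>" "{..<?p} - set (positions Qs T) \<subseteq> (\<Union>j<r. F j)"
    then show thesis by (rule that)
  qed
  have "\<exists>U Y. F j = set (positions Qs U) \<and> set U \<inter> set T = {} \<and> set U \<subseteq> Q \<and> card (set U) = fst (snd (f j)) \<and>
      Y \<subseteq> TLof (P j) \<and> packs Y \<and> base Qs (block cls Is lab (j, f j)) + snd (snd (f j)) \<le> card Y \<and> Q \<inter> cov Y \<subseteq> set U"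
    if j: "j < r" for j
  proof -
    obtain U where U: "(U, j) \<in> set (block_sets m Qs cls Is lab xs)" "set U \<inter> set T = {}" "F j = set (positions Qs U)"
      using F(1)[OF j] unfolding \<A>_def by blast
    then show ?thesis using bs[OF U(1)] by blast
  qed
  then obtain U Y where UY: "\<And>j. j < r \<Longrightarrow> F j = set (positions Qs (U j)) \<and> set (U j) \<inter> set T = {} \<and> set (U j) \<subseteq> Q \<and>
      card (set (U j)) = fst (snd (f j)) \<and> Y j \<subseteq> TLof (P j) \<and> packs (Y j) \<and>
      base Qs (block cls Is lab (j, f j)) + snd (snd (f j)) \<le> card (Y j) \<and> Q \<inter> cov (Y j) \<subseteq> set (U j)" by metis
  have cardF: "card (F j) = fst (snd (f j))" if "j < r" for j
    using UY[OF that] card_positions[OF distinct_Qs, of "U j"] by (simp add: Int_absorb1)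
  have "(\<Sum>j<r. card (F j)) + length T = ?p"
    using size cardF unfolding xs' sum_list_dn by simp
  moreover have "card ({..<?p} - set (positions Qs T)) = ?p - length T"
    using \<open>card (set (positions Qs T)) = length T\<close> by (subst card_Diff_subset) (auto simp: set_positions)
  moreover have "card ({..<?p} - set (positions Qs T)) \<le> card (\<Union>j<r. F j)"
    by (rule card_mono[OF _ F(2)]) (use UY in auto)
  \<comment> \<open>The cardinalities sum to exactly \<open>?p - length T\<close>, which is at most
    the size of the union, so no element can be covered twice.\<close>
  ultimately have dF: "disjoint_upto r F" by (intro disjoint_uptoI) (use UY in auto)
  have dU: "set (U i) \<inter> set (U j) = {}" if ij: "i < r" "j < r" "i \<noteq> j" for i j
  proof (rule ccontr)
    assume "set (U i) \<inter> set (U j) \<noteq> {}"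
    then obtain q where q: "q \<in> set (U i)" "q \<in> set (U j)" by blast
    then have "q \<in> Q" using UY[OF ij(1)] by blast
    then obtain a where "a < ?p" "Qs ! a = q" by (auto simp: in_set_conv_nth)
    then have "a \<in> F i \<inter> F j" using UY[OF ij(1)] UY[OF ij(2)] q by (simp add: set_positions)
    then show False using dF ij unfolding disjoint_upto_def by blast
  qed
  \<comment> \<open>The index \<open>r\<close> is given to the tail, so that blocks and tail can be
    treated alike.\<close>
  define Z where "Z = (\<lambda>j. if j < r then Y j else YT)"
  define V where "V = (\<lambda>j. if j < r then set (U j) else set T)"
  define PZ where "PZ = (\<lambda>j. if j < r then P j else PT)"
  have Z: "Z j \<subseteq> TLof (PZ j)" "packs (Z j)" "Q \<inter> cov (Z j) \<subseteq> V j" for j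
    using UY[of j] YT by (auto simp: Z_def PZ_def V_def)
  have V: "V i \<inter> V j = {}" if "i < Suc r" "j < Suc r" "i \<noteq> j" for i j
    using that dU[of i j] UY[of i] UY[of j] by (auto simp: V_def less_Suc_eq)
  have PZ: "\<not> (PZ i c \<and> PZ j c)" if "i < Suc r" "j < Suc r" "i \<noteq> j" for i j c
    using that inb_unique[of lab c i j] unfolding PZ_def P_def PT_def
    by (auto simp: less_Suc_eq simp del: split_paired_All dest: inb_unique)
  have dis: "set t \<inter> set t' = {}" if "i < Suc r" "j < Suc r" "i \<noteq> j" "t \<in> Z i" "t' \<in> Z j" for i j t t'
  proof -
    have "set t \<inter> set t' \<subseteq> Q"
      using TLof_separate[of t "PZ i" t' "PZ j"] Z(1)[of i] Z(1)[of j] PZ[OF that(1-3)] that by blast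
    moreover have "set t \<inter> Q \<subseteq> V i" "set t' \<inter> Q \<subseteq> V j" using Z(3) that by (auto simp: cov_def)
    ultimately show ?thesis using V[OF that(1-3)] by blast
  qed
  let ?Y = "\<Union>j<Suc r. Z j"
  have sub: "Z j \<subseteq> TL" for j using Z(1) TLof_sub by blast
  have "packs ?Y"
    unfolding packs_def pairwise_def disjnt_def
  proof (intro ballI impI)
    fix t t' assume "t \<in> ?Y" "t' \<in> ?Y" "t \<noteq> t'"
    then obtain i j where ij: "i < Suc r" "j < Suc r" "t \<in> Z i" "t' \<in> Z j" by blast
    show "set t \<inter> set t' = {}"
    proof (cases "i = j")
      case True
      then show ?thesis using Z(2)[of i] ij \<open>t \<noteq> t'\<close> by (auto simp: packs_def pairwise_def disjnt_def)
    next
      case False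
      then show ?thesis using dis ij by blast
    qed
  qed
  moreover have "?Y \<subseteq> TL" using sub by blast
  moreover have "tt \<le> card ?Y"
  proof -
    have "disjoint_upto (Suc r) Z"
      unfolding disjoint_upto_def
    proof (intro allI impI, rule ccontr)
      fix i j assume ij: "i < Suc r" "j < Suc r" "i \<noteq> j" and "Z i \<inter> Z j \<noteq> {}"
      then obtain t where t: "t \<in> Z i" "t \<in> Z j" by blast
      have "set t \<inter> set t = {}" by (rule dis[OF ij t])
      then show False using tri_ne[of t] t(1) sub[of i] by auto
    qed
    then have "card ?Y = (\<Sum>j<Suc r. card (Z j))"
      by (rule card_disjoint_upto) (use sub finite_TL finite_subset in blast)
    also have "\<dots> = (\<Sum>j<r. card (Y j)) + v" by (simp add: Z_def YT(4))
    also have "\<dots> \<ge> (\<Sum>j<r. base Qs (block cls Is lab (j, f j)) + snd (snd (f j))) + v"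
      by (intro add_mono sum_mono) (use UY in auto)
    finally show ?thesis using tt unfolding need_def xs' sum_list_dn by simp
  qed
  ultimately show ?thesis by blast
qed

lemma card_cov_le:
  assumes "Y \<subseteq> TL"
  shows "card (Q \<inter> cov Y) \<le> 3 * card {t \<in> Y. set t \<inter> Q \<noteq> {}}"
proof -
  let ?A = "{t \<in> Y. set t \<inter> Q \<noteq> {}}"
  have fin: "finite ?A" using assms finite_TL finite_subset by fastforce
  have "card (Q \<inter> cov Y) \<le> card (\<Union>t\<in>?A. set t)"
    by (rule card_mono) (use fin in \<open>auto simp: cov_def\<close>)
  also have "\<dots> \<le> (\<Sum>t\<in>?A. card (set t))" by (rule card_UN_le[OF fin])
  also have "\<dots> = (\<Sum>t\<in>?A. 3)"
    by (rule sum.cong) (use assms tri in \<open>auto simp: distinct_card\<close>)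
  finally show ?thesis by simp
qed

text \<open>The sum of squares counts ordered pairs of triangles in a common bucket. At most
  \<open>\<mu>\<close> disjoint triangles that meet the hub share a key, which gives at most
  \<open>length Qs * \<mu>\<close> pairs with equal keys; pairs with different keys collide at most
  \<open>length Qs ^ 2 / r\<close> times for a suitable labelling.\<close>

lemma balanced_labels:
  assumes Y: "Y \<subseteq> TL" "packs Y" and r: "0 < r"
  obtains lab L where "lab \<in> set (labels Is r)" "\<And>t. t \<in> Y \<Longrightarrow> L t < r \<and> t \<in> TLof (\<lambda>c. inb lab c (L t))"
    "r * (\<Sum>j<r. card {t \<in> Y. set t \<inter> Q \<noteq> {} \<and> L t = j} ^ 2) \<le> r * (length Qs * \<mu>) + length Qs ^ 2"
proof -
  let ?p = "length Qs"
  define A where "A = {t \<in> Y. set t \<inter> Q \<noteq> {}}"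
  have finY: "finite Y" using Y(1) finite_TL finite_subset by blast
  have finA: "finite A" using finY by (simp add: A_def)
  have packA: "packs A" using packs_mono[OF Y(2)] by (auto simp: A_def)
  have cardA: "card A \<le> ?p"
    using packs_card_le[OF packA finA, of Q] distinct_card[OF distinct_Qs] by (simp add: A_def)
  have "\<forall>t\<in>Y. \<exists>c. c \<in> set cls \<and> t \<in> set (snd c)" using Y(1) unfolding TL_eq TLof_def by blast
  then obtain cl where cl: "\<And>t. t \<in> Y \<Longrightarrow> cl t \<in> set cls \<and> t \<in> set (snd (cl t))" by metis
  have "\<forall>t\<in>Y. \<exists>i. i < length Is \<and> Is ! i = fst (cl t)"
    using cl by (metis image_eqI in_set_conv_nth set_dedup set_map)
  then obtain \<iota> where \<iota>: "\<And>t. t \<in> Y \<Longrightarrow> \<iota> t < length Is \<and> Is ! \<iota> t = fst (cl t)" by metis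
  obtain l where l: "good_labels r l (labels Is r)" "length Is \<le> 2 ^ l" using labels_good[OF r] by metis
  define Z where "Z = {z \<in> A \<times> A. \<iota> (fst z) \<noteq> \<iota> (snd z)}"
  have finZ: "finite Z" using finA by (simp add: Z_def)
  have ZA: "z \<in> Z \<Longrightarrow> fst z \<in> A \<and> snd z \<in> A \<and> \<iota> (fst z) \<noteq> \<iota> (snd z)" for z by (auto simp: Z_def)
  have AY: "t \<in> A \<Longrightarrow> t \<in> Y" for t by (simp add: A_def)
  obtain lab where lab: "lab \<in> set (labels Is r)" "r * card {z\<in>Z. lab ! \<iota> (fst z) = lab ! \<iota> (snd z)} \<le> card Z"
  proof (rule few_collisions[OF l(1) r finZ, of "\<lambda>z. \<iota> (fst z)" "\<lambda>z. \<iota> (snd z)"])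
    fix z assume "z \<in> Z"
    then show "\<iota> (fst z) < 2 ^ l \<and> \<iota> (snd z) < 2 ^ l \<and> \<iota> (fst z) \<noteq> \<iota> (snd z)"
      using ZA[of z] \<iota>[OF AY, of "fst z"] \<iota>[OF AY, of "snd z"] l(2) by auto
  qed blast
  have lab': "length lab = 2 ^ l" "\<forall>a\<in>set lab. a < r" using l(1) lab(1) unfolding good_labels_def by auto
  define L where "L = (\<lambda>t. lab ! \<iota> t)"
  have L: "L t < r \<and> t \<in> TLof (\<lambda>c. inb lab c (L t))" if "t \<in> Y" for t
  proof -
    have len: "\<iota> t < length lab" using \<iota>[OF that] l(2) lab'(1) by simp
    have "(Is ! \<iota> t, lab ! \<iota> t) \<in> set (zip Is lab)"
      using len \<iota>[OF that] by (auto simp: in_set_zip intro!: exI[of _ "\<iota> t"])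
    then have "inb lab (cl t) (L t)" using \<iota>[OF that] by (simp add: inb_def L_def)
    then show ?thesis using cl[OF that] lab'(2) len nth_mem unfolding L_def TLof_def by blast
  qed
  define a where "a = (\<lambda>j. {t \<in> A. L t = j})"
  let ?W = "{z \<in> A \<times> A. L (fst z) = L (snd z)}"
  have "(\<Sum>j<r. card (a j) ^ 2) = (\<Sum>j<r. card (a j \<times> a j))" by (simp add: card_cartesian_product power2_eq_square)
  also have "\<dots> = card (\<Union>j<r. a j \<times> a j)"
    by (rule card_disjoint_upto[symmetric]) (use finA in \<open>auto simp: disjoint_upto_def a_def\<close>)
  also have "\<dots> \<le> card ?W" by (rule card_mono) (use finA in \<open>auto simp: a_def\<close>)
  also have "?W \<subseteq> (SIGMA t:A. {t' \<in> A. \<iota> t' = \<iota> t}) \<union> {z\<in>Z. lab ! \<iota> (fst z) = lab ! \<iota> (snd z)}"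
    by (auto simp: Z_def L_def)
  then have "card ?W \<le> card ((SIGMA t:A. {t' \<in> A. \<iota> t' = \<iota> t}) \<union> {z\<in>Z. lab ! \<iota> (fst z) = lab ! \<iota> (snd z)})"
    using finA finZ by (intro card_mono) auto
  also have "\<dots> \<le> card (SIGMA t:A. {t' \<in> A. \<iota> t' = \<iota> t}) + card {z\<in>Z. lab ! \<iota> (fst z) = lab ! \<iota> (snd z)}"
    by (rule card_Un_le)
  also have "card (SIGMA t:A. {t' \<in> A. \<iota> t' = \<iota> t}) \<le> ?p * \<mu>"
  proof -
    have "card {t' \<in> A. \<iota> t' = \<iota> t} \<le> \<mu>" if "t \<in> A" for t
    proof -
      have "card {t' \<in> A. \<iota> t' = \<iota> t} \<le> card (set (fst (cl t)))"
      proof (rule packs_card_le)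
        show "packs {t' \<in> A. \<iota> t' = \<iota> t}" by (rule packs_mono[OF packA]) auto
        fix t' assume t': "t' \<in> {t' \<in> A. \<iota> t' = \<iota> t}"
        then have "fst (cl t') = fst (cl t)" using \<iota>[OF AY, of t'] \<iota>[OF AY, of t] that by auto
        then have "set t' \<inter> Q \<subseteq> set (fst (cl t))" using cl_Q[of "cl t'" t'] cl[of t'] t' AY by auto
        then show "set t' \<inter> set (fst (cl t)) \<noteq> {}" using t' by (auto simp: A_def)
      qed (use finA in auto)
      also have "\<dots> \<le> \<mu>" using cl_key[of "cl t"] cl[OF AY[OF that]] card_length[of "fst (cl t)"] by linarith
      finally show ?thesis .
    qed
    then have "card (SIGMA t:A. {t' \<in> A. \<iota> t' = \<iota> t}) \<le> (\<Sum>t\<in>A. \<mu>)"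
      using finA by (subst card_SigmaI) (auto simp del: sum_constant intro!: sum_mono)
    also have "\<dots> \<le> ?p * \<mu>" using cardA by simp
    finally show ?thesis .
  qed
  finally have "(\<Sum>j<r. card (a j) ^ 2) \<le> ?p * \<mu> + card {z\<in>Z. lab ! \<iota> (fst z) = lab ! \<iota> (snd z)}" by simp
  from mult_le_mono2[OF this, of r]
  have "r * (\<Sum>j<r. card (a j) ^ 2) \<le> r * (?p * \<mu>) + r * card {z\<in>Z. lab ! \<iota> (fst z) = lab ! \<iota> (snd z)}"
    unfolding add_mult_distrib2 .
  also have "\<dots> \<le> r * (?p * \<mu>) + ?p ^ 2"
  proof -
    have "card Z \<le> card (A \<times> A)" by (rule card_mono) (use finA in \<open>auto simp: Z_def\<close>)
    also have "\<dots> \<le> ?p ^ 2" using cardA by (simp add: card_cartesian_product power2_eq_square mult_le_mono)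
    finally show ?thesis using lab(2) by linarith
  qed
  finally show ?thesis
    using that[OF lab(1) L] unfolding a_def A_def by (simp add: conj_assoc)
qed

text \<open>A bucket is overfull if more than \<open>D\<close> of its triangles meet the hub. The
  sum of squares of these loads is at most \<open>length Qs * (\<mu> + g)\<close>, so overfull
  buckets hold at most \<open>length Qs / (3 * h)\<close> such triangles, which occupy at most
  \<open>k\<close> hub vertices. In every other bucket at most \<open>3 * D = m\<close> hub vertices
  are occupied.\<close>

lemma core_complete:
  assumes Y: "Y \<subseteq> TL" "packs Y" "tt \<le> card Y" and "0 < g" "0 < h" and r: "0 < r" "length Qs \<le> r * g"
    and D: "D = 3 * h * (\<mu> + g)" and m: "m = 3 * D" and k: "k = length Qs div h"
  shows "\<exists>lab\<in>set (labels Is r). \<exists>gv\<in>set (vectors (choices m) r). \<exists>s\<in>set (dp Qs k (tail cls Is lab (zip (dn r) gv))).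
    tt \<le> need Qs cls Is lab (zip (dn r) gv) + snd s \<and>
    sum_list (map (\<lambda>x. fst (snd (snd x))) (zip (dn r) gv)) + length (fst s) = length Qs \<and>
    has_set_cover {..<length Qs + r + r} (set ` set (cover_family Qs r (block_sets m Qs cls Is lab (zip (dn r) gv)) (fst s)))
      (int (r + length (fst s)))"
proof -
  let ?p = "length Qs"
  obtain lab L where lab: "lab \<in> set (labels Is r)" "\<And>t. t \<in> Y \<Longrightarrow> L t < r \<and> t \<in> TLof (\<lambda>c. inb lab c (L t))"
    "r * (\<Sum>j<r. card {t \<in> Y. set t \<inter> Q \<noteq> {} \<and> L t = j} ^ 2) \<le> r * (?p * \<mu>) + ?p ^ 2"
  proof (rule balanced_labels[OF Y(1,2) r(1)])
    fix lab L assume "lab \<in> set (labels Is r)" "\<And>t. t \<in> Y \<Longrightarrow> L t < r \<and> t \<in> TLof (\<lambda>c. inb lab c (L t))"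
      "r * (\<Sum>j<r. card {t \<in> Y. set t \<inter> Q \<noteq> {} \<and> L t = j} ^ 2) \<le> r * (?p * \<mu>) + ?p ^ 2"
    then show thesis by (rule that)
  qed
  have finY: "finite Y" using Y(1) finite_TL finite_subset by blast
  define a where "a = (\<lambda>j. {t \<in> Y. set t \<inter> Q \<noteq> {} \<and> L t = j})"
  have fina: "finite (a j)" for j using finY by (simp add: a_def)
  define bad where "bad = (\<lambda>j. D < card (a j))"
  have sq: "(\<Sum>j<r. card (a j) ^ 2) \<le> ?p * (\<mu> + g)"
  proof -
    have "r * (\<Sum>j<r. card (a j) ^ 2) \<le> r * (?p * \<mu>) + ?p * (r * g)"
      using lab(3) r(2) mult_le_mono2[of ?p "r * g" ?p] unfolding a_def power2_eq_square by linarith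
    also have "\<dots> = r * (?p * (\<mu> + g))" by (simp add: algebra_simps)
    finally show ?thesis using r(1) by simp
  qed
  define B where "B = {j. j < r \<and> bad j}"
  have finB: "finite B" by (simp add: B_def)
  have tail_le: "3 * (\<Sum>j\<in>B. card (a j)) \<le> k"
  proof -
    \<comment> \<open>A load above \<open>D\<close> contributes more than \<open>D\<close> times
      itself to the sum of squares.\<close>
    have "D * (\<Sum>j\<in>B. card (a j)) \<le> (\<Sum>j\<in>B. card (a j) ^ 2)"
      unfolding sum_distrib_left power2_eq_square
      by (intro sum_mono mult_le_mono1) (auto simp: B_def bad_def)
    also have "\<dots> \<le> (\<Sum>j<r. card (a j) ^ 2)" by (rule sum_mono2) (auto simp: B_def)
    finally have "(3 * h * (\<Sum>j\<in>B. card (a j))) * (\<mu> + g) \<le> ?p * (\<mu> + g)"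
      using sq unfolding D by (simp add: algebra_simps)
    then have "3 * h * (\<Sum>j\<in>B. card (a j)) \<le> ?p" using \<open>0 < g\<close> by simp
    then have "3 * (\<Sum>j\<in>B. card (a j)) * h \<le> ?p" by (simp add: algebra_simps)
    then show ?thesis unfolding k using \<open>0 < h\<close> by (simp add: less_eq_div_iff_mult_less_eq)
  qed
  define YT where "YT = {t \<in> Y. bad (L t)}"
  define Yj where "Yj = (\<lambda>j. {t \<in> Y. \<not> bad j \<and> L t = j})"
  define P where "P = (\<lambda>j c. \<not> bad j \<and> inb lab c j)"
  define PT where "PT = (\<lambda>c. \<exists>j<r. bad j \<and> inb lab c j)"
  have YT: "YT \<subseteq> TLof PT" "packs YT" "YT \<subseteq> TL"
    using lab(2) Y(1) packs_mono[OF Y(2), of YT] by (auto simp: YT_def PT_def TLof_def) blast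
  have Yj: "Yj j \<subseteq> TLof (P j)" "packs (Yj j)" "Yj j \<subseteq> TL" for j
    using lab(2) Y(1) packs_mono[OF Y(2), of "Yj j"] by (auto simp: Yj_def P_def TLof_def)
  have cardT: "card (Q \<inter> cov YT) \<le> k"
  proof -
    have "card (Q \<inter> cov YT) \<le> 3 * card {t \<in> YT. set t \<inter> Q \<noteq> {}}" by (rule card_cov_le[OF YT(3)])
    also have "card {t \<in> YT. set t \<inter> Q \<noteq> {}} \<le> card (\<Union>j\<in>B. a j)"
      by (rule card_mono) (use finB fina lab(2) in \<open>auto simp: YT_def a_def B_def\<close>)
    also have "\<dots> \<le> (\<Sum>j\<in>B. card (a j))" by (rule card_UN_le[OF finB])
    finally show ?thesis using tail_le by simp
  qed
  have used: "card (Q \<inter> cov (Yj j)) \<le> m" for j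
  proof (cases "bad j")
    case True
    then show ?thesis by (simp add: Yj_def cov_def)
  next
    case False
    have "card (Q \<inter> cov (Yj j)) \<le> 3 * card {t \<in> Yj j. set t \<inter> Q \<noteq> {}}" by (rule card_cov_le[OF Yj(3)])
    also have "card {t \<in> Yj j. set t \<inter> Q \<noteq> {}} \<le> card (a j)"
      by (rule card_mono[OF fina]) (auto simp: Yj_def a_def)
    also have "\<dots> \<le> D" using False by (simp add: bad_def)
    finally show ?thesis unfolding m by simp
  qed
  have dis: "set t \<inter> set t' = {}" if "t \<in> Y" "t' \<in> Y" "t \<noteq> t'" for t t'
    using Y(2) that unfolding packs_def pairwise_def disjnt_def by blast
  let ?X = "Q - cov YT"
  have "disjoint_upto r (\<lambda>j. Q \<inter> cov (Yj j))"
    unfolding disjoint_upto_def cov_def using dis by (fastforce simp: Yj_def)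
  moreover have "Q \<inter> cov (Yj j) \<subseteq> ?X" for j
    unfolding cov_def using dis by (fastforce simp: Yj_def YT_def)
  \<comment> \<open>Capacity for distributing all of \<open>?X\<close>: already \<open>g\<close>
    places in each of the \<open>r\<close> buckets would do, and \<open>m\<close> is at least
    \<open>g\<close>.\<close>
  moreover have "card ?X \<le> r * m"
  proof -
    have "card ?X \<le> ?p" using card_mono[of Q ?X] distinct_card[OF distinct_Qs] by simp
    also have "\<dots> \<le> r * g" by (rule r(2))
    also have "\<dots> \<le> r * m" 
    proof (rule mult_le_mono2)
      have "1 * (\<mu> + g) \<le> 9 * h * (\<mu> + g)" using \<open>0 < h\<close> by (intro mult_le_mono1) simp
      then show "g \<le> m" unfolding m D by (simp add: algebra_simps)
    qed
    finally show ?thesis .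
  qed
  ultimately obtain S where S: "\<And>j. j < r \<Longrightarrow> Q \<inter> cov (Yj j) \<subseteq> S j \<and> S j \<subseteq> ?X \<and> card (S j) \<le> m"
    "disjoint_upto r S" "(\<Union>j<r. S j) = ?X"
    using extend_to_partition[of ?X r "\<lambda>j. Q \<inter> cov (Yj j)" m] used by (metis finite_Diff List.finite_set)
  have finS: "finite (S j)" if "j < r" for j using S(1)[OF that] finite_subset by (metis finite_Diff List.finite_set)
  define b where "b = (\<lambda>j. base Qs (moves (filter (P j) cls)))"
  define f where "f = (\<lambda>j. (bad j, card (S j), card (Yj j) - b j))"
  \<comment> \<open>The triangles of the bucket that avoid the hub number at most
    \<open>b j\<close>, so the excess is at most the number of those that meet it.\<close>
  have w: "card (Yj j) - b j \<le> m" for j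
  proof -
    let ?N = "{t \<in> Yj j. set t \<inter> Q = {}}"
    have "card ?N \<le> b j"
      unfolding b_def by (rule base_ge) (use Yj(1)[of j] packs_mono[OF Yj(2)[of j], of ?N] in \<open>auto simp: cov_def\<close>)
    moreover have "card (Yj j) \<le> card ?N + (if bad j then 0 else card (a j))"
    proof (cases "bad j")
      case True
      then show ?thesis by (simp add: Yj_def)
    next
      case False
      have "card (Yj j) \<le> card (?N \<union> a j)"
        by (rule card_mono) (use finY fina in \<open>auto simp: Yj_def a_def\<close>)
      then show ?thesis using False card_Un_le[of ?N "a j"] by simp
    qed
    moreover have "(if bad j then 0 else card (a j)) \<le> m" unfolding m by (simp add: bad_def)
    ultimately show ?thesis by linarith
  qed
  define gv where "gv = map f (dn r)"
  have zip: "zip (dn r) gv = map (\<lambda>j. (j, f j)) (dn r)" by (simp add: gv_def zip_map2 zip_same_conv_map)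
  have gv: "gv \<in> set (vectors (choices m) r)"
    unfolding set_vectors gv_def using S(1) w by (auto simp: f_def set_choices)
  define T where "T = restrict_to Qs (cov YT)"
  have block: "block cls Is lab (j, f j) = moves (filter (P j) cls)" for j
    unfolding block_moves' P_def f_def by simp
  have tl: "tail cls Is lab (zip (dn r) gv) = moves (filter PT cls)"
    unfolding zip tail_moves PT_def f_def by simp
  have T: "(T, card YT) \<in> set (dp Qs k (tail cls Is lab (zip (dn r) gv)))"
    unfolding tl dp_moves T_def using YT cardT by blast
  have lenT: "length T = card (Q \<inter> cov YT)" unfolding T_def by (rule length_restrict_to[OF distinct_Qs])
  have sumS: "(\<Sum>j<r. card (S j)) + length T = ?p"
  proof -
    have "(\<Sum>j<r. card (S j)) = card ?X" using card_disjoint_upto[OF S(2) finS] S(3) by simp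
    moreover have "card ?X + card (Q \<inter> cov YT) = card Q"
      by (metis List.finite_set card_Int_Diff add.commute)
    ultimately show ?thesis using lenT distinct_card[OF distinct_Qs] by simp
  qed
  have 1: "tt \<le> need Qs cls Is lab (zip (dn r) gv) + card YT"
  proof -
    have "Y \<subseteq> (\<Union>j<r. Yj j) \<union> YT" using lab(2) by (auto simp: Yj_def YT_def)
    then have "card Y \<le> card ((\<Union>j<r. Yj j) \<union> YT)"
      by (rule card_mono[rotated]) (use finY in \<open>auto simp: Yj_def YT_def\<close>)
    also have "\<dots> \<le> card (\<Union>j<r. Yj j) + card YT" by (rule card_Un_le)
    also have "card (\<Union>j<r. Yj j) \<le> (\<Sum>j<r. card (Yj j))" by (rule card_UN_le) simp
    also have "\<dots> \<le> (\<Sum>j<r. b j + (card (Yj j) - b j))" by (rule sum_mono) simp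
    also have "\<dots> = need Qs cls Is lab (zip (dn r) gv)"
      unfolding need_def zip sum_list_dn block by (simp add: f_def b_def)
    finally show ?thesis using Y(3) by simp
  qed
  have 2: "sum_list (map (\<lambda>x. fst (snd (snd x))) (zip (dn r) gv)) + length T = ?p"
    using sumS unfolding zip sum_list_dn by (simp add: f_def)
  have SQ: "S j \<subseteq> Q" if "j < r" for j using S(1)[OF that] by blast
  have bs: "(restrict_to Qs (S j), j) \<in> set (block_sets m Qs cls Is lab (zip (dn r) gv))" if j: "j < r" for j
  proof -
    have "\<exists>Y'\<subseteq>TLof (P j). packs Y' \<and> Q \<inter> cov Y' \<subseteq> S j \<and> b j + (card (Yj j) - b j) \<le> card Y'"
    proof (cases "b j \<le> card (Yj j)")
      case True
      then show ?thesis using Yj S(1)[OF j] by (intro exI[of _ "Yj j"]) auto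
    next
      \<comment> \<open>The truncated difference is 0 here, and a packing that avoids the hub
        already realises the promised gain.\<close>
      case False
      obtain Y' where "Y' \<subseteq> TLof (P j)" "packs Y'" "Q \<inter> cov Y' = {}" "card Y' = b j"
        using base_attained[of "P j"] unfolding b_def by blast
      then show ?thesis using False by (intro exI[of _ Y']) auto
    qed
    then obtain Y' where Y': "Y' \<subseteq> TLof (P j)" "packs Y'" "Q \<inter> cov Y' \<subseteq> S j" "b j + (card (Yj j) - b j) \<le> card Y'" by blast
    have "(restrict_to Qs (S j), card Y') \<in> set (dp Qs m (moves (filter (P j) cls) @ waste Qs))"
      by (rule dp_waste_complete[OF Y'(1-3) SQ[OF j]]) (use S(1)[OF j] in blast)
    moreover have "length (restrict_to Qs (S j)) = card (S j)"
      using length_restrict_to[OF distinct_Qs] SQ[OF j] by (simp add: Int_absorb1)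
    moreover have "fst (snd (f j)) = card (S j)" "snd (snd (f j)) = card (Yj j) - b j" by (simp_all add: f_def)
    ultimately show ?thesis
      unfolding set_block_sets zip using j Y'(4)
      by (intro CollectI exI[of _ "restrict_to Qs (S j)"] exI[of _ "card Y'"] exI[of _ "(j, f j)"])
        (simp add: block b_def)
  qed
  define tok where "tok = (\<lambda>j. set (positions Qs (restrict_to Qs (S j))) \<union> {?p + j, ?p + r + j})"
  let ?S = "(\<lambda>x. {x}) ` set (positions Qs T) \<union> tok ` {..<r}"
  have pos: "set (positions Qs (restrict_to Qs A)) = {i. i < ?p \<and> Qs ! i \<in> A}" for A
    by (auto simp: set_positions)
  define \<A> where "\<A> = {(set (positions Qs U), j) |U j.
    (U, j) \<in> set (block_sets m Qs cls Is lab (zip (dn r) gv)) \<and> set U \<inter> set T = {}}"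
  have "?S \<subseteq> set ` set (cover_family Qs r (block_sets m Qs cls Is lab (zip (dn r) gv)) T)"
  proof -
    have "(set (positions Qs (restrict_to Qs (S j))), j) \<in> \<A>" if "j < r" for j
    proof -
      have "set (restrict_to Qs (S j)) \<inter> set T = {}" using S(1)[OF that] by (auto simp: T_def)
      then show ?thesis unfolding \<A>_def using bs[OF that] by blast
    qed
    then have "\<exists>A i. tok j = A \<union> {?p + i, ?p + r + i} \<and> (A, i) \<in> \<A>" if "j < r" for j
      using that unfolding tok_def by (intro exI[of _ j] exI[of _ "set (positions Qs (restrict_to Qs (S j)))"]) simp
    then have "tok ` {..<r} \<subseteq> {A \<union> {?p + j, ?p + r + j} |A j. (A, j) \<in> \<A>}"
      by (intro image_subsetI CollectI) simp
    moreover have "(\<lambda>x. {x}) ` set (positions Qs T) \<subseteq> {{x} |x. x < ?p + r + r}" by (auto simp: set_positions)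
    ultimately show ?thesis unfolding set_cover_family \<A>_def[symmetric] by (intro Un_mono)
  qed
  moreover have "\<Union>?S = {..<?p + r + r}"
  proof (intro equalityI subsetI)
    fix x assume "x \<in> \<Union>?S"
    then show "x \<in> {..<?p + r + r}" by (auto simp: tok_def set_positions)
  next
    fix x assume "x \<in> {..<?p + r + r}"
    then consider "x < ?p" | j where "j < r" "x = ?p + j" | j where "j < r" "x = ?p + r + j"
      by (metis add.assoc add_less_cancel_left le_Suc_ex lessThan_iff not_le)
    then show "x \<in> \<Union>?S"
    proof cases
      case 1
      then have q: "Qs ! x \<in> Q" by simp
      show ?thesis
      proof (cases "Qs ! x \<in> cov YT")
        case True
        then show ?thesis using 1 by (auto simp: T_def pos)
      next
        case False
        then obtain j where "j < r" "Qs ! x \<in> S j" using q S(3) by blast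
        then show ?thesis using 1 by (auto simp: tok_def pos)
      qed
    qed (auto simp: tok_def)
  qed
  moreover have "card ?S \<le> r + length T"
  proof -
    have "card ?S \<le> card ((\<lambda>x. {x}) ` set (positions Qs T)) + card (tok ` {..<r})" by (rule card_Un_le)
    also have "card ((\<lambda>x. {x}) ` set (positions Qs T)) \<le> card (set (positions Qs T))" by (rule card_image_le) simp
    also have "card (set (positions Qs T)) = length T"
      using card_positions[OF distinct_Qs, of T] lenT by (simp add: T_def Int_absorb1)
    also have "card (tok ` {..<r}) \<le> r" using card_image_le[of "{..<r}" tok] by simp
    finally show ?thesis by simp
  qed
  ultimately have 3: "has_set_cover {..<?p + r + r} (set ` set (cover_family Qs r (block_sets m Qs cls Is lab (zip (dn r) gv)) T))
      (int (r + length T))"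
    unfolding has_set_cover_def by (intro exI[of _ ?S]) auto
  show ?thesis
    by (rule bexI[OF _ lab(1)], rule bexI[OF _ gv], rule bexI[OF _ T]) (use 1 2 3 in simp)
qed

end

section \<open>Sizes of the intermediate lists\<close>

definition binsum :: "nat \<Rightarrow> nat \<Rightarrow> nat" where
  "binsum p k = (\<Sum>i\<le>k. p choose i)"

lemma card_small_subsets: "finite A \<Longrightarrow> card {B. B \<subseteq> A \<and> card B \<le> k} = binsum (card A) k"
proof -
  assume A: "finite A"
  have "{B. B \<subseteq> A \<and> card B \<le> k} = (\<Union>i\<in>{..k}. {B. B \<subseteq> A \<and> card B = i})" by auto
  also have "card \<dots> = (\<Sum>i\<in>{..k}. card {B. B \<subseteq> A \<and> card B = i})"
    by (rule card_UN_disjoint) (use A in auto)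
  finally show ?thesis using A by (simp add: binsum_def n_subsets)
qed

text \<open>Used where \<open>k\<close> is a constant, as for blocks and keys; for the tail, whose
  limit grows with \<open>p\<close>, an exponential bound is derived later.\<close>

lemma binsum_le: "binsum p k \<le> (p + 1) ^ k"
proof (induction k)
  case (Suc k)
  have "p choose Suc k \<le> p ^ Suc k"
    by (cases "Suc k \<le> p") (auto simp del: binomial_Suc_Suc power_Suc intro: binomial_le_pow simp: binomial_eq_0)
  also have "\<dots> \<le> p * (p + 1) ^ k" by (simp add: power_mono)
  finally show ?case using Suc by (simp add: binsum_def algebra_simps)
qed (simp add: binsum_def)

lemma binsum_pos: "0 < binsum p k"
proof -
  have "p choose 0 \<le> binsum p k" unfolding binsum_def by (rule member_le_sum) auto
  then show ?thesis by simp
qed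

text \<open>A state holds at most \<open>n\<close> hub vertices from earlier classes and the
  vertices of at most \<open>M\<close> triangles of the current one; the last summand is for the
  gain.\<close>

definition state_bound :: "nat \<Rightarrow> nat \<Rightarrow> nat" where
  "state_bound M n = 2 + (3 * M + n) * (2 * n + 2) + (2 * (n + M) + 2)"

text \<open>Between two normalisations each of at most \<open>M\<close> moves can double the list of
  states; hence the factor \<open>2 ^ M\<close>.\<close>

definition dp_bound :: "nat \<Rightarrow> nat \<Rightarrow> nat \<Rightarrow> nat" where
  "dp_bound M b n = 2 + 2 ^ M * (b * (n + 1)) * state_bound M n"

text \<open>Locates an interruption of the flattened loop: it lies at the boundary of a class or
  after \<open>j\<close> moves of the class with index \<open>q\<close>.\<close>

lemma take_steps:
  "\<exists>q j. q \<le> length mss \<and> (fold F (take i (concat (map (\<lambda>ms. steps ms) mss))) S =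
      fold F (concat (map (\<lambda>ms. steps ms) (take q mss))) S \<or>
    q < length mss \<and> fold F (take i (concat (map (\<lambda>ms. steps ms) mss))) S =
      fold F (map (\<lambda>m. (False, m)) (take j (mss ! q))) (fold F (concat (map (\<lambda>ms. steps ms) (take q mss))) S))"
proof (induction mss rule: rev_induct)
  case (snoc ms mss)
  let ?l = "length (concat (map (\<lambda>ms. steps ms) mss))"
  show ?case
  proof (cases "i \<le> ?l")
    case True
    then have eq: "take i (concat (map (\<lambda>ms. steps ms) (mss @ [ms]))) = take i (concat (map (\<lambda>ms. steps ms) mss))" by simp
    obtain q j where "q \<le> length mss" "fold F (take i (concat (map (\<lambda>ms. steps ms) mss))) S =
      fold F (concat (map (\<lambda>ms. steps ms) (take q mss))) S \<or>
    q < length mss \<and> fold F (take i (concat (map (\<lambda>ms. steps ms) mss))) S =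
      fold F (map (\<lambda>m. (False, m)) (take j (mss ! q))) (fold F (concat (map (\<lambda>ms. steps ms) (take q mss))) S)"
      using snoc.IH by blast
    then show ?thesis unfolding eq by (intro exI[of _ q] exI[of _ j]) (auto simp: nth_append)
  next
    case False
    then have eq: "take i (concat (map (\<lambda>ms. steps ms) (mss @ [ms]))) = concat (map (\<lambda>ms. steps ms) mss) @ take (i - ?l) (steps ms)" by simp
    show ?thesis
    proof (cases "i - ?l \<le> length ms")
      case True
      then have "take (i - ?l) (steps ms) = map (\<lambda>m. (False, m)) (take (i - ?l) ms)"
        by (simp add: steps_def take_map)
      then show ?thesis unfolding eq by (intro exI[of _ "length mss"] exI[of _ "i - ?l"]) (simp add: nth_append)
    next
      case False
      then have "take (i - ?l) (steps ms) = steps ms" by (simp add: steps_def)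
      then show ?thesis unfolding eq by (intro exI[of _ "length (mss @ [ms])"]) simp
    qed
  qed
qed simp

lemma extend_all_length: "length (extend_all Qs k ms S) \<le> 2 ^ length ms * length S"
proof (induction ms rule: rev_induct)
  case (snoc m ms)
  have c: "length (concat (map (\<lambda>s. if \<exists>u\<in>set (fst m). u \<in> set (fst s) then [] else [(fst m @ fst s, snd m + snd s)]) X)) \<le> length X"
    for X :: "state list" by (induction X) auto
  have "length (dp_step (False, m) X Qs k) \<le> 2 * length X" for X
    using c[of X] unfolding dp_step_def fst_conv snd_conv by simp
  from le_trans[OF this mult_le_mono2[OF snoc.IH]] show ?case by simp
qed simp

lemma extend_all_states:
  assumes "s \<in> set (extend_all Qs k ms S)" "\<And>s. s \<in> set S \<Longrightarrow> length (fst s) \<le> a \<and> set (fst s) \<subseteq> {..<n} \<and> snd s \<le> b"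
    "\<And>m. m \<in> set ms \<Longrightarrow> length (fst m) \<le> 3 \<and> set (fst m) \<subseteq> {..<n} \<and> snd m \<le> 1"
  shows "length (fst s) \<le> a + 3 * length ms \<and> set (fst s) \<subseteq> {..<n} \<and> snd s \<le> b + length ms"
  using assms(1,3)
proof (induction ms arbitrary: s rule: rev_induct)
  case Nil
  then show ?case using assms(2) by simp
next
  case (snoc m ms)
  then consider "s \<in> set (extend_all Qs k ms S)"
    | s' where "s' \<in> set (extend_all Qs k ms S)" "s = (fst m @ fst s', snd m + snd s')"
    by (auto simp: dp_step_def split: if_splits)
  then show ?case
  proof cases
    case 1
    then show ?thesis using snoc.IH[of s] snoc.prems(2) by fastforce
  next
    case 2
    then show ?thesis using snoc.IH[of s'] snoc.prems(2)[of m] snoc.prems(2) by fastforce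
  qed
qed

lemma sz_state:
  assumes "length (fst s) \<le> n + 3 * M" "set (fst s) \<subseteq> {..<n}" "snd s \<le> n + M"
  shows "sz s \<le> state_bound M n"
proof -
  have "sz (fst s) \<le> 2 + length (fst s) * (2 * n + 2)"
    by (rule sz_list_le) (use assms(2) in auto)
  also have "\<dots> \<le> 2 + (3 * M + n) * (2 * n + 2)" using assms(1) by (intro add_mono mult_le_mono) auto
  finally show ?thesis using assms(3) by (simp add: sz_prod state_bound_def)
qed

lemma gain_le:
  assumes "compatible P" "finite P" "\<And>m. m \<in> P \<Longrightarrow> fst m \<noteq> [] \<and> set (fst m) \<subseteq> {..<n} \<and> snd m \<le> 1"
  shows "gain P \<le> n"
proof -
  have "gain P \<le> (\<Sum>m\<in>P. card (set (fst m)))"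
    unfolding gain_def
  proof (rule sum_mono)
    fix m assume "m \<in> P"
    then have "0 < card (set (fst m))" "snd m \<le> 1" using assms(3)[of m] by (auto simp: card_gt_0_iff)
    then show "snd m \<le> card (set (fst m))" by linarith
  qed
  also have "\<dots> = card (\<Union>m\<in>P. set (fst m))"
    by (rule card_UN_disjoint[symmetric]) (use assms(1,2) in \<open>auto simp: compatible_def pairwise_def disjnt_def\<close>)
  also have "\<dots> \<le> card {..<n}" by (rule card_mono) (use assms(3) in auto)
  finally show ?thesis by simp
qed

text \<open>At the boundary of a class a state is determined by a hub subset of size at most
  \<open>k\<close> and a gain between 0 and \<open>n\<close>. Inside a class the list grows by a
  constant factor only.\<close>

lemma dp_bounded_moves:
  assumes Qs: "distinct Qs" "set Qs \<subseteq> {..<n}" and sep: "separated (set Qs) mss"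
    and ms: "\<And>ms. ms \<in> set mss \<Longrightarrow> length ms \<le> M"
    and m: "\<And>ms m. ms \<in> set mss \<Longrightarrow> m \<in> set ms \<Longrightarrow> length (fst m) \<le> 3 \<and> set (fst m) \<subseteq> {..<n} \<and> snd m \<le> 1"
  shows "dp_bounded Qs k mss (dp_bound M (binsum (length Qs) k) n)"
    and "length (dp Qs k mss) \<le> binsum (length Qs) k * (n + 1)"
    and "s \<in> set (dp Qs k mss) \<Longrightarrow> sz s \<le> state_bound M n"
proof -
  let ?b = "binsum (length Qs) k"
  have pre: "length (dp Qs k (take q mss)) \<le> ?b * (n + 1) \<and>
      (\<forall>s\<in>set (dp Qs k (take q mss)). length (fst s) \<le> n \<and> set (fst s) \<subseteq> {..<n} \<and> snd s \<le> n)" for q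
  proof -
    have sepq: "separated (set Qs) (take q mss)"
      using sep in_set_takeD[of _ q mss] unfolding separated_iff by (auto intro: sorted_wrt_take)
    have st: "\<exists>B. B \<subseteq> set Qs \<and> card B \<le> k \<and> fst s = restrict_to Qs B \<and> snd s \<le> n" if s: "s \<in> set (dp Qs k (take q mss))" for s
    proof -
      obtain P where P: "P \<subseteq> set (concat (take q mss))" "compatible P" "card (set Qs \<inter> covered P) \<le> k"
        "s = (restrict_to Qs (covered P), gain P)" using s unfolding dp_iff[OF Qs(1) sepq] by blast
      have "gain P \<le> n"
      proof (rule gain_le[OF P(2)])
        show "finite P" using P(1) finite_subset by blast
        fix x assume "x \<in> P"
        then obtain ms where "ms \<in> set mss" "x \<in> set ms" using P(1) in_set_takeD by fastforce
        then show "fst x \<noteq> [] \<and> set (fst x) \<subseteq> {..<n} \<and> snd x \<le> 1" using m sep unfolding separated_def by blast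
      qed
      moreover have "restrict_to Qs (covered P) = restrict_to Qs (set Qs \<inter> covered P)" by (auto simp: restrict_to_eq_iff)
      ultimately show ?thesis using P(3,4) by auto
    qed
    have "length (dp Qs k (take q mss)) \<le> ?b * (n + 1)"
    proof (cases "take q mss = []")
      case True
      have "1 * 1 \<le> ?b * (n + 1)" using binsum_pos[of "length Qs" k] by (intro mult_le_mono) auto
      moreover have "length (dp Qs k (take q mss)) = 1" unfolding True by (simp add: dp_def)
      ultimately show ?thesis by simp
    next
      case False
      have "length (dp Qs k (take q mss)) = card (set (dp Qs k (take q mss)))"
        by (rule distinct_card[symmetric]) (rule dp_distinct[OF False])
      also have "\<dots> \<le> card ((restrict_to Qs ` {B. B \<subseteq> set Qs \<and> card B \<le> k}) \<times> {..n})"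
      proof (rule card_mono)
        show "set (dp Qs k (take q mss)) \<subseteq> (restrict_to Qs ` {B. B \<subseteq> set Qs \<and> card B \<le> k}) \<times> {..n}"
        proof
          fix s assume "s \<in> set (dp Qs k (take q mss))"
          from st[OF this] show "s \<in> (restrict_to Qs ` {B. B \<subseteq> set Qs \<and> card B \<le> k}) \<times> {..n}"
            by (auto simp: mem_Times_iff)
        qed
      qed simp
      also have "\<dots> \<le> card {B. B \<subseteq> set Qs \<and> card B \<le> k} * (n + 1)"
        unfolding card_cartesian_product by (intro mult_le_mono card_image_le) auto
      finally show ?thesis using card_small_subsets[of "set Qs" k] distinct_card[OF Qs(1)] by simp
    qed
    moreover have "length (fst s) \<le> n \<and> set (fst s) \<subseteq> {..<n} \<and> snd s \<le> n" if s: "s \<in> set (dp Qs k (take q mss))" for s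
    proof -
      obtain B where B: "fst s = restrict_to Qs B" "snd s \<le> n" using st[OF s] by blast
      have "card (set Qs) \<le> n" using card_mono[OF _ Qs(2)] by simp
      then have "length (fst s) \<le> n"
        unfolding B restrict_to_def using length_filter_le[of _ Qs] distinct_card[OF Qs(1)] by (metis le_trans)
      then show ?thesis using B Qs(2) by auto
    qed
    ultimately show ?thesis by blast
  qed
  from pre[of "length mss"] show len: "length (dp Qs k mss) \<le> ?b * (n + 1)" by simp
  show "s \<in> set (dp Qs k mss) \<Longrightarrow> sz s \<le> state_bound M n"
    using pre[of "length mss"] by (intro sz_state) auto
  have one: "(1::nat) \<le> 2 ^ M" by simp
  show "dp_bounded Qs k mss (dp_bound M ?b n)"
    unfolding dp_bounded_def
  proof (intro allI impI)
    fix i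
    let ?F = "\<lambda>x S. dp_step x S Qs k"
    obtain q j where "q \<le> length mss" and fold: "fold ?F (take i (concat (map (\<lambda>ms. steps ms) mss))) [([], 0)] = dp Qs k (take q mss) \<or>
      q < length mss \<and> fold ?F (take i (concat (map (\<lambda>ms. steps ms) mss))) [([], 0)] =
      extend_all Qs k (take j (mss ! q)) (dp Qs k (take q mss))"
      using take_steps[of mss ?F i "[([], 0)]"] unfolding dp_def by blast
    then obtain ms where fold': "fold ?F (take i (concat (map (\<lambda>ms. steps ms) mss))) [([], 0)] = extend_all Qs k ms (dp Qs k (take q mss))"
      and ms': "length ms \<le> M" "\<And>m. m \<in> set ms \<Longrightarrow> length (fst m) \<le> 3 \<and> set (fst m) \<subseteq> {..<n} \<and> snd m \<le> 1"
    proof (elim disjE conjE)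
      assume "fold ?F (take i (concat (map (\<lambda>ms. steps ms) mss))) [([], 0)] = dp Qs k (take q mss)"
      then show thesis by (intro that[of "[]"]) auto
    next
      assume *: "q < length mss" "fold ?F (take i (concat (map (\<lambda>ms. steps ms) mss))) [([], 0)] =
        extend_all Qs k (take j (mss ! q)) (dp Qs k (take q mss))"
      have "length (take j (mss ! q)) \<le> M" using ms[OF nth_mem[OF *(1)]] by simp
      then show thesis using that[OF *(2)] m[OF nth_mem[OF *(1)]] in_set_takeD by metis
    qed
    have "sz s \<le> state_bound M n" if "s \<in> set (extend_all Qs k ms (dp Qs k (take q mss)))" for s
      using extend_all_states[OF that, of n n n] pre[of q] ms' by (intro sz_state) fastforce+
    then have "sz (extend_all Qs k ms (dp Qs k (take q mss))) \<le> 2 + length (extend_all Qs k ms (dp Qs k (take q mss))) * state_bound M n"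
      by (rule sz_list_le)
    also have "length (extend_all Qs k ms (dp Qs k (take q mss))) \<le> 2 ^ M * (?b * (n + 1))"
      by (rule le_trans[OF extend_all_length]) (use pre[of q] ms'(1) in \<open>auto intro!: mult_le_mono power_increasing\<close>)
    finally show "sz (fold ?F (take i (concat (map (\<lambda>ms. steps ms) mss))) [([], 0)]) \<le> dp_bound M ?b n"
      unfolding fold' dp_bound_def by simp
  qed
qed

context class_system_loc
begin

lemma moves_facts:
  assumes "1 \<le> M" "ms \<in> set (moves (filter P cls) @ waste Qs)"
  shows "length ms \<le> M" "m \<in> set ms \<Longrightarrow> length (fst m) \<le> 3 \<and> set (fst m) \<subseteq> {..<n} \<and> snd m \<le> 1"
proof -
  consider c where "c \<in> set cls" "ms = map (\<lambda>t. (t, 1)) (snd c)" | q where "q \<in> Q" "ms = [([q], 0)]"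
    using assms(2) by (auto simp: moves_def waste_def)
  then have "length ms \<le> M \<and> (\<forall>m\<in>set ms. length (fst m) \<le> 3 \<and> set (fst m) \<subseteq> {..<n} \<and> snd m \<le> 1)"
  proof cases
    case 1
    then show ?thesis using cl_key[OF 1(1)] tri unfolding TL_eq TLof_def by fastforce
  next
    case 2
    then show ?thesis using assms(1) Qs_sub by auto
  qed
  then show "length ms \<le> M" "m \<in> set ms \<Longrightarrow> length (fst m) \<le> 3 \<and> set (fst m) \<subseteq> {..<n} \<and> snd m \<le> 1" by auto
qed

lemma dp_bounded_block:
  assumes "1 \<le> M"
  shows "dp_bounded Qs k (moves (filter P cls)) (dp_bound M (binsum (length Qs) k) n)"
    "length (dp Qs k (moves (filter P cls))) \<le> binsum (length Qs) k * (n + 1)"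
    "s \<in> set (dp Qs k (moves (filter P cls))) \<Longrightarrow> sz s \<le> state_bound M n"
    "dp_bounded Qs k (moves (filter P cls) @ waste Qs) (dp_bound M (binsum (length Qs) k) n)"
proof -
  have f: "ms \<in> set (moves (filter P cls)) \<Longrightarrow> length ms \<le> M"
    "ms \<in> set (moves (filter P cls)) \<Longrightarrow> m \<in> set ms \<Longrightarrow> length (fst m) \<le> 3 \<and> set (fst m) \<subseteq> {..<n} \<and> snd m \<le> 1" for ms m
    using moves_facts(1)[OF assms, of ms P] moves_facts(2)[OF assms, of ms P m] by simp_all
  note a = dp_bounded_moves[OF distinct_Qs Qs_sub separated_moves[of P], where M = M]
  show "dp_bounded Qs k (moves (filter P cls)) (dp_bound M (binsum (length Qs) k) n)"
    "length (dp Qs k (moves (filter P cls))) \<le> binsum (length Qs) k * (n + 1)"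
    "s \<in> set (dp Qs k (moves (filter P cls))) \<Longrightarrow> sz s \<le> state_bound M n"
    by (rule a; (rule f)?; assumption)+
  show "dp_bounded Qs k (moves (filter P cls) @ waste Qs) (dp_bound M (binsum (length Qs) k) n)"
    by (rule dp_bounded_moves(1)[OF distinct_Qs Qs_sub separated_waste]) (rule moves_facts[OF assms]; assumption)+
qed

text \<open>Keys are small subsets of the hub, so their number is bounded by the hub size alone,
  independently of \<open>n\<close>.\<close>

lemma card_Is: "length Is \<le> (length Qs + 1) ^ \<mu>"
proof -
  have "length Is = card (set Is)" by (rule distinct_card[symmetric]) simp
  also have "\<dots> \<le> card (restrict_to Qs ` {B. B \<subseteq> Q \<and> card B \<le> \<mu>})"
  proof (rule card_mono)
    show "set Is \<subseteq> restrict_to Qs ` {B. B \<subseteq> Q \<and> card B \<le> \<mu>}"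
    proof
      fix x assume "x \<in> set Is"
      then obtain c where c: "c \<in> set cls" "x = fst c" by auto
      have eq: "x = restrict_to Qs (set x)" and len: "length x \<le> \<mu>" using cl_key[OF c(1)] c(2) by auto
      have "set x \<subseteq> Q" using set_restrict_to[of Qs "set x"] eq by auto
      moreover have "card (set x) \<le> \<mu>" using card_length[of x] len by linarith
      ultimately show "x \<in> restrict_to Qs ` {B. B \<subseteq> Q \<and> card B \<le> \<mu>}" using eq by blast
    qed
  qed simp
  also have "\<dots> \<le> card {B. B \<subseteq> Q \<and> card B \<le> \<mu>}" by (rule card_image_le) simp
  also have "\<dots> \<le> (length Qs + 1) ^ \<mu>"
    using card_small_subsets[of Q \<mu>] binsum_le distinct_card[OF distinct_Qs] by simp
  finally show ?thesis .
qed

end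

text \<open>Doubling stops at the first \<open>l\<close> with \<open>N \<le> 2\<^sup>l\<close>, so this bounds the number of labellings generated for \<open>N\<close> keys.\<close>

definition label_count :: "nat \<Rightarrow> nat \<Rightarrow> nat" where
  "label_count r N = Max {r ^ l |l. l = 0 \<or> 2 ^ (l - 1) < N}"

lemma exponent_le:
  assumes "l = 0 \<or> 2 ^ (l - 1) < (N::nat)"
  shows "l \<le> N"
proof (cases "l = 0")
  case False
  then have "2 ^ (l - 1) < N" using assms by simp
  moreover have "l - 1 < 2 ^ (l - 1)" by (rule less_exp)
  ultimately show ?thesis by linarith
qed simp

lemma label_count_ge:
  assumes "l = 0 \<or> 2 ^ (l - 1) < N"
  shows "r ^ l \<le> label_count r N"
  unfolding label_count_def
proof (rule Max_ge)
  have "{r ^ l |l. l = 0 \<or> 2 ^ (l - 1) < N} \<subseteq> (\<lambda>l. r ^ l) ` {..N}"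
    using exponent_le by auto
  then show "finite {r ^ l |l. l = 0 \<or> 2 ^ (l - 1) < N}" using finite_subset by blast
qed (use assms in blast)

lemma label_count_mem: "\<exists>l. label_count r N = r ^ l \<and> (l = 0 \<or> 2 ^ (l - 1) < N)"
proof -
  have "{r ^ l |l. l = 0 \<or> 2 ^ (l - 1) < N} \<subseteq> (\<lambda>l. r ^ l) ` {..N}"
    using exponent_le by auto
  then have "finite {r ^ l |l. l = 0 \<or> 2 ^ (l - 1) < N}" using finite_subset by blast
  then have "label_count r N \<in> {r ^ l |l. l = 0 \<or> 2 ^ (l - 1) < N}"
    unfolding label_count_def by (rule Max_in) blast
  then show ?thesis by blast
qed

lemma good_labels_size:
  assumes "good_labels r l L" "l = 0 \<or> 2 ^ (l - 1) < N"
  shows "length L \<le> label_count r N" "\<And>lab. lab \<in> set L \<Longrightarrow> sz lab \<le> 2 + (2 * N + 1) * (2 * r + 2)"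
    "sz L \<le> 2 + label_count r N * (2 + (2 * N + 1) * (2 * r + 2))"
proof -
  \<comment> \<open>The last doubling started below \<open>N\<close>; the \<open>+ 1\<close> is for
    \<open>l = 0\<close> and \<open>N = 0\<close>.\<close>
  have two: "2 ^ l \<le> 2 * N + 1"
    using assms(2) by (cases l) auto
  show len: "length L \<le> label_count r N"
    using label_count_ge[OF assms(2)] assms(1) unfolding good_labels_def by simp
  show lab: "sz lab \<le> 2 + (2 * N + 1) * (2 * r + 2)" if "lab \<in> set L" for lab
  proof -
    have "length lab = 2 ^ l" "\<forall>a\<in>set lab. a < r" using assms(1) that unfolding good_labels_def by auto
    then have "sz lab \<le> 2 + length lab * (2 * r + 2)" by (intro sz_list_le) auto
    also have "\<dots> \<le> 2 + (2 * N + 1) * (2 * r + 2)" using two \<open>length lab = 2 ^ l\<close>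
      by (intro add_mono mult_le_mono) auto
    finally show ?thesis .
  qed
  have "sz L \<le> 2 + length L * (2 + (2 * N + 1) * (2 * r + 2))" by (rule sz_list_le) (rule lab)
  also have "\<dots> \<le> 2 + label_count r N * (2 + (2 * N + 1) * (2 * r + 2))"
    using len by (intro add_mono mult_le_mono) auto
  finally show "sz L \<le> 2 + label_count r N * (2 + (2 * N + 1) * (2 * r + 2))" .
qed

lemma length_choices: "length (choices m) = 2 * (m + 1) ^ 2"
  unfolding choices_def by (simp add: length_concat comp_def sum_list_triv power2_eq_square algebra_simps)

lemma vectors_iterate:
  "length (fold (\<lambda>_ L. concat (map (\<lambda>x. map (\<lambda>g. x # g) L) os)) ks [[]]) = length os ^ length ks"
proof (induction ks rule: rev_induct)
  case (snoc k ks)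
  have "length (concat (map (\<lambda>x. map (\<lambda>g. x # g) L) os)) = length os * length L" for L :: "'a list list"
    by (induction os) auto
  then show ?case using snoc by simp
qed simp

lemma sz_vector:
  assumes "\<And>x. x \<in> set os \<Longrightarrow> sz x \<le> B"
    "g \<in> set (fold (\<lambda>_ L. concat (map (\<lambda>x. map (\<lambda>g. x # g) L) os)) ks [[]])"
  shows "sz g \<le> 2 + length ks * B"
  using assms(2)
proof (induction ks arbitrary: g rule: rev_induct)
  case (snoc k ks)
  then obtain x g' where "x \<in> set os" "g' \<in> set (fold (\<lambda>_ L. concat (map (\<lambda>x. map (\<lambda>g. x # g) L) os)) ks [[]])" "g = x # g'"
    by auto
  then show ?case using snoc.IH[of g'] assms(1)[of x] by simp
qed simp

lemma sz_choice: "x \<in> set (choices m) \<Longrightarrow> sz x \<le> 4 * m + 8"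
proof -
  assume x: "x \<in> set (choices m)"
  obtain b s w where "x = (b, s, w)" by (cases x)
  then show ?thesis using x set_choices[of b s w m] sz_bool_le[of b] by simp
qed

section \<open>Running time of the search\<close>

lemma pt_time: "pt_on D f \<Longrightarrow> \<exists>e. computes D f (\<lambda>c. sz c ^ e)"
  by (erule pt_onE) (auto simp: pb_def intro: computes_mono)

lemma pb_pt_nat: "pt_on D f \<Longrightarrow> pb D f" for f :: "'a::enc \<Rightarrow> nat"
  by (drule pt_sz, erule pb_mono) auto

text \<open>The exponential factors are kept apart from the polynomial ones: \<open>V\<close> for
  generating the list, \<open>E\<close> for its length and \<open>W\<close> for a single test. Only
  polynomial factors are merged into the power of \<open>sz c\<close>, so the exponential ones keep
  their exact form through the nesting.\<close>

lemma computes_search: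
  assumes xs: "computes D xs Tx"
    and P: "computes {p. snd p \<in> D \<and> fst p \<in> set (xs (snd p))} (\<lambda>p. P (fst p) (snd p)) (\<lambda>p. sz p ^ e * W (snd p))"
    and Tx: "\<And>c. c \<in> D \<Longrightarrow> Tx c \<le> V c * R c" "pb D R"
    and len: "\<And>c. c \<in> D \<Longrightarrow> length (xs c) \<le> E c * Y c" "pb D Y"
    and elem: "\<And>c x. c \<in> D \<Longrightarrow> x \<in> set (xs c) \<Longrightarrow> sz x \<le> Z c" "pb D Z"
    and ge: "\<And>c. c \<in> D \<Longrightarrow> 1 \<le> V c \<and> 1 \<le> E c \<and> 1 \<le> W c"
  shows "\<exists>e. computes D (\<lambda>c. \<exists>x\<in>set (xs c). P x c) (\<lambda>c. sz c ^ e * (V c * E c * W c))"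
proof -
  define B where "B = (\<lambda>c. (Z c + sz c) ^ e * W c)"
  have "computes D (\<lambda>c. \<exists>x\<in>set (xs c). P x c) (\<lambda>c. Tx c + (length (xs c) + 2) * (B c + 70))"
  proof (rule computes_Bex[OF xs P])
    fix c x assume "c \<in> D" "x \<in> set (xs c)"
    then show "sz (x, c) ^ e * W (snd (x, c)) \<le> B c"
      unfolding B_def using elem(1) by (auto intro!: mult_le_mono power_mono)
  qed
  moreover have "pb D (\<lambda>c. R c + (Y c + 2) * ((Z c + sz c) ^ e + 70))"
    by (intro pb_intros Tx len elem pb_sz)
  then obtain e' where e': "\<And>c. c \<in> D \<Longrightarrow> R c + (Y c + 2) * ((Z c + sz c) ^ e + 70) \<le> sz c ^ e'"
    unfolding pb_def by blast
  have "Tx c + (length (xs c) + 2) * (B c + 70) \<le> sz c ^ e' * (V c * E c * W c)" if c: "c \<in> D" for c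
  proof -
    have g: "1 \<le> V c" "1 \<le> E c" "1 \<le> W c" using ge[OF c] by auto
    have "Tx c \<le> R c * (V c * E c * W c)"
    proof -
      have "V c * R c * 1 * 1 \<le> V c * R c * E c * W c" using g by (intro mult_le_mono) auto
      moreover have "V c * R c * E c * W c = R c * (V c * E c * W c)" by (simp only: ac_simps)
      ultimately show ?thesis using Tx(1)[OF c] by linarith
    qed
    moreover have "(length (xs c) + 2) * (B c + 70) \<le> (Y c + 2) * ((Z c + sz c) ^ e + 70) * (V c * E c * W c)"
    proof -
      have "length (xs c) + 2 \<le> (Y c + 2) * E c" using len(1)[OF c] g(2) by (simp add: algebra_simps)
      moreover have "B c + 70 \<le> ((Z c + sz c) ^ e + 70) * W c" using g(3) by (simp add: B_def algebra_simps)
      ultimately have "(length (xs c) + 2) * (B c + 70) \<le> ((Y c + 2) * E c) * (((Z c + sz c) ^ e + 70) * W c)"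
        by (rule mult_le_mono)
      also have "\<dots> \<le> ((Y c + 2) * E c) * (((Z c + sz c) ^ e + 70) * W c) * V c" using g(1) by simp
      finally show ?thesis by (simp only: ac_simps)
    qed
    ultimately have "Tx c + (length (xs c) + 2) * (B c + 70) \<le> (R c + (Y c + 2) * ((Z c + sz c) ^ e + 70)) * (V c * E c * W c)"
      by (simp only: add_mult_distrib add_mono)
    also have "\<dots> \<le> sz c ^ e' * (V c * E c * W c)" by (rule mult_le_mono1[OF e'[OF c]])
    finally show ?thesis .
  qed
  ultimately show ?thesis by (intro exI[of _ e']) (auto intro: computes_mono)
qed

text \<open>The components are the number of vertices, the threshold, the hub, the classes, the
  keys, the number of buckets and the limit for the tail. All are computed once, before any
  guess.\<close>

type_synonym frame = "nat \<times> nat \<times> nat list \<times> (nat list \<times> nat list list) list \<times> nat list list \<times> nat \<times> nat"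

abbreviation xn :: "frame \<Rightarrow> nat" where "xn X \<equiv> fst X"
abbreviation xt :: "frame \<Rightarrow> nat" where "xt X \<equiv> fst (snd X)"
abbreviation xQ :: "frame \<Rightarrow> nat list" where "xQ X \<equiv> fst (snd (snd X))"
abbreviation xc :: "frame \<Rightarrow> (nat list \<times> nat list list) list" where "xc X \<equiv> fst (snd (snd (snd X)))"
abbreviation xI :: "frame \<Rightarrow> nat list list" where "xI X \<equiv> fst (snd (snd (snd (snd X))))"
abbreviation xr :: "frame \<Rightarrow> nat" where "xr X \<equiv> fst (snd (snd (snd (snd (snd X)))))"
abbreviation xk :: "frame \<Rightarrow> nat" where "xk X \<equiv> snd (snd (snd (snd (snd (snd X)))))"

lemma block_filter: "\<exists>P. block cls Is lab x = moves (filter P cls)"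
proof (cases "fst (snd x)")
  case True
  then show ?thesis by (intro exI[of _ "\<lambda>_. False"]) (simp add: block_def moves_def)
next
  case False
  then show ?thesis by (auto simp: block_def bucket_eq)
qed

lemma dp_bounded_mono: "dp_bounded Qs k mss b \<Longrightarrow> b \<le> b' \<Longrightarrow> dp_bounded Qs k mss b'"
  unfolding dp_bounded_def by (meson le_trans)

lemma dp_bound_mono: "b \<le> b' \<Longrightarrow> dp_bound M b n \<le> dp_bound M b' n"
  unfolding dp_bound_def by (intro add_mono mult_le_mono) auto

lemma pb_dp_bound:
  assumes "pb D b" "pb D n"
  shows "pb D (\<lambda>c. dp_bound M (b c) (n c))"
  unfolding dp_bound_def state_bound_def by (intro pb_intros assms)

text \<open>Here the limit \<open>k\<close> is a constant, so the number of states is polynomial.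
  Only the tail has a limit that grows with the hub.\<close>

lemma pt_dp_blocks:
  assumes pt: "pt_on D nn" "pt_on D Qs" "pt_on D cls" "pt_on D Is" "pt_on D lab" "pt_on D x"
    and sys: "\<And>c. c \<in> D \<Longrightarrow> \<exists>TL. class_system_loc (nn c) (Qs c) \<mu> M TL (cls c)" and M: "1 \<le> M"
  shows "pt_on D (\<lambda>c. dp (Qs c) k (block (cls c) (Is c) (lab c) (x c)))"
    "pt_on D (\<lambda>c. dp (Qs c) k (block (cls c) (Is c) (lab c) (x c) @ waste (Qs c)))"
proof -
  have pb: "pb D (\<lambda>c. dp_bound M ((length (Qs c) + 1) ^ k) (nn c))"
    by (intro pb_dp_bound pb_intros pb_pt_nat pt_length pt)
  have "dp_bounded (Qs c) k (block (cls c) (Is c) (lab c) (x c)) (dp_bound M ((length (Qs c) + 1) ^ k) (nn c)) \<and>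
    dp_bounded (Qs c) k (block (cls c) (Is c) (lab c) (x c) @ waste (Qs c)) (dp_bound M ((length (Qs c) + 1) ^ k) (nn c))"
    if c: "c \<in> D" for c
  proof -
    obtain TL where TL: "class_system_loc (nn c) (Qs c) \<mu> M TL (cls c)" using sys[OF c] by blast
    obtain P where P: "block (cls c) (Is c) (lab c) (x c) = moves (filter P (cls c))" using block_filter by blast
    show ?thesis unfolding P
      using class_system_loc.dp_bounded_block(1,4)[OF TL M, of k P] dp_bounded_mono[OF _ dp_bound_mono[OF binsum_le]] by blast
  qed
  then show "pt_on D (\<lambda>c. dp (Qs c) k (block (cls c) (Is c) (lab c) (x c)))"
    "pt_on D (\<lambda>c. dp (Qs c) k (block (cls c) (Is c) (lab c) (x c) @ waste (Qs c)))"
    by (auto intro!: pt_dp[OF _ _ _ pb] pt pt_const pt_block pt_append pt_waste)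
qed

lemma pt_need_sets:
  assumes pt: "pt_on D nn" "pt_on D Qs" "pt_on D cls" "pt_on D Is" "pt_on D lab" "pt_on D xs"
    and sys: "\<And>c. c \<in> D \<Longrightarrow> \<exists>TL. class_system_loc (nn c) (Qs c) \<mu> M TL (cls c)" and M: "1 \<le> M"
  shows "pt_on D (\<lambda>c. need (Qs c) (cls c) (Is c) (lab c) (xs c))"
    "pt_on D (\<lambda>c. block_sets m (Qs c) (cls c) (Is c) (lab c) (xs c))"
proof -
  let ?D = "{p. snd p \<in> D \<and> fst p \<in> set (xs (snd p))}"
  note ctx = pt[THEN pt_snd_ctx, of "\<lambda>p. fst p \<in> set (xs (snd p))"]
  have dp0: "pt_on ?D (\<lambda>p. dp (Qs (snd p)) 0 (block (cls (snd p)) (Is (snd p)) (lab (snd p)) (fst p)))"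
    by (rule pt_dp_blocks(1)[OF ctx(1-5) pt_fst[OF pt_id] _ M]) (use sys in auto)
  have dpm: "pt_on ?D (\<lambda>p. dp (Qs (snd p)) m (block (cls (snd p)) (Is (snd p)) (lab (snd p)) (fst p) @ waste (Qs (snd p))))"
    by (rule pt_dp_blocks(2)[OF ctx(1-5) pt_fst[OF pt_id] _ M]) (use sys in auto)
  have base: "pt_on ?D (\<lambda>p. base (Qs (snd p)) (block (cls (snd p)) (Is (snd p)) (lab (snd p)) (fst p)))"
    unfolding base_def by (intro pt_max_list pt_map dp0 pt_snd pt_fst pt_id)
  show "pt_on D (\<lambda>c. need (Qs c) (cls c) (Is c) (lab c) (xs c))"
    unfolding need_def by (intro pt_sum_list pt_map pt pt_add base pt_snd pt_fst pt_id)
  show "pt_on D (\<lambda>c. block_sets m (Qs c) (cls c) (Is c) (lab c) (xs c))"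
    unfolding block_sets_def
    by (intro pt_concat_map pt pt_map pt_filter dpm pt_Pair pt_conj pt_eq pt_length pt_le pt_add pt_snd pt_fst pt_id
        pt_comp[OF base pt_snd[OF pt_id]]) auto
qed

text \<open>A block set has at most \<open>m\<close> hub positions and two tokens, which gives the
  set size \<open>m + 2\<close>. Its list is determined by its set, because positions are listed in
  increasing order and the tokens reveal the bucket; having two tokens, it differs from every
  singleton.\<close>

lemma cover_family_instance:
  assumes "distinct Qs" "\<And>U j. (U, j) \<in> set Ss \<Longrightarrow> j < r \<and> card (set Qs \<inter> set U) \<le> m"
  shows "set_cover_instance (m + 2) {..<length Qs + r + r} (set ` set (cover_family Qs r Ss T))"
    "lists_family (cover_family Qs r Ss T) (set ` set (cover_family Qs r Ss T))"
proof -
  let ?p = "length Qs"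
  define f where "f = (\<lambda>s. positions Qs (fst s) @ [?p + snd s, ?p + r + snd s])"
  define Ss' where "Ss' = filter (\<lambda>s. \<not> (\<exists>q\<in>set (fst s). q \<in> set T)) Ss"
  have fam: "cover_family Qs r Ss T = map (\<lambda>x. [x]) (dn (?p + r + r)) @ dedup (map f Ss')"
    by (simp add: cover_family_def f_def Ss'_def)
  have f: "distinct (f s)" "set (f s) \<subseteq> {..<?p + r + r}" "card (set (f s)) \<le> m + 2" if s: "s \<in> set Ss'" for s
  proof -
    have j: "snd s < r" and U: "card (set Qs \<inter> set (fst s)) \<le> m"
      using assms(2)[of "fst s" "snd s"] s by (auto simp: Ss'_def)
    show "distinct (f s)" using j by (auto simp: f_def positions_eq)
    show "set (f s) \<subseteq> {..<?p + r + r}" using j by (auto simp: f_def set_positions)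
    have "card (set (f s)) \<le> card (set (positions Qs (fst s))) + card {?p + snd s, ?p + r + snd s}"
      unfolding f_def set_append using card_Un_le[of "set (positions Qs (fst s))" "{?p + snd s, ?p + r + snd s}"] by simp
    also have "\<dots> \<le> m + 2" using card_positions[OF assms(1), of "fst s"] U card_insert_le_m1[of 2 "{?p + r + snd s}" "?p + snd s"] by simp
    finally show "card (set (f s)) \<le> m + 2" .
  qed
  have inj: "f s = f s'" if s: "s \<in> set Ss'" "s' \<in> set Ss'" and eq: "set (f s) = set (f s')" for s s'
  proof -
    have j: "snd s < r" "snd s' < r" using assms(2)[of "fst s" "snd s"] assms(2)[of "fst s'" "snd s'"] s by (auto simp: Ss'_def)
    have part: "set (f t) \<inter> {..<?p} = set (positions Qs (fst t))" "set (f t) \<inter> {?p..<?p + r} = {?p + snd t}" if "snd t < r" for t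
      using that by (auto simp: f_def set_positions)
    have "set (positions Qs (fst s)) = set (positions Qs (fst s'))" using part(1)[OF j(1)] part(1)[OF j(2)] eq by simp
    then have "positions Qs (fst s) = positions Qs (fst s')"
      unfolding positions_eq by (intro filter_cong) auto
    moreover have "snd s = snd s'" using part(2)[OF j(1)] part(2)[OF j(2)] eq by simp
    ultimately show ?thesis by (simp add: f_def)
  qed
  have two: "card (set (f s)) \<noteq> 1" if "s \<in> set Ss'" for s
  proof -
    have "snd s < r" using assms(2)[of "fst s" "snd s"] that by (auto simp: Ss'_def)
    moreover have "card {?p + snd s, ?p + r + snd s} \<le> card (set (f s))" by (rule card_mono) (auto simp: f_def)
    ultimately show ?thesis by simp
  qed
  show "lists_family (cover_family Qs r Ss T) (set ` set (cover_family Qs r Ss T))"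
    unfolding lists_family_def lists_set_def
  proof (intro conjI)
    show "\<forall>xs\<in>set (cover_family Qs r Ss T). distinct xs" using f(1) by (auto simp: fam)
    have "inj_on set (set (dedup (map f Ss')))" using inj by (auto simp: inj_on_def)
    then have "distinct (map set (dedup (map f Ss')))" by (simp add: distinct_map)
    moreover have "distinct (map set (map (\<lambda>x. [x]) (dn (?p + r + r))))" by (simp add: distinct_map inj_on_def)
    moreover have "set (map set (map (\<lambda>x. [x]) (dn (?p + r + r)))) \<inter> set (map set (dedup (map f Ss'))) = {}"
    proof (rule ccontr)
      assume "\<not> ?thesis"
      then obtain X where X: "X \<in> set (map set (map (\<lambda>x. [x]) (dn (?p + r + r))))" "X \<in> set (map set (dedup (map f Ss')))" by blast
      then obtain x s where "X = {x}" "s \<in> set Ss'" "X = set (f s)" by auto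
      then show False using two[of s] by simp
    qed
    ultimately show "distinct (map set (cover_family Qs r Ss T))" unfolding fam by simp
  qed simp
  have "card {x} \<le> m + 2" for x :: nat by simp
  moreover have "\<Union> (set ` set (cover_family Qs r Ss T)) = {..<?p + r + r}"
    using f(2) by (auto simp: fam)
  ultimately show "set_cover_instance (m + 2) {..<?p + r + r} (set ` set (cover_family Qs r Ss T))"
    unfolding set_cover_instance_def using f(2,3) by (auto simp: fam)
qed

section \<open>The search over all guesses and its queries to the Set Cover program\<close>

definition frames :: "nat \<Rightarrow> nat \<Rightarrow> nat \<Rightarrow> nat \<Rightarrow> frame set" where
  "frames \<mu> M g h = {X. (\<exists>TL. class_system_loc (xn X) (xQ X) \<mu> M TL (xc X)) \<and> xI X = dedup (map fst (xc X)) \<and>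
     xr X = length (xQ X) div g + 1 \<and> xk X = length (xQ X) div h}"

text \<open>Chosen so that its encoding is literally the input of a Set Cover program: flag and
  number are sign and absolute value of the threshold, and the unit is the end of the list.\<close>

type_synonym query = "nat \<times> nat list list \<times> (bool \<times> nat) \<times> unit"

definition sc_answer :: "query \<Rightarrow> bool" where
  "sc_answer z \<longleftrightarrow> has_set_cover {..<fst z} (set ` set (fst (snd z))) (int (snd (fst (snd (snd z)))))"

definition sc_queries :: "nat \<Rightarrow> query set" where
  "sc_queries d = {z. set_cover_instance d {..<fst z} (set ` set (fst (snd z))) \<and>
     lists_family (fst (snd z)) (set ` set (fst (snd z))) \<and> \<not> fst (fst (snd (snd z)))}"

type_synonym guess = "state \<times> (bool \<times> nat \<times> nat) list \<times> nat list \<times> frame"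

abbreviation gX :: "guess \<Rightarrow> frame" where "gX p \<equiv> snd (snd (snd p))"
abbreviation glab :: "guess \<Rightarrow> nat list" where "glab p \<equiv> fst (snd (snd p))"
abbreviation gxs :: "guess \<Rightarrow> (nat \<times> bool \<times> nat \<times> nat) list" where "gxs p \<equiv> zip (dn (xr (gX p))) (fst (snd p))"

definition check :: "guess \<Rightarrow> bool" where
  "check p \<longleftrightarrow> xt (gX p) \<le> need (xQ (gX p)) (xc (gX p)) (xI (gX p)) (glab p) (gxs p) + snd (fst p) \<and>
     sum_list (map (\<lambda>x. fst (snd (snd x))) (gxs p)) + length (fst (fst p)) = length (xQ (gX p))"

definition query_of :: "nat \<Rightarrow> guess \<Rightarrow> query" where
  "query_of m p = (length (xQ (gX p)) + xr (gX p) + xr (gX p),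
     cover_family (xQ (gX p)) (xr (gX p)) (block_sets m (xQ (gX p)) (xc (gX p)) (xI (gX p)) (glab p) (gxs p)) (fst (fst p)),
     (False, xr (gX p) + length (fst (fst p))), ())"

definition leaf :: "nat \<Rightarrow> guess \<Rightarrow> bool" where
  "leaf m p \<longleftrightarrow> (if check p then sc_answer (query_of m p) else False)"

definition tail_states :: "(bool \<times> nat \<times> nat) list \<times> nat list \<times> frame \<Rightarrow> state list" where
  "tail_states q = dp (xQ (snd (snd q))) (xk (snd (snd q)))
     (tail (xc (snd (snd q))) (xI (snd (snd q))) (fst (snd q)) (zip (dn (xr (snd (snd q)))) (fst q)))"

definition search :: "nat \<Rightarrow> frame \<Rightarrow> bool" where
  "search m X \<longleftrightarrow> (\<exists>lab\<in>set (labels (xI X) (xr X)). \<exists>gv\<in>set (vectors (choices m) (xr X)).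
     \<exists>s\<in>set (tail_states (gv, lab, X)). leaf m (s, gv, lab, X))"

lemma leaf_iff: "leaf m p \<longleftrightarrow> check p \<and> sc_answer (query_of m p)"
  by (simp add: leaf_def)

lemma search_correct:
  assumes X: "class_system_loc (xn X) (xQ X) \<mu> M TL (xc X)" "X \<in> frames \<mu> M g h" and "0 < g" "0 < h"
    and m: "m = 9 * h * (\<mu> + g)"
  shows "search m X \<longleftrightarrow> (\<exists>Y\<subseteq>TL. packs Y \<and> xt X \<le> card Y)"
proof -
  interpret class_system_loc "xn X" "xQ X" \<mu> M TL "xc X" by (rule X(1))
  have I: "xI X = Is" and r: "xr X = length (xQ X) div g + 1" and k: "xk X = length (xQ X) div h"
    using X(2) by (auto simp: frames_def)
  have rg: "length (xQ X) \<le> xr X * g"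
    unfolding r using dividend_less_div_times[OF \<open>0 < g\<close>, of "length (xQ X)"] by (simp add: algebra_simps)
  show ?thesis
  proof
    assume "search m X"
    then obtain lab gv s where *: "gv \<in> set (vectors (choices m) (xr X))" "s \<in> set (tail_states (gv, lab, X))" "leaf m (s, gv, lab, X)"
      unfolding search_def by blast
    have "length gv = xr X" using *(1) unfolding set_vectors by simp
    then show "\<exists>Y\<subseteq>TL. packs Y \<and> xt X \<le> card Y"
      using *(2,3) unfolding leaf_iff check_def query_of_def sc_answer_def tail_states_def fst_conv snd_conv I
      by (intro core_sound[OF _ refl, where T = "fst s" and v = "snd s"]) (auto split: if_splits)
  next
    assume "\<exists>Y\<subseteq>TL. packs Y \<and> xt X \<le> card Y"
    then obtain Y where Y: "Y \<subseteq> TL" "packs Y" "xt X \<le> card Y" by blast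
    have "m = 3 * (3 * h * (\<mu> + g))" using m by simp
    moreover have "0 < xr X" by (simp add: r)
    ultimately show "search m X"
      unfolding search_def leaf_iff check_def query_of_def sc_answer_def tail_states_def fst_conv snd_conv I conj_assoc
      by (intro core_complete[OF Y \<open>0 < g\<close> \<open>0 < h\<close> _ rg refl _ k])
  qed
qed

lemma pt_leaf_parts:
  assumes M: "1 \<le> M"
  shows "pt_on {p. gX p \<in> frames \<mu> M g h} check" "pt_on {p. gX p \<in> frames \<mu> M g h} (query_of m)"
proof -
  let ?D = "{p. gX p \<in> frames \<mu> M g h}"
  have *: "pt_on ?D (\<lambda>p. xn (gX p))" "pt_on ?D (\<lambda>p. xQ (gX p))" "pt_on ?D (\<lambda>p. xc (gX p))" "pt_on ?D (\<lambda>p. xI (gX p))"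
    "pt_on ?D (\<lambda>p. glab p)" "pt_on ?D (\<lambda>p. gxs p)" by (intro pt)+
  have sys: "\<And>p. p \<in> ?D \<Longrightarrow> \<exists>TL. class_system_loc (xn (gX p)) (xQ (gX p)) \<mu> M TL (xc (gX p))" by (auto simp: frames_def)
  note need = pt_need_sets[OF * sys M]
  show "pt_on ?D check" unfolding check_def[abs_def] by (intro pt need(1))
  show "pt_on ?D (query_of m)" unfolding query_of_def[abs_def] by (intro pt need(2))
qed

lemma query_valid:
  assumes X: "gX p \<in> frames \<mu> M g h"
  shows "query_of m p \<in> sc_queries (m + 2)"
proof -
  obtain TL where TL: "class_system_loc (xn (gX p)) (xQ (gX p)) \<mu> M TL (xc (gX p))" using X by (auto simp: frames_def)
  interpret class_system_loc "xn (gX p)" "xQ (gX p)" \<mu> M TL "xc (gX p)" by (rule TL)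
  have "j < xr (gX p) \<and> card (set (xQ (gX p)) \<inter> set U) \<le> m"
    if "(U, j) \<in> set (block_sets m (xQ (gX p)) (xc (gX p)) (xI (gX p)) (glab p) (gxs p))" for U j
  proof -
    obtain v x where x: "x \<in> set (gxs p)" "j = fst x"
      "(U, v) \<in> set (dp (xQ (gX p)) m (block (xc (gX p)) (xI (gX p)) (glab p) x @ waste (xQ (gX p))))"
      using \<open>(U, j) \<in> _\<close> unfolding set_block_sets by blast
    obtain P where "block (xc (gX p)) (xI (gX p)) (glab p) x = moves (filter P (xc (gX p)))" using block_filter by blast
    then have "length U \<le> m" using dp_waste_sound[of U v m P] x(3) by auto
    moreover have "card (set (xQ (gX p)) \<inter> set U) \<le> card (set U)" by (rule card_mono) auto
    moreover have "j < xr (gX p)" using set_zip_leftD[of "fst x" "snd x"] x(1,2) by fastforce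
    ultimately show ?thesis using card_length[of U] by linarith
  qed
  from cover_family_instance[OF distinct_Qs this] show ?thesis
    by (simp add: query_of_def sc_queries_def)
qed

lemma leaf_time:
  assumes M: "1 \<le> M" and orc: "computes (sc_queries (m + 2)) sc_answer (\<lambda>z. ot (fst z))"
  shows "\<exists>e. computes {p. gX p \<in> frames \<mu> M g h} (leaf m) (\<lambda>p. sz p ^ e * (ot (length (xQ (gX p)) + xr (gX p) + xr (gX p)) + 1))"
proof -
  let ?D = "{p. gX p \<in> frames \<mu> M g h}" and ?o = "\<lambda>p. ot (length (xQ (gX p)) + xr (gX p) + xr (gX p))"
  obtain e1 where e1: "computes ?D check (\<lambda>p. sz p ^ e1)" using pt_time[OF pt_leaf_parts(1)[OF M]] by blast
  obtain e2 where e2: "computes ?D (query_of m) (\<lambda>p. sz p ^ e2)" using pt_time[OF pt_leaf_parts(2)[OF M]] by blast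
  have "computes {p \<in> ?D. check p} (\<lambda>p. sc_answer (query_of m p)) (\<lambda>p. sz p ^ e2 + ot (fst (query_of m p)) + 2)"
    by (rule computes_comp[OF computes_mono[OF e2] orc]) (blast, simp, simp, rule query_valid, blast)
  from computes_if[OF e1 this computes_const]
  have "computes ?D (leaf m) (\<lambda>p. sz p ^ e1 + (if check p then sz p ^ e2 + ot (fst (query_of m p)) + 2 else sz False) + 5)"
    unfolding leaf_def[abs_def] by simp
  moreover have "pb ?D (\<lambda>p. sz p ^ e1 + sz p ^ e2 + 10)" by (intro pb_intros pb_sz)
  then obtain e where e: "\<And>p. p \<in> ?D \<Longrightarrow> sz p ^ e1 + sz p ^ e2 + 10 \<le> sz p ^ e" unfolding pb_def by blast
  have "sz p ^ e1 + (if check p then sz p ^ e2 + ot (fst (query_of m p)) + 2 else sz False) + 5 \<le> sz p ^ e * (?o p + 1)"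
    if p: "p \<in> ?D" for p
  proof -
    have "sz p ^ e1 + (if check p then sz p ^ e2 + ot (fst (query_of m p)) + 2 else sz False) + 5 \<le> sz p ^ e1 + sz p ^ e2 + 10 + ?o p"
      by (simp add: query_of_def)
    also have "\<dots> \<le> (sz p ^ e1 + sz p ^ e2 + 10) * (?o p + 1)" by (simp add: algebra_simps)
    also have "\<dots> \<le> sz p ^ e * (?o p + 1)" by (rule mult_le_mono1[OF e[OF p]])
    finally show ?thesis .
  qed
  ultimately show ?thesis by (intro exI[of _ e]) (auto intro: computes_mono)
qed

text \<open>Combines polynomial preprocessing with a loop timed by \<open>fold_exponent\<close>. The
  size bound splits into an exponential factor \<open>E\<close> and a polynomial one, and
  \<open>E\<close> is raised to the given exponent \<open>a\<close> only, whatever the preprocessing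
  costs.\<close>

lemma computes_via:
  assumes pre: "pt_on D pre" and f: "computes (pre ` D) f (\<lambda>c. B c ^ a)"
    and B: "\<And>q. q \<in> D \<Longrightarrow> B (pre q) \<le> E q * S q" "pb D S" and E: "\<And>q. q \<in> D \<Longrightarrow> 1 \<le> E q"
  shows "\<exists>T R. computes D (\<lambda>q. f (pre q)) T \<and> (\<forall>q\<in>D. T q \<le> E q ^ a * R q) \<and> pb D R"
proof -
  obtain e where e: "computes D pre (\<lambda>q. sz q ^ e)" using pt_time[OF pre] by blast
  have c: "computes D (\<lambda>q. f (pre q)) (\<lambda>q. sz q ^ e + B (pre q) ^ a + 2)"
    by (rule computes_comp[OF e f]) auto
  show ?thesis
  proof (rule exI[of _ "\<lambda>q. sz q ^ e + B (pre q) ^ a + 2"], rule exI[of _ "\<lambda>q. sz q ^ e + S q ^ a + 2"],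
      intro conjI ballI c)
    show "pb D (\<lambda>q. sz q ^ e + S q ^ a + 2)" by (intro pb_intros pb_sz B)
    fix q assume q: "q \<in> D"
    have "B (pre q) ^ a \<le> (E q * S q) ^ a" by (rule power_mono[OF B(1)[OF q]]) simp
    moreover have "1 \<le> E q ^ a" using E[OF q] by simp
    ultimately show "sz q ^ e + B (pre q) ^ a + 2 \<le> E q ^ a * (sz q ^ e + S q ^ a + 2)"
      using mult_le_mono1[OF \<open>1 \<le> E q ^ a\<close>, of "sz q ^ e + 2"] by (simp add: algebra_simps power_mult_distrib)
  qed
qed

lemma dp_bound_factor: "1 \<le> b \<Longrightarrow> dp_bound M b n \<le> b * dp_bound M 1 n"
  unfolding dp_bound_def by (simp add: algebra_simps)

lemma pb_frame:
  assumes "pt_on D X"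
  shows "pb D (\<lambda>c. xn (X c))" "pb D (\<lambda>c. xr (X c))" "pb D (\<lambda>c. length (xI (X c)))"
  by (intro pb_pt_nat pt assms)+

abbreviation oracle_time :: "(nat \<Rightarrow> nat) \<Rightarrow> frame \<Rightarrow> nat" where
  "oracle_time ot X \<equiv> ot (length (xQ X) + xr X + xr X) + 1"

text \<open>The exponent \<open>a\<close> enters through a hypothesis, as in the two lemmas for the
  outer loops. One and the same \<open>a\<close> can thus be fixed before \<open>m\<close>,
  \<open>g\<close>, \<open>h\<close>, \<open>\<mu>\<close> and \<open>M\<close> are known.\<close>

lemma tail_search_time:
  assumes a: "\<forall>D B. (\<forall>c\<in>D. sz (c :: nat \<times> nat list \<times> nat \<times> move list list) \<le> B c \<and>
      dp_bounded (fst (snd c)) (fst (snd (snd c))) (snd (snd (snd c))) (B c))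
    \<longrightarrow> computes D (\<lambda>c. dp (fst (snd c)) (fst (snd (snd c))) (snd (snd (snd c)))) (\<lambda>c. B c ^ a)"
    and M: "1 \<le> M" and orc: "computes (sc_queries (m + 2)) sc_answer (\<lambda>z. ot (fst z))"
  shows "\<exists>e. computes {q. snd (snd q) \<in> frames \<mu> M g h} (\<lambda>q. \<exists>s\<in>set (tail_states q). leaf m (s, q))
    (\<lambda>q. sz q ^ e * (binsum (length (xQ (snd (snd q)))) (xk (snd (snd q))) ^ a *
      binsum (length (xQ (snd (snd q)))) (xk (snd (snd q))) * oracle_time ot (snd (snd q))))"
proof -
  let ?D = "{q :: (bool \<times> nat \<times> nat) list \<times> nat list \<times> frame. snd (snd q) \<in> frames \<mu> M g h}"
  let ?X = "\<lambda>q :: (bool \<times> nat \<times> nat) list \<times> nat list \<times> frame. snd (snd q)"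
  let ?E = "\<lambda>q. binsum (length (xQ (?X q))) (xk (?X q))"
  define pre where "pre = (\<lambda>q. (xn (?X q), xQ (?X q), xk (?X q),
    tail (xc (?X q)) (xI (?X q)) (fst (snd q)) (zip (dn (xr (?X q))) (fst q))))"
  have pt_pre: "pt_on ?D pre" unfolding pre_def by (intro pt)
  define B where "B = (\<lambda>c :: nat \<times> nat list \<times> nat \<times> move list list.
    sz c + dp_bound M (binsum (length (fst (snd c))) (fst (snd (snd c)))) (fst c))"
  have sys: "dp_bounded (xQ (?X q)) (xk (?X q)) (snd (snd (snd (pre q)))) (dp_bound M (?E q) (xn (?X q))) \<and>
      length (tail_states q) \<le> ?E q * (xn (?X q) + 1) \<and> (\<forall>s\<in>set (tail_states q). sz s \<le> state_bound M (xn (?X q)))"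
    if q: "q \<in> ?D" for q
  proof -
    obtain TL where TL: "class_system_loc (xn (?X q)) (xQ (?X q)) \<mu> M TL (xc (?X q))" using q by (auto simp: frames_def)
    show ?thesis
      unfolding tail_states_def pre_def snd_conv tail_eq using class_system_loc.dp_bounded_block(1-3)[OF TL M] by blast
  qed
  have B: "sz c \<le> B c \<and> dp_bounded (fst (snd c)) (fst (snd (snd c))) (snd (snd (snd c))) (B c)" if c: "c \<in> pre ` ?D" for c
  proof -
    obtain q where q: "q \<in> ?D" "c = pre q" using c by blast
    then show ?thesis using sys[OF q(1)] dp_bounded_mono unfolding B_def by (auto simp: pre_def intro: dp_bounded_mono)
  qed
  then have f: "computes (pre ` ?D) (\<lambda>c. dp (fst (snd c)) (fst (snd (snd c))) (snd (snd (snd c)))) (\<lambda>c. B c ^ a)"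
    by (intro a[THEN spec, THEN spec, THEN mp]) blast
  have E: "1 \<le> ?E q" for q using binsum_pos by (simp add: Suc_le_eq)
  have BE: "B (pre q) \<le> ?E q * (sz (pre q) + dp_bound M 1 (xn (?X q)))" for q
  proof -
    have "sz (pre q) * 1 \<le> sz (pre q) * ?E q" by (rule mult_le_mono2[OF E])
    then show ?thesis using dp_bound_factor[OF E[of q], of M "xn (?X q)"] by (simp add: B_def pre_def algebra_simps)
  qed
  have ptX: "pt_on ?D ?X" by (intro pt)
  have "pb ?D (\<lambda>q. sz (pre q) + dp_bound M 1 (xn (?X q)))"
    by (intro pb_intros pt_sz[OF pt_pre] pb_dp_bound pb_frame[OF ptX])
  from computes_via[OF pt_pre f BE this E]
  obtain T R where TR0: "computes ?D (\<lambda>q. dp (fst (snd (pre q))) (fst (snd (snd (pre q)))) (snd (snd (snd (pre q))))) T \<and>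
    (\<forall>q\<in>?D. T q \<le> ?E q ^ a * R q) \<and> pb ?D R" by (elim exE) (rule that)
  then have TR: "T q \<le> ?E q ^ a * R q" if "q \<in> ?D" for q using that by blast
  have pbR: "pb ?D R" using TR0 by blast
  have xs: "computes ?D tail_states T"
    using TR0[THEN conjunct1] by (rule computes_mono) (auto simp: tail_states_def pre_def)
  obtain e where e: "computes {p. gX p \<in> frames \<mu> M g h} (leaf m) (\<lambda>p. sz p ^ e * oracle_time ot (gX p))"
    using leaf_time[OF M orc] by blast
  have P: "computes {p. snd p \<in> ?D \<and> fst p \<in> set (tail_states (snd p))} (\<lambda>p. leaf m (fst p, snd p))
      (\<lambda>p. sz p ^ e * oracle_time ot (?X (snd p)))"
    using e by (rule computes_mono) auto
  show ?thesis
  proof (rule computes_search[OF xs P TR pbR, where Y = "\<lambda>q. xn (?X q) + 1" and Z = "\<lambda>q. state_bound M (xn (?X q))"])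
    show "pb ?D (\<lambda>q. xn (?X q) + 1)" by (intro pb_intros pb_frame[OF ptX])
    show "pb ?D (\<lambda>q. state_bound M (xn (?X q)))" unfolding state_bound_def by (intro pb_intros pb_frame[OF ptX])
  qed (use sys E in simp_all)
qed

lemma vector_search_time:
  assumes a: "\<forall>D B. (\<forall>c\<in>D. sz c \<le> B c \<and> (\<forall>i\<le>length (dn (snd c)). sz (fold (\<lambda>_ L. concat (map (\<lambda>x. map (\<lambda>g. x # g) L) (fst c)))
      (take i (dn (snd c))) [[]]) \<le> B c))
    \<longrightarrow> computes D (\<lambda>c. vectors (fst c) (snd c)) (\<lambda>c. B c ^ a)"
    and P: "computes {q. snd (snd q) \<in> F} (\<lambda>q. P (fst q) (snd q)) (\<lambda>q. sz q ^ e * W (snd (snd q)))" and W: "\<And>X. 1 \<le> W X"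
  shows "\<exists>e. computes {q :: nat list \<times> frame. snd q \<in> F} (\<lambda>q. \<exists>gv\<in>set (vectors (choices m) (xr (snd q))). P gv q)
    (\<lambda>q. sz q ^ e * ((length (choices m) ^ xr (snd q)) ^ a * length (choices m) ^ xr (snd q) * W (snd q)))"
proof -
  let ?D = "{q :: nat list \<times> frame. snd q \<in> F}"
  let ?o = "length (choices m)"
  let ?E = "\<lambda>q :: nat list \<times> frame. ?o ^ xr (snd q)"
  have o: "1 \<le> ?o" unfolding length_choices by simp
  define pre where "pre = (\<lambda>q :: nat list \<times> frame. (choices m, xr (snd q)))"
  have pt_pre: "pt_on ?D pre" unfolding pre_def by (intro pt)
  define B where "B = (\<lambda>c :: (bool \<times> nat \<times> nat) list \<times> nat. sz c + (2 + ?o ^ snd c * (2 + snd c * (4 * m + 8))))"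
  have "sz c \<le> B c \<and> (\<forall>i\<le>length (dn (snd c)). sz (fold (\<lambda>_ L. concat (map (\<lambda>x. map (\<lambda>g. x # g) L) (fst c)))
      (take i (dn (snd c))) [[]]) \<le> B c)" if "c \<in> pre ` ?D" for c
  proof (intro conjI allI impI)
    have c: "fst c = choices m" using that by (auto simp: pre_def)
    show "sz c \<le> B c" by (simp add: B_def)
    fix i assume i: "i \<le> length (dn (snd c))"
    let ?L = "fold (\<lambda>_ L. concat (map (\<lambda>x. map (\<lambda>g. x # g) L) (choices m))) (take i (dn (snd c))) [[]]"
    have "sz g \<le> 2 + snd c * (4 * m + 8)" if "g \<in> set ?L" for g
    proof -
      have "sz g \<le> 2 + length (take i (dn (snd c))) * (4 * m + 8)" by (rule sz_vector[OF sz_choice that])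
      also have "\<dots> \<le> 2 + snd c * (4 * m + 8)" by (intro add_mono mult_le_mono) auto
      finally show ?thesis .
    qed
    then have "sz ?L \<le> 2 + length ?L * (2 + snd c * (4 * m + 8))" by (rule sz_list_le)
    also have "\<dots> \<le> 2 + ?o ^ snd c * (2 + snd c * (4 * m + 8))"
      unfolding vectors_iterate using o by (intro add_mono mult_le_mono power_increasing) auto
    finally show "sz (fold (\<lambda>_ L. concat (map (\<lambda>x. map (\<lambda>g. x # g) L) (fst c))) (take i (dn (snd c))) [[]]) \<le> B c"
      unfolding c B_def by simp
  qed
  then have f: "computes (pre ` ?D) (\<lambda>c. vectors (fst c) (snd c)) (\<lambda>c. B c ^ a)"
    by (intro a[THEN spec, THEN spec, THEN mp]) blast
  have E: "1 \<le> ?E q" for q using o by simp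
  have BE: "B (pre q) \<le> ?E q * (sz (pre q) + (2 + (2 + xr (snd q) * (4 * m + 8))))" for q
  proof -
    have "(sz (pre q) + 2) * 1 \<le> (sz (pre q) + 2) * ?E q" by (rule mult_le_mono2[OF E])
    then show ?thesis by (simp add: B_def pre_def algebra_simps)
  qed
  have ptX: "pt_on ?D snd" by (rule pt_snd[OF pt_id])
  have "pb ?D (\<lambda>q. sz (pre q) + (2 + (2 + xr (snd q) * (4 * m + 8))))"
    by (intro pb_intros pt_sz[OF pt_pre] pb_frame[OF ptX])
  from computes_via[OF pt_pre f BE this E]
  obtain T R where TR0: "computes ?D (\<lambda>q. vectors (fst (pre q)) (snd (pre q))) T \<and>
    (\<forall>q\<in>?D. T q \<le> ?E q ^ a * R q) \<and> pb ?D R" by (elim exE) (rule that)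
  then have TR: "T q \<le> ?E q ^ a * R q" if "q \<in> ?D" for q using that by blast
  have pbR: "pb ?D R" using TR0 by blast
  have xs: "computes ?D (\<lambda>q. vectors (choices m) (xr (snd q))) T"
    using TR0[THEN conjunct1] by (simp add: pre_def)
  have P': "computes {p. snd p \<in> ?D \<and> fst p \<in> set (vectors (choices m) (xr (snd (snd p))))} (\<lambda>q. P (fst q) (snd q))
      (\<lambda>p. sz p ^ e * W (snd (snd p)))"
    using P by (rule computes_mono) auto
  have el: "sz gv \<le> 2 + xr (snd q) * (4 * m + 8)" if "gv \<in> set (vectors (choices m) (xr (snd q)))" for gv q
    using sz_vector[OF sz_choice that[unfolded vectors_def]] by simp
  have len: "length (vectors (choices m) (xr (snd q))) \<le> ?E q * 1" for q :: "nat list \<times> frame"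
    unfolding vectors_def vectors_iterate by simp
  show ?thesis
  proof (rule computes_search[OF xs P' TR pbR len _ el])
    show "pb ?D (\<lambda>_. 1)" by (rule pb_const)
    show "pb ?D (\<lambda>q. 2 + xr (snd q) * (4 * m + 8))" by (intro pb_intros pb_frame[OF ptX])
  qed (use E W in simp_all)
qed

lemma label_search_time:
  assumes a: "\<forall>D B. (\<forall>c\<in>D. sz c \<le> B c \<and> (\<forall>i\<le>length (fst c). sz (fold (\<lambda>_ L. if \<exists>lab\<in>set L. length (fst c) \<le> length lab then L
      else double_labels (snd c) L) (take i (fst c)) [[0]]) \<le> B c))
    \<longrightarrow> computes D (\<lambda>c. labels (fst c) (snd c)) (\<lambda>c. B c ^ a)"
    and P: "computes {q. snd q \<in> F} (\<lambda>q. P (fst q) (snd q)) (\<lambda>q. sz q ^ e * W (snd q))" and W: "\<And>X. 1 \<le> W X"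
    and r: "\<And>X. X \<in> F \<Longrightarrow> 0 < xr X"
  shows "\<exists>e. computes F (\<lambda>X. \<exists>lab\<in>set (labels (xI X) (xr X)). P lab X)
    (\<lambda>X. sz X ^ e * (label_count (xr X) (length (xI X)) ^ a * label_count (xr X) (length (xI X)) * W X))"
proof -
  let ?E = "\<lambda>X. label_count (xr X) (length (xI X))"
  let ?Z = "\<lambda>X. 2 + (2 * length (xI X) + 1) * (2 * xr X + 2)"
  define pre where "pre = (\<lambda>X :: frame. (xI X, xr X))"
  have pt_pre: "pt_on F pre" unfolding pre_def by (intro pt)
  define B where "B = (\<lambda>c :: nat list list \<times> nat. sz c + (2 + label_count (snd c) (length (fst c)) *
    (2 + (2 * length (fst c) + 1) * (2 * snd c + 2))))"
  have "sz c \<le> B c \<and> (\<forall>i\<le>length (fst c). sz (fold (\<lambda>_ L. if \<exists>lab\<in>set L. length (fst c) \<le> length lab then L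
      else double_labels (snd c) L) (take i (fst c)) [[0]]) \<le> B c)" if "c \<in> pre ` F" for c
  proof (intro conjI allI impI)
    have c: "0 < snd c" using that r by (auto simp: pre_def)
    show "sz c \<le> B c" by (simp add: B_def)
    fix i
    obtain l where "good_labels (snd c) l (fold (\<lambda>_ L. if \<exists>lab\<in>set L. length (fst c) \<le> length lab then L
      else double_labels (snd c) L) (take i (fst c)) [[0]])" "l = 0 \<or> 2 ^ (l - 1) < length (fst c)"
      using labels_iterate[OF c] by blast
    from good_labels_size(3)[OF this] show "sz (fold (\<lambda>_ L. if \<exists>lab\<in>set L. length (fst c) \<le> length lab then L
      else double_labels (snd c) L) (take i (fst c)) [[0]]) \<le> B c" by (simp add: B_def)
  qed
  then have f: "computes (pre ` F) (\<lambda>c. labels (fst c) (snd c)) (\<lambda>c. B c ^ a)"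
    by (intro a[THEN spec, THEN spec, THEN mp]) blast
  have E: "1 \<le> ?E X" for X using label_count_ge[of 0 "length (xI X)" "xr X"] by simp
  have BE: "B (pre X) \<le> ?E X * (sz (pre X) + (2 + ?Z X))" for X
  proof -
    have "(sz (pre X) + 2) * 1 \<le> (sz (pre X) + 2) * ?E X" by (rule mult_le_mono2[OF E])
    then show ?thesis by (simp add: B_def pre_def algebra_simps)
  qed
  have ptX: "pt_on F (\<lambda>X. X)" by (rule pt_id)
  have "pb F (\<lambda>X. sz (pre X) + (2 + ?Z X))"
    by (intro pb_intros pt_sz[OF pt_pre] pb_frame[OF ptX])
  from computes_via[OF pt_pre f BE this E]
  obtain T R where TR0: "computes F (\<lambda>X. labels (fst (pre X)) (snd (pre X))) T \<and>
    (\<forall>q\<in>F. T q \<le> ?E q ^ a * R q) \<and> pb F R" by (elim exE) (rule that)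
  then have TR: "T q \<le> ?E q ^ a * R q" if "q \<in> F" for q using that by blast
  have pbR: "pb F R" using TR0 by blast
  have xs: "computes F (\<lambda>X. labels (xI X) (xr X)) T" using TR0[THEN conjunct1] by (simp add: pre_def)
  have P': "computes {p. snd p \<in> F \<and> fst p \<in> set (labels (xI (snd p)) (xr (snd p)))} (\<lambda>q. P (fst q) (snd q))
      (\<lambda>p. sz p ^ e * W (snd p))"
    using P by (rule computes_mono) auto
  have sz: "length (labels (xI X) (xr X)) \<le> ?E X * 1 \<and> (\<forall>lab\<in>set (labels (xI X) (xr X)). sz lab \<le> ?Z X)" if X: "X \<in> F" for X
  proof -
    obtain l where l: "good_labels (xr X) l (labels (xI X) (xr X))" "length (xI X) \<le> 2 ^ l" "l = 0 \<or> 2 ^ (l - 1) < length (xI X)"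
      by (rule labels_good[OF r[OF X]])
    show ?thesis using good_labels_size(1,2)[OF l(1,3)] by simp
  qed
  show ?thesis
  proof (rule computes_search[OF xs P' TR pbR, where Y = "\<lambda>_. 1" and Z = ?Z])
    show "pb F (\<lambda>_. 1)" by (rule pb_const)
    show "pb F ?Z" by (intro pb_intros pb_frame[OF ptX])
    show "\<And>X. X \<in> F \<Longrightarrow> length (labels (xI X) (xr X)) \<le> ?E X * 1" using sz by blast
    show "\<And>X lab. X \<in> F \<Longrightarrow> lab \<in> set (labels (xI X) (xr X)) \<Longrightarrow> sz lab \<le> ?Z X" using sz by blast
  qed (assumption, intro conjI one_le_power E W)
qed

text \<open>The order of the quantifiers is the point. \<open>a1\<close>, \<open>a2\<close> and
  \<open>a3\<close> come before all parameters, so that the parameters can be chosen to make the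
  powers small; only the polynomial exponent \<open>e\<close> may depend on them.\<close>

theorem search_time:
  "\<exists>a1 a2 a3. \<forall>\<mu> M g h m ot. 1 \<le> M \<longrightarrow> computes (sc_queries (m + 2)) sc_answer (\<lambda>z. ot (fst z)) \<longrightarrow>
    (\<exists>e. computes (frames \<mu> M g h) (search m) (\<lambda>X. sz X ^ e *
      (label_count (xr X) (length (xI X)) ^ (a1 + 1) * ((length (choices m) ^ xr X) ^ (a2 + 1) *
       (binsum (length (xQ X)) (xk X) ^ (a3 + 1) * oracle_time ot X)))))"
proof -
  obtain a1 where a1: "\<forall>D B. (\<forall>c\<in>D. sz c \<le> B c \<and> (\<forall>i\<le>length (fst c). sz (fold (\<lambda>_ L. if \<exists>lab\<in>set L. length (fst c) \<le> length lab then L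
      else double_labels (snd c) L) (take i (fst c)) [[0]]) \<le> B c))
    \<longrightarrow> computes D (\<lambda>c. labels (fst c) (snd c)) (\<lambda>c. B c ^ a1)" using labels_exponent by blast
  obtain a2 where a2: "\<forall>D B. (\<forall>c\<in>D. sz c \<le> B c \<and> (\<forall>i\<le>length (dn (snd c)). sz (fold (\<lambda>_ L. concat (map (\<lambda>x. map (\<lambda>g. x # g) L) (fst c)))
      (take i (dn (snd c))) [[]]) \<le> B c))
    \<longrightarrow> computes D (\<lambda>c. vectors (fst c) (snd c)) (\<lambda>c. B c ^ a2)" using vectors_exponent by blast
  obtain a3 where a3: "\<forall>D B. (\<forall>c\<in>D. sz (c :: nat \<times> nat list \<times> nat \<times> move list list) \<le> B c \<and>
      dp_bounded (fst (snd c)) (fst (snd (snd c))) (snd (snd (snd c))) (B c))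
    \<longrightarrow> computes D (\<lambda>c. dp (fst (snd c)) (fst (snd (snd c))) (snd (snd (snd c)))) (\<lambda>c. B c ^ a3)" using dp_exponent by blast
  have "\<exists>e. computes (frames \<mu> M g h) (search m) (\<lambda>X. sz X ^ e *
      (label_count (xr X) (length (xI X)) ^ (a1 + 1) * ((length (choices m) ^ xr X) ^ (a2 + 1) *
       (binsum (length (xQ X)) (xk X) ^ (a3 + 1) * oracle_time ot X))))"
    if M: "1 \<le> M" and orc: "computes (sc_queries (m + 2)) sc_answer (\<lambda>z. ot (fst z))" for \<mu> M g h m ot
  proof -
    let ?b = "\<lambda>X. binsum (length (xQ X)) (xk X)"
    obtain e2 where e2: "computes {q. snd (snd q) \<in> frames \<mu> M g h} (\<lambda>q. \<exists>s\<in>set (tail_states (fst q, snd q)). leaf m (s, fst q, snd q))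
      (\<lambda>q. sz q ^ e2 * (?b (snd (snd q)) ^ a3 * ?b (snd (snd q)) * oracle_time ot (snd (snd q))))"
      using tail_search_time[OF a3 M orc, of \<mu> g h] by auto
    have W2: "1 \<le> ?b X ^ a3 * ?b X * oracle_time ot X" for X
    proof -
      have "0 < ?b X ^ a3 * ?b X * oracle_time ot X" by (intro mult_pos_pos zero_less_power binsum_pos) simp
      then show ?thesis by linarith
    qed
    let ?o = "\<lambda>X. length (choices m) ^ xr X"
    obtain e1 where e1: "computes {q :: nat list \<times> frame. snd q \<in> frames \<mu> M g h}
        (\<lambda>q. \<exists>gv\<in>set (vectors (choices m) (xr (snd q))). \<exists>s\<in>set (tail_states (gv, q)). leaf m (s, gv, q))
      (\<lambda>q. sz q ^ e1 * (?o (snd q) ^ a2 * ?o (snd q) * (?b (snd q) ^ a3 * ?b (snd q) * oracle_time ot (snd q))))"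
      using vector_search_time[OF a2 e2 W2, of m] by auto
    then have e1': "computes {q :: nat list \<times> frame. snd q \<in> frames \<mu> M g h}
        (\<lambda>q. \<exists>gv\<in>set (vectors (choices m) (xr (snd q))). \<exists>s\<in>set (tail_states (gv, fst q, snd q)). leaf m (s, gv, fst q, snd q))
      (\<lambda>q. sz q ^ e1 * (?o (snd q) ^ a2 * ?o (snd q) * (?b (snd q) ^ a3 * ?b (snd q) * oracle_time ot (snd q))))" by simp
    have W1: "1 \<le> ?o X ^ a2 * ?o X * (?b X ^ a3 * ?b X * oracle_time ot X)" for X
    proof -
      have "0 < ?o X ^ a2 * ?o X * (?b X ^ a3 * ?b X * oracle_time ot X)"
        by (intro mult_pos_pos zero_less_power binsum_pos) (auto simp: length_choices)
      then show ?thesis by linarith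
    qed
    have r: "0 < xr X" if "X \<in> frames \<mu> M g h" for X using that by (auto simp: frames_def)
    have "\<exists>e. computes (frames \<mu> M g h) (\<lambda>X. \<exists>lab\<in>set (labels (xI X) (xr X)).
        \<exists>gv\<in>set (vectors (choices m) (xr X)). \<exists>s\<in>set (tail_states (gv, lab, X)). leaf m (s, gv, lab, X))
      (\<lambda>X. sz X ^ e * (label_count (xr X) (length (xI X)) ^ a1 * label_count (xr X) (length (xI X)) *
        (?o X ^ a2 * ?o X * (?b X ^ a3 * ?b X * oracle_time ot X))))"
      by (rule label_search_time[OF a1 e1' W1 r])
    then show ?thesis unfolding search_def[abs_def] by (simp add: mult.assoc mult.left_commute mult.commute)
  qed
  then show ?thesis by blast
qed

section \<open>The complete algorithm\<close>

text \<open>The input of a Triangle Packing program as nested pairs with the same encoding; flag and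
  number stand for the integer threshold.\<close>

type_synonym raw = "nat \<times> nat list list \<times> (bool \<times> nat) \<times> nat list \<times> unit"

lemma enc_natss_eq: "enc_natss xss = enc xss"
proof -
  have "enc_nats = enc" by (rule ext) (simp add: enc_nats_def enc_list' enc_nat'[abs_def])
  then show ?thesis by (simp add: enc_natss_def enc_list')
qed

lemma enc_nats_eq: "enc_nats xs = enc xs"
  by (simp add: enc_nats_def enc_list' enc_nat'[abs_def])

lemma enc_raw:
  "enc (n, Es, (t < 0, nat \<bar>t\<bar>), Qs, ()) = enc_list [enc_nat n, enc_natss Es, enc_int t, enc_nats Qs]"
  by (simp add: enc_Pair enc_unit_def enc_int_def enc_nat' enc_bool' enc_natss_eq enc_nats_eq)

lemma enc_query:
  "enc (m, Fs, (False, t), ()) = enc_list [enc_nat m, enc_natss Fs, enc_int (int t)]"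
  by (simp add: enc_Pair enc_unit_def enc_int_def enc_nat' enc_bool' enc_natss_eq)

text \<open>The given program itself serves as the subroutine; step counts are natural numbers, so
  its real bound may be rounded down.\<close>

lemma oracle_computes:
  assumes "solves_set_cover d A T"
  shows "computes (sc_queries d) sc_answer (\<lambda>z. nat \<lfloor>T (fst z)\<rfloor>)"
  unfolding computes_def
proof (intro exI[of _ A] ballI allI)
  fix z :: query and env assume z: "z \<in> sc_queries d"
  obtain m Fs b t where z': "z = (m, Fs, (b, t), ())" by (metis old.unit.exhaust prod.collapse)
  then have b: "\<not> b" and inst: "set_cover_instance d {..<m} (set ` set Fs)" "lists_family Fs (set ` set Fs)"
    using z by (auto simp: sc_queries_def)
  have "decides_within A (enc_list [enc_nat m, enc_natss Fs, enc_int (int t)]) (has_set_cover {..<m} (set ` set Fs) (int t)) (T m)"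
    using assms inst unfolding solves_set_cover_def by blast
  then obtain k where k: "eval [enc z] A (enc (sc_answer z)) k" "real k \<le> T m"
    unfolding decides_within_def using b by (auto simp: z' enc_query sc_answer_def enc_bool')
  have "eval (enc z # env) A (enc (sc_answer z)) k" by (rule eval_weaken[OF k(1) enc_data enc_data])
  moreover have "k \<le> nat \<lfloor>T (fst z)\<rfloor>" using k(2) by (simp add: z' le_nat_floor)
  ultimately show "runs (enc z # env) A (enc (sc_answer z)) (nat \<lfloor>T (fst z)\<rfloor>)" unfolding runs_def by blast
qed

text \<open>
  The threshold may be arbitrarily larger than the graph, so it is cut off at one more than the
  number of vertices in time independent of its size.
\<close>

definition ct :: "('a::enc \<Rightarrow> 'b::enc) \<Rightarrow> bool" where
  "ct f \<longleftrightarrow> (\<exists>K. computes UNIV f (\<lambda>_. K))"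

lemma ct_id: "ct (\<lambda>c. c)" and ct_const: "ct (\<lambda>_. k)"
  unfolding ct_def using computes_id computes_const by blast+

lemma ct_comp:
  assumes "ct g" "ct f"
  shows "ct (\<lambda>c. g (f c))"
proof -
  obtain K1 K2 where K: "computes UNIV g (\<lambda>_. K1)" "computes UNIV f (\<lambda>_. K2)"
    using assms unfolding ct_def by auto
  have "computes UNIV (\<lambda>c. g (f c)) (\<lambda>_. K2 + K1 + 2)" using computes_comp[OF K(2,1)] by simp
  then show ?thesis unfolding ct_def by (rule exI)
qed

lemma ct_fst: "ct f \<Longrightarrow> ct (\<lambda>c. fst (f c))" and ct_snd: "ct f \<Longrightarrow> ct (\<lambda>c. snd (f c))"
  and ct_tl: "ct f' \<Longrightarrow> ct (\<lambda>c. tl (f' c))" and ct_null: "ct f' \<Longrightarrow> ct (\<lambda>c. f' c = [])"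
  by (rule ct_comp[of fst] ct_comp[of snd] ct_comp[of tl] ct_comp[of "\<lambda>xs. xs = []"];
      auto simp: ct_def intro: computes_fst computes_snd computes_tl computes_Nil)+

lemma ct_Pair:
  assumes "ct f" "ct g"
  shows "ct (\<lambda>c. (f c, g c))"
proof -
  obtain K1 K2 where K: "computes UNIV f (\<lambda>_. K1)" "computes UNIV g (\<lambda>_. K2)"
    using assms unfolding ct_def by auto
  have "computes UNIV (\<lambda>c. (f c, g c)) (\<lambda>_. K1 + K2 + 1)" using computes_Pair[OF K] by simp
  then show ?thesis unfolding ct_def by (rule exI)
qed

lemma ct_recode: "ct f \<Longrightarrow> (\<And>c. enc (f' c) = enc (f c)) \<Longrightarrow> ct f'"
  unfolding ct_def using computes_recode by blast

lemma ct_if: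
  assumes "ct b" "ct f" "ct g"
  shows "ct (\<lambda>c. if b c then f c else g c)"
proof -
  obtain K1 K2 K3 where K: "computes UNIV b (\<lambda>_. K1)" "computes UNIV f (\<lambda>_. K2)" "computes UNIV g (\<lambda>_. K3)"
    using assms unfolding ct_def by blast
  have "computes UNIV (\<lambda>c. if b c then f c else g c) (\<lambda>c. K1 + (if b c then K2 else K3) + 5)"
    by (rule computes_if[OF K(1) computes_mono[OF K(2)] computes_mono[OF K(3)]]) auto
  then have "computes UNIV (\<lambda>c. if b c then f c else g c) (\<lambda>_. K1 + (K2 + K3) + 5)"
    by (rule computes_mono) auto
  then show ?thesis unfolding ct_def by blast
qed

definition cut :: "raw \<Rightarrow> nat \<times> nat list list \<times> nat \<times> nat list" where
  "cut c = (fst c, fst (snd c), min (snd (fst (snd (snd c)))) (Suc (fst c)), fst (snd (snd (snd c))))"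

lemma fold_cut:
  "fold (\<lambda>_ s. if fst s = [] then s else (tl (fst s), Suc (snd s))) xs (replicate t (), a)
    = (replicate (t - length xs) (), a + min t (length xs))"
proof (induction xs arbitrary: t a)
  case (Cons x xs)
  show ?case using Cons.IH[of 0] by (cases t) (simp_all add: Cons.IH)
qed simp

text \<open>The polynomial-time rules would give a bound in the size of the whole input, which
  includes the threshold. Instead each round of a loop of length \<open>n + 1\<close> removes one
  unit from the threshold in constant time.\<close>

lemma cut_time: "\<exists>K. computes UNIV cut (\<lambda>c. (fst c + 3) * K)"
proof -
  have step: "ct (\<lambda>p :: unit \<times> (unit list \<times> nat) \<times> raw.
      if fst (fst (snd p)) = [] then fst (snd p) else (tl (fst (fst (snd p))), Suc (snd (fst (snd p)))))"
  proof (intro ct_if ct_null ct_fst ct_snd ct_Pair ct_tl ct_id)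
    show "ct (\<lambda>p :: unit \<times> (unit list \<times> nat) \<times> raw. Suc (snd (fst (snd p))))"
      by (rule ct_recode[of "\<lambda>p. ((), snd (fst (snd p)))"], intro ct_Pair ct_const ct_snd ct_fst ct_id)
        (simp add: enc_Suc enc_Pair enc_unit_def)
  qed
  then obtain K where K: "computes UNIV (\<lambda>p :: unit \<times> (unit list \<times> nat) \<times> raw.
      if fst (fst (snd p)) = [] then fst (snd p) else (tl (fst (fst (snd p))), Suc (snd (fst (snd p))))) (\<lambda>_. K)"
    unfolding ct_def by blast
  have "ct (\<lambda>c :: raw. Suc (fst c))"
    by (rule ct_recode[of "\<lambda>c. ((), fst c)"], intro ct_Pair ct_const ct_fst ct_id) (simp add: enc_Suc enc_Pair enc_unit_def)
  then have "ct (\<lambda>c :: raw. replicate (Suc (fst c)) ())" by (rule ct_recode) (rule enc_replicate_unit)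
  then obtain K1 where K1: "computes UNIV (\<lambda>c :: raw. replicate (Suc (fst c)) ()) (\<lambda>_. K1)" unfolding ct_def by blast
  have "ct (\<lambda>c :: raw. snd (fst (snd (snd c))))" by (intro ct_fst ct_snd ct_id)
  then have "ct (\<lambda>c :: raw. replicate (snd (fst (snd (snd c)))) ())" by (rule ct_recode) (rule enc_replicate_unit)
  then have "ct (\<lambda>c :: raw. (replicate (snd (fst (snd (snd c)))) (), 0 :: nat))" by (rule ct_Pair[OF _ ct_const])
  then obtain K2 where K2: "computes UNIV (\<lambda>c :: raw. (replicate (snd (fst (snd (snd c)))) (), 0 :: nat)) (\<lambda>_. K2)" unfolding ct_def by blast
  have "computes UNIV (\<lambda>c :: raw. fold (\<lambda>_ s. if fst s = [] then s else (tl (fst s), Suc (snd s))) (replicate (Suc (fst c)) ())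
      (replicate (snd (fst (snd (snd c)))) (), 0)) (\<lambda>c. K1 + K2 + (length (replicate (Suc (fst c)) ()) + 1) * (K + 30))"
    using computes_fold[OF K1 K2 K, of "\<lambda>_. K", unfolded fst_conv snd_conv] by simp
  from computes_comp[OF this computes_snd]
  have m: "computes UNIV (\<lambda>c :: raw. min (snd (fst (snd (snd c)))) (Suc (fst c))) (\<lambda>c. K1 + K2 + (fst c + 2) * (K + 30) + 5)"
    unfolding fold_cut by (auto elim: computes_mono)
  have "ct (\<lambda>c :: raw. fst c)" "ct (\<lambda>c :: raw. fst (snd c))" "ct (\<lambda>c :: raw. fst (snd (snd (snd c))))" by (intro ct_fst ct_snd ct_id)+
  then obtain K3 K4 K5 where K3: "computes UNIV (\<lambda>c :: raw. fst c) (\<lambda>_. K3)" "computes UNIV (\<lambda>c :: raw. fst (snd c)) (\<lambda>_. K4)"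
    "computes UNIV (\<lambda>c :: raw. fst (snd (snd (snd c)))) (\<lambda>_. K5)" unfolding ct_def by blast
  have "computes UNIV cut (\<lambda>c. K3 + (K4 + (K1 + K2 + (fst c + 2) * (K + 30) + 5 + K5 + 1) + 1) + 1)"
    unfolding cut_def[abs_def] by (intro computes_Pair K3 m)
  then have "computes UNIV cut (\<lambda>c. (fst c + 3) * (K3 + K4 + K5 + K1 + K2 + K + 50))"
    by (rule computes_mono) (auto simp: algebra_simps)
  then show ?thesis by blast
qed

definition prep :: "nat \<Rightarrow> nat \<Rightarrow> nat \<times> nat list list \<times> nat \<times> nat list \<Rightarrow> frame" where
  "prep g h c = (fst c, fst (snd (snd c)), snd (snd (snd c)), classes (fst c) (fst (snd c)) (snd (snd (snd c))),
     dedup (map fst (classes (fst c) (fst (snd c)) (snd (snd (snd c))))),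
     length (snd (snd (snd c))) div g + 1, length (snd (snd (snd c))) div h)"

lemma pt_prep: "0 < g \<Longrightarrow> 0 < h \<Longrightarrow> pt_on D (prep g h)"
  unfolding prep_def[abs_def] by (intro pt pt_div_const)

context hub_instance
begin

lemma class_system_loc: "class_system_loc n Qs (\<delta> + 3) (2 ^ (\<sigma> + \<delta> + 3)) (set (tris n Es)) (classes n Es Qs)"
  by unfold_locales (use class_system_classes distinct_Qs set_Qs Q_subset in auto)

text \<open>A packing has at most \<open>n\<close> triangles, because each occupies a vertex of its
  own. Cutting the threshold at \<open>n + 1\<close> therefore preserves the answer.\<close>

lemma packing_iff:
  "has_triangle_packing {..<n} E t \<longleftrightarrow> t \<le> 0 \<or> (\<exists>Y\<subseteq>set (tris n Es). packs Y \<and> min (nat t) (Suc n) \<le> card Y)"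
proof -
  interpret class_system_loc n Qs "\<delta> + 3" "2 ^ (\<sigma> + \<delta> + 3)" "set (tris n Es)" "classes n Es Qs"
    by (rule class_system_loc)
  have le: "card Y \<le> n" if Y: "Y \<subseteq> set (tris n Es)" "packs Y" for Y
  proof -
    have "set x \<inter> {..<n} \<noteq> {}" if "x \<in> Y" for x
      using tri[of x] tri_ne[of x] subsetD[OF Y(1) that] by (simp add: Int_absorb2)
    then have "card Y \<le> card {..<n}"
      by (intro packs_card_le[OF Y(2)] finite_subset[OF Y(1)]) simp_all
    then show ?thesis by simp
  qed
  have disj: "pairwise disjnt (set ` Y) \<longleftrightarrow> packs Y" if "Y \<subseteq> set (tris n Es)" for Y
  proof -
    have "set x = set y \<longleftrightarrow> x = y" if "x \<in> Y" "y \<in> Y" for x y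
      using inj_on_eq_iff[OF inj_on_subset[OF inj_TL \<open>Y \<subseteq> set (tris n Es)\<close>] that] .
    then show ?thesis unfolding packs_def pairwise_def by simp
  qed
  have "has_triangle_packing {..<n} E t \<longleftrightarrow> (\<exists>Y\<subseteq>set (tris n Es). packs Y \<and> t \<le> int (card Y))"
  proof
    assume "has_triangle_packing {..<n} E t"
    then obtain P where P: "P \<subseteq> set ` set (tris n Es)" "pairwise disjnt P" "t \<le> int (card P)"
      unfolding has_triangle_packing_def triangles_eq by blast
    then obtain Y where Y: "Y \<subseteq> set (tris n Es)" "P = set ` Y" by (auto simp: subset_image_iff)
    then show "\<exists>Y\<subseteq>set (tris n Es). packs Y \<and> t \<le> int (card Y)"
      using P disj[OF Y(1)] card_image[OF inj_on_subset[OF inj_TL Y(1)]] by auto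
  next
    assume "\<exists>Y\<subseteq>set (tris n Es). packs Y \<and> t \<le> int (card Y)"
    then obtain Y where Y: "Y \<subseteq> set (tris n Es)" "packs Y" "t \<le> int (card Y)" by blast
    then show "has_triangle_packing {..<n} E t"
      unfolding has_triangle_packing_def triangles_eq
      using disj[OF Y(1)] card_image[OF inj_on_subset[OF inj_TL Y(1)]] by (intro exI[of _ "set ` Y"]) auto
  qed
  also have "\<dots> \<longleftrightarrow> t \<le> 0 \<or> (\<exists>Y\<subseteq>set (tris n Es). packs Y \<and> min (nat t) (Suc n) \<le> card Y)"
  proof (cases "t \<le> 0")
    case True
    then show ?thesis by (auto intro!: exI[of _ "{}"] simp: packs_def)
  next
    case False
    have "t \<le> int (card Y) \<longleftrightarrow> min (nat t) (Suc n) \<le> card Y" if "Y \<subseteq> set (tris n Es)" "packs Y" for Y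
      using le[OF that] by linarith
    then show ?thesis using False by auto
  qed
  finally show ?thesis .
qed

text \<open>Edges and hub vertices are listed without repetition, so after the cut the input is
  polynomial in \<open>n\<close>; this converts powers of the input size into powers of
  \<open>n\<close>.\<close>

lemma sz_input:
  assumes "t \<le> Suc n"
  shows "sz (n, Es, t, Qs) \<le> (2 * n + 2) + ((2 + n * n * (4 * n + 6)) + ((2 * n + 4) + (2 + n * (2 * n + 2))))"
proof -
  have Es': "\<exists>a b. xs = [a, b] \<and> a < n \<and> b < n" if "xs \<in> set Es" for xs
  proof -
    have "distinct xs" "set xs \<in> E" using Es that by (auto simp: lists_family_def lists_set_def)
    then have "length xs = 2" "set xs \<subseteq> {..<n}" using graph distinct_card[of xs] by (auto simp: simple_graph_def)
    then show ?thesis by (auto simp: numeral_2_eq_2 length_Suc_conv)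
  qed
  have "distinct Es" using Es by (simp add: lists_family_def lists_set_def distinct_map)
  then have "length Es = card (set Es)" by (simp add: distinct_card)
  also have "\<dots> \<le> card ((\<lambda>p. [fst p, snd p]) ` ({..<n} \<times> {..<n}))"
    by (rule card_mono) (use Es' in \<open>force simp: image_iff\<close>)+
  also have "\<dots> \<le> card ({..<n} \<times> {..<n})" by (rule card_image_le) simp
  finally have "length Es \<le> n * n" by (simp add: card_cartesian_product)
  moreover have "sz Es \<le> 2 + length Es * (4 * n + 6)"
    by (rule sz_list_le) (use Es' in fastforce)
  ultimately have "sz Es \<le> 2 + n * n * (4 * n + 6)" by (meson add_left_mono le_trans mult_le_mono1)
  moreover have "length Qs \<le> n"
    using card_mono[OF _ Q_subset] distinct_card[OF distinct_Qs] set_Qs by simp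
  then have "2 + length Qs * (2 * n + 2) \<le> 2 + n * (2 * n + 2)" by (intro add_left_mono mult_le_mono1)
  moreover have "sz Qs \<le> 2 + length Qs * (2 * n + 2)"
    by (rule sz_list_le) (use Q_subset set_Qs in auto)
  ultimately show ?thesis using assms by simp
qed

end

definition answer :: "nat \<Rightarrow> nat \<Rightarrow> nat \<Rightarrow> raw \<Rightarrow> bool" where
  "answer g h m c \<longleftrightarrow> (if fst (fst (snd (snd c))) then True else search m (prep g h (cut c)))"

text \<open>\<open>N\<close> is the number of keys. \<open>\<sigma>\<close> occurs in none of the
  exponential factors and can influence the bound through \<open>e\<close> alone.\<close>

theorem main_algorithm:
  "\<exists>a1 a2 a3. \<forall>\<sigma> \<delta> g h m ot. 0 < g \<longrightarrow> 0 < h \<longrightarrow> m = 9 * h * (\<delta> + 3 + g) \<longrightarrow>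
    computes (sc_queries (m + 2)) sc_answer (\<lambda>z. ot (fst z)) \<longrightarrow>
    (\<exists>A e. \<forall>n E t Q Es Qs. hub_instance \<sigma> \<delta> n E Q Es Qs \<longrightarrow>
      (\<exists>k N r. r = card Q div g + 1 \<and> N \<le> (card Q + 1) ^ (\<delta> + 3) \<and>
        eval [enc_list [enc_nat n, enc_natss Es, enc_int t, enc_nats Qs]] A (enc_bool (has_triangle_packing {..<n} E t)) k \<and>
        k \<le> (2 * n + 2) ^ e * (label_count r N ^ (a1 + 1) * ((length (choices m) ^ r) ^ (a2 + 1) *
          (binsum (card Q) (card Q div h) ^ (a3 + 1) * (ot (card Q + r + r) + 1))))))"
proof -
  obtain a1 a2 a3 where st: "\<forall>\<mu> M g h m ot. 1 \<le> M \<longrightarrow> computes (sc_queries (m + 2)) sc_answer (\<lambda>z. ot (fst z)) \<longrightarrow>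
    (\<exists>e. computes (frames \<mu> M g h) (search m) (\<lambda>X. sz X ^ e *
      (label_count (xr X) (length (xI X)) ^ (a1 + 1) * ((length (choices m) ^ xr X) ^ (a2 + 1) *
       (binsum (length (xQ X)) (xk X) ^ (a3 + 1) * oracle_time ot X)))))"
    using search_time by blast
  show ?thesis
  proof (rule exI[of _ a1], rule exI[of _ a2], rule exI[of _ a3], intro allI impI)
    fix \<sigma> \<delta> g h m :: nat and ot :: "nat \<Rightarrow> nat"
    assume g: "0 < g" and h: "0 < h" and m: "m = 9 * h * (\<delta> + 3 + g)"
      and orc: "computes (sc_queries (m + 2)) sc_answer (\<lambda>z. ot (fst z))"
    let ?F = "frames (\<delta> + 3) (2 ^ (\<sigma> + \<delta> + 3)) g h"
    define cost where "cost = (\<lambda>X. label_count (xr X) (length (xI X)) ^ (a1 + 1) * ((length (choices m) ^ xr X) ^ (a2 + 1) *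
       (binsum (length (xQ X)) (xk X) ^ (a3 + 1) * oracle_time ot X)))"
    have "\<exists>e. computes ?F (search m) (\<lambda>X. sz X ^ e * cost X)"
      unfolding cost_def by (rule st[rule_format, OF _ orc]) simp
    then obtain e1 where e1: "computes ?F (search m) (\<lambda>X. sz X ^ e1 * cost X)" ..
    define D where "D = {c :: raw. \<exists>E Q. hub_instance \<sigma> \<delta> (fst c) E Q (fst (snd c)) (fst (snd (snd (snd c))))}"
    obtain e2 where e2: "computes (UNIV :: (nat \<times> nat list list \<times> nat \<times> nat list) set) (prep g h) (\<lambda>c. sz c ^ e2)"
      using pt_time[OF pt_prep[OF g h]] by blast
    obtain e3 where e3: "\<And>c :: nat \<times> nat list list \<times> nat \<times> nat list. sz (prep g h c) \<le> sz c ^ e3"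
      using pt_sz[OF pt_prep[OF g h, of UNIV]] unfolding pb_def by blast
    obtain K where K: "computes UNIV cut (\<lambda>c. (fst c + 3) * K)" using cut_time by blast
    have frame: "prep g h (cut c) \<in> ?F" if "c \<in> D" for c
    proof -
      obtain E Q where "hub_instance \<sigma> \<delta> (fst c) E Q (fst (snd c)) (fst (snd (snd (snd c))))" using \<open>c \<in> D\<close> unfolding D_def by blast
      from hub_instance.class_system_loc[OF this] show ?thesis by (auto simp: frames_def prep_def cut_def)
    qed
    have "computes D (\<lambda>c. prep g h (cut c)) (\<lambda>c. (fst c + 3) * K + sz (cut c) ^ e2 + 2)"
      by (rule computes_comp[OF computes_mono[OF K] e2]) auto
    from computes_comp[OF this e1 frame]
    have s: "computes D (\<lambda>c. search m (prep g h (cut c)))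
      (\<lambda>c. (fst c + 3) * K + sz (cut c) ^ e2 + 2 + sz (prep g h (cut c)) ^ e1 * cost (prep g h (cut c)) + 2)" .
    have "ct (\<lambda>c :: raw. fst (fst (snd (snd c))))" by (intro ct_fst ct_snd ct_id)
    then obtain K1 where "computes UNIV (\<lambda>c :: raw. fst (fst (snd (snd c)))) (\<lambda>_. K1)" unfolding ct_def by blast
    then have K1: "computes D (\<lambda>c :: raw. fst (fst (snd (snd c)))) (\<lambda>_. K1)" by (rule computes_mono) auto
    have "computes D (answer g h m) (\<lambda>c. K1 + (if fst (fst (snd (snd c))) then sz True else
      (fst c + 3) * K + sz (cut c) ^ e2 + 2 + sz (prep g h (cut c)) ^ e1 * cost (prep g h (cut c)) + 2) + 5)"
      unfolding answer_def[abs_def] by (rule computes_if[OF K1 computes_const computes_mono[OF s]]) auto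
    then obtain A where A: "\<And>c env. c \<in> D \<Longrightarrow> runs (enc c # env) A (enc (answer g h m c))
      (K1 + (if fst (fst (snd (snd c))) then sz True else
      (fst c + 3) * K + sz (cut c) ^ e2 + 2 + sz (prep g h (cut c)) ^ e1 * cost (prep g h (cut c)) + 2) + 5)"
      unfolding computes_def by blast
    define q where "q = (\<lambda>n::nat. (2 * n + 2) + ((2 + n * n * (4 * n + 6)) + ((2 * n + 4) + (2 + n * (2 * n + 2)))))"
    have idpb: "pb UNIV (\<lambda>n::nat. n)" by (rule pb_mono[OF pb_sz]) auto
    have "pb UNIV (\<lambda>n::nat. K1 + (n + 3) * K + q n ^ e2 + (q n ^ e3) ^ e1 + 20)"
      unfolding q_def by (intro pb_intros idpb)
    then obtain e where e: "\<And>n::nat. K1 + (n + 3) * K + q n ^ e2 + (q n ^ e3) ^ e1 + 20 \<le> (2 * n + 2) ^ e"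
      unfolding pb_def by auto
    show "\<exists>A e. \<forall>n E t Q Es Qs. hub_instance \<sigma> \<delta> n E Q Es Qs \<longrightarrow>
      (\<exists>k N r. r = card Q div g + 1 \<and> N \<le> (card Q + 1) ^ (\<delta> + 3) \<and>
        eval [enc_list [enc_nat n, enc_natss Es, enc_int t, enc_nats Qs]] A (enc_bool (has_triangle_packing {..<n} E t)) k \<and>
        k \<le> (2 * n + 2) ^ e * (label_count r N ^ (a1 + 1) * ((length (choices m) ^ r) ^ (a2 + 1) *
          (binsum (card Q) (card Q div h) ^ (a3 + 1) * (ot (card Q + r + r) + 1)))))"
    proof (rule exI[of _ A], rule exI[of _ e], intro allI impI)
      fix n E t Q Es Qs assume hi: "hub_instance \<sigma> \<delta> n E Q Es Qs"
      interpret hub_instance \<sigma> \<delta> n E Q Es Qs by (rule hi)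
      define c :: raw where "c = (n, Es, (t < 0, nat \<bar>t\<bar>), Qs, ())"
      have cD: "c \<in> D" using hi by (auto simp: D_def c_def)
      have cut: "cut c = (n, Es, min (nat \<bar>t\<bar>) (Suc n), Qs)" by (simp add: cut_def c_def)
      let ?X = "prep g h (cut c)"
      have X: "xn ?X = n" "xt ?X = min (nat \<bar>t\<bar>) (Suc n)" "xQ ?X = Qs" "xc ?X = classes n Es Qs"
        "xI ?X = dedup (map fst (classes n Es Qs))" "xr ?X = card Q div g + 1" "xk ?X = card Q div h"
        using distinct_card[OF distinct_Qs] by (simp_all add: prep_def cut set_Qs)
      have len: "length Qs = card Q" using distinct_card[OF distinct_Qs] set_Qs by simp
      have ans: "answer g h m c \<longleftrightarrow> has_triangle_packing {..<n} E t"
      proof (cases "t < 0")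
        case True
        then show ?thesis using packing_iff[of t] by (simp add: answer_def c_def)
      next
        case False
        have "search m ?X \<longleftrightarrow> (\<exists>Y\<subseteq>set (tris n Es). packs Y \<and> xt ?X \<le> card Y)"
          by (rule search_correct[OF _ frame[OF cD] g h m]) (use class_system_loc in \<open>simp add: X\<close>)
        moreover have "\<exists>Y\<subseteq>set (tris n Es). packs Y \<and> min (nat t) (Suc n) \<le> card Y" if "t = 0"
          using that by (intro exI[of _ "{}"]) (simp add: packs_def)
        ultimately show ?thesis
          using False packing_iff[of t] unfolding answer_def X by (auto simp: c_def)
      qed
      obtain k where k: "eval [enc c] A (enc (answer g h m c)) k" "k \<le> K1 + (if fst (fst (snd (snd c))) then sz True else
        (fst c + 3) * K + sz (cut c) ^ e2 + 2 + sz ?X ^ e1 * cost ?X + 2) + 5"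
        using A[OF cD, of "[]"] unfolding runs_def by blast
      have cost1: "1 \<le> cost ?X"
      proof -
        have "0 < cost ?X" unfolding cost_def
          using label_count_ge[of 0 "length (xI ?X)" "xr ?X"]
          by (intro mult_pos_pos zero_less_power binsum_pos) (auto simp: length_choices)
        then show ?thesis by linarith
      qed
      have "sz (cut c) \<le> q n" unfolding cut q_def by (rule sz_input) simp
      then have 1: "sz (cut c) ^ e2 \<le> q n ^ e2" "sz ?X ^ e1 \<le> (q n ^ e3) ^ e1"
        using le_trans[OF e3[of "cut c"] power_mono[of "sz (cut c)" "q n" e3]] by (auto intro: power_mono)
      have "k \<le> K1 + (n + 3) * K + q n ^ e2 + 20 + (q n ^ e3) ^ e1 * cost ?X"
      proof -
        have "sz ?X ^ e1 * cost ?X \<le> (q n ^ e3) ^ e1 * cost ?X" by (rule mult_le_mono1[OF 1(2)])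
        moreover have c1: "fst c = n" by (simp add: c_def)
        ultimately show ?thesis
        proof (cases "fst (fst (snd (snd c)))")
          case True
          have "sz True = 4" by simp
          then show ?thesis using k(2) unfolding if_P[OF True] by linarith
        next
          case False
          show ?thesis
            using k(2) 1(1) \<open>sz ?X ^ e1 * cost ?X \<le> (q n ^ e3) ^ e1 * cost ?X\<close>
            unfolding if_not_P[OF False] c1 by linarith
        qed
      qed
      also have "\<dots> \<le> (K1 + (n + 3) * K + q n ^ e2 + (q n ^ e3) ^ e1 + 20) * cost ?X"
        using mult_le_mono2[OF cost1, of "K1 + (n + 3) * K + q n ^ e2 + 20"] by (simp add: algebra_simps)
      also have "\<dots> \<le> (2 * n + 2) ^ e * cost ?X" by (rule mult_le_mono1[OF e])
      finally have "k \<le> (2 * n + 2) ^ e * cost ?X" .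
      moreover have "length (xI ?X) \<le> (card Q + 1) ^ (\<delta> + 3)"
        unfolding X using class_system_loc.card_Is[OF class_system_loc] len by simp
      moreover have "eval [enc_list [enc_nat n, enc_natss Es, enc_int t, enc_nats Qs]] A (enc_bool (has_triangle_packing {..<n} E t)) k"
        using k(1) unfolding ans unfolding c_def enc_raw enc_bool' .
      ultimately show "\<exists>k N r. r = card Q div g + 1 \<and> N \<le> (card Q + 1) ^ (\<delta> + 3) \<and>
        eval [enc_list [enc_nat n, enc_natss Es, enc_int t, enc_nats Qs]] A (enc_bool (has_triangle_packing {..<n} E t)) k \<and>
        k \<le> (2 * n + 2) ^ e * (label_count r N ^ (a1 + 1) * ((length (choices m) ^ r) ^ (a2 + 1) *
          (binsum (card Q) (card Q div h) ^ (a3 + 1) * (ot (card Q + r + r) + 1))))"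
        unfolding cost_def X(3,6,7) len by blast
    qed
  qed
qed

section \<open>Running time\<close>

text \<open>With \<open>y = p + 1\<close>, the logarithm of the left-hand side is at most of order
  \<open>(ln y)^2\<close>, because \<open>l\<close> is logarithmic in \<open>y\<close>. The estimate
  \<open>ln y \<le> 4 * s\<close> for the fourth root \<open>s\<close> of \<open>y\<close> turns
  this into a multiple of the square root of \<open>y\<close>, which is small compared with
  \<open>c * y\<close>.\<close>

lemma quasipolynomial_le_exponential:
  fixes \<rho> :: real
  assumes \<rho>: "1 < \<rho>"
  obtains C where "\<forall>p l r. r \<le> p + 1 \<longrightarrow> l = 0 \<or> 2 ^ (l - 1) < (p + 1) ^ \<mu> \<longrightarrow> real (r ^ l) ^ a \<le> C * \<rho> ^ p"
proof (intro that allI impI)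
  define B where "B = 4 * real a * (1 + 8 * real \<mu>)"
  define c where "c = ln \<rho>"
  have c: "0 < c" using \<rho> by (simp add: c_def)
  fix p l r :: nat
  assume r: "r \<le> p + 1" and l: "l = 0 \<or> 2 ^ (l - 1) < (p + 1) ^ \<mu>"
  define y where "y = real (p + 1)"
  define s where "s = sqrt (sqrt y)"
  have y: "1 \<le> y" by (simp add: y_def)
  have s: "1 \<le> s" using y by (simp add: s_def)
  have "s\<^sup>2 = sqrt y" "(sqrt y)\<^sup>2 = y" using y by (simp_all add: s_def)
  then have s4: "y = s ^ 4" by (metis numeral_Bit0 mult_2 power_even_eq power2_eq_square power_add)
  have "ln y = 4 * ln s" using s by (simp add: s4 ln_realpow)
  also have "\<dots> \<le> 4 * s" using ln_le_minus_one[of s] s by simp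
  finally have lny: "ln y \<le> 4 * s" .
  have lny0: "0 \<le> ln y" using y by simp
  have "real l \<le> 1 + 2 * real \<mu> * ln y"
  proof (cases "l = 0")
    case True
    then show ?thesis using lny0 by simp
  next
    case False
    then have "real (2 ^ (l - 1)) \<le> real ((p + 1) ^ \<mu>)" using l by (intro of_nat_mono) simp
    then have "ln (2 ^ (l - 1)) \<le> ln (y ^ \<mu>)" using y by (subst ln_le_cancel_iff) (simp_all add: y_def)
    then have "real (l - 1) * ln 2 \<le> real \<mu> * ln y" using y by (simp add: ln_realpow)
    moreover have ln2: "1 / 2 \<le> ln (2::real)" using ln_le_minus_one[of "1 / 2 :: real"] by (simp add: ln_div)
    have "real (l - 1) * (1 / 2) \<le> real (l - 1) * ln 2"
      using ln2 by (intro mult_left_mono) simp_all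
    ultimately show ?thesis using False by simp
  qed
  also have "\<dots> \<le> s + 8 * real \<mu> * s"
    using s mult_left_mono[OF lny, of "real \<mu>"] by (simp add: mult_ac)
  finally have ls: "real l \<le> (1 + 8 * real \<mu>) * s" by (simp add: algebra_simps)
  have "real (r ^ l) ^ a = real r ^ (l * a)" by (simp add: power_mult)
  also have "\<dots> \<le> y ^ (l * a)" using r by (intro power_mono) (auto simp: y_def)
  also have "\<dots> = exp (real (l * a) * ln y)" using y by (subst exp_of_nat_mult) simp
  also have "real (l * a) * ln y = real a * (real l * ln y)" by simp
  also have "exp (real a * (real l * ln y)) \<le> exp (B * s\<^sup>2)"
  proof -
    have "real l * ln y \<le> (1 + 8 * real \<mu>) * s * (4 * s)"
      using ls lny lny0 s by (intro mult_mono) auto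
    then have "real a * (real l * ln y) \<le> real a * ((1 + 8 * real \<mu>) * s * (4 * s))" by (rule mult_left_mono) simp
    then show ?thesis by (simp add: B_def power2_eq_square algebra_simps)
  qed
  also have "\<dots> \<le> exp (c * y + B\<^sup>2 / (4 * c))"
  proof -
    \<comment> \<open>Completing the square absorbs the square root of \<open>y\<close> into
      \<open>c * y\<close> at the price of an additive constant.\<close>
    have "0 \<le> (2 * c * s\<^sup>2 - B)\<^sup>2 / (4 * c)" using c by simp
    also have "\<dots> = c * y + B\<^sup>2 / (4 * c) - B * s\<^sup>2"
      using c by (simp add: s4 field_simps power2_eq_square power4_eq_xxxx)
    finally show ?thesis by simp
  qed
  also have "\<dots> = exp (c + B\<^sup>2 / (4 * c)) * exp (real p * c)"
    by (simp add: y_def algebra_simps flip: exp_add)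
  also have "exp (real p * c) = \<rho> ^ p" using \<rho> by (simp add: c_def exp_of_nat_mult)
  finally show "real (r ^ l) ^ a \<le> exp (c + B\<^sup>2 / (4 * c)) * \<rho> ^ p" .
qed

text \<open>If a subset of size \<open>i\<close> has weight \<open>x ^ i\<close>, all subsets
  together weigh \<open>(1 + x) ^ p\<close>, and each subset that is counted weighs at least
  \<open>x ^ k\<close>.\<close>

lemma binsum_le_weighted:
  fixes x :: real
  assumes "0 < x" "x \<le> 1" "k \<le> p"
  shows "real (binsum p k) \<le> (1 + x) ^ p * (1 / x) ^ k"
proof -
  have "real (binsum p k) * x ^ k = (\<Sum>i\<le>k. real (p choose i) * x ^ k)"
    by (simp add: binsum_def sum_distrib_right)
  also have "\<dots> \<le> (\<Sum>i\<le>k. real (p choose i) * x ^ i)"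
    using assms by (intro sum_mono mult_left_mono power_decreasing) auto
  also have "\<dots> \<le> (\<Sum>i\<le>p. real (p choose i) * x ^ i)"
    using assms by (intro sum_mono2) auto
  also have "\<dots> = (1 + x) ^ p" using binomial_ring[of x 1 p] by (simp add: add.commute)
  finally show ?thesis using assms by (simp add: power_one_over field_simps)
qed

text \<open>\<open>x\<close> is chosen so small that \<open>(1 + x) ^ Suc a\<close> is at most the
  square root of \<open>\<rho>\<close>, and then \<open>h\<close> so large that the factor
  \<open>(1 / x) ^ Suc a\<close>, incurred once for every \<open>h\<close> hub vertices, costs at
  most another square root.\<close>

lemma binsum_le_exponential:
  fixes \<rho> :: real
  assumes \<rho>: "1 < \<rho>"
  obtains h where "0 < h" "\<forall>p. real (binsum p (p div h)) ^ Suc a \<le> \<rho> ^ p"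
proof -
  define w where "w = sqrt \<rho>"
  have w: "1 < w" "w * w = \<rho>" using \<rho> by (auto simp: w_def)
  define u where "u = root (Suc a) w"
  have u: "1 < u" "u ^ Suc a = w" using w by (simp_all add: u_def del: power_Suc)
  define x where "x = min 1 (u - 1)"
  have x: "0 < x" "x \<le> 1" "1 + x \<le> u" using u(1) by (auto simp: x_def)
  obtain h where h: "(1 / x) ^ Suc a < w ^ h" using real_arch_pow[OF w(1)] by blast
  show ?thesis
  proof (intro that allI)
    show "0 < Suc h" by simp
    fix p
    have h': "(1 / x) ^ Suc a \<le> w ^ Suc h"
      using h w(1) power_increasing[of h "Suc h" w] by linarith
    have "real (binsum p (p div Suc h)) ^ Suc a \<le> ((1 + x) ^ p * (1 / x) ^ (p div Suc h)) ^ Suc a"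
      using binsum_le_weighted[OF x(1,2), of "p div Suc h" p] by (intro power_mono) (auto simp del: div_le_dividend simp: div_le_dividend)
    also have "\<dots> = ((1 + x) ^ Suc a) ^ p * ((1 / x) ^ Suc a) ^ (p div Suc h)"
      by (simp add: power_mult_distrib mult.commute del: power_Suc flip: power_mult)
    also have "\<dots> \<le> w ^ p * (w ^ Suc h) ^ (p div Suc h)"
      using x u h' w(1) power_mono[OF x(3), of "Suc a"] by (intro mult_mono power_mono) (simp_all del: power_Suc)
    also have "\<dots> \<le> w ^ p * w ^ p"
      using w(1) unfolding power_mult[symmetric]
      by (intro mult_left_mono power_increasing) (simp_all add: times_div_less_eq_dividend del: mult_Suc)
    also have "\<dots> = \<rho> ^ p" using w(2) by (simp flip: power_mult_distrib)
    finally show "real (binsum p (p div Suc h)) ^ Suc a \<le> \<rho> ^ p" .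
  qed
qed

lemma polynomial_le_exponential:
  fixes \<rho> :: real
  assumes \<rho>: "1 < \<rho>"
  obtains g where "0 < g" "K * real (g + 1) ^ N \<le> \<rho> ^ g"
proof -
  define w where "w = sqrt \<rho>"
  have w: "1 < w" "w * w = \<rho>" using \<rho> by (auto simp: w_def)
  obtain C where C: "\<forall>p l r. r \<le> p + 1 \<longrightarrow> l = 0 \<or> 2 ^ (l - 1) < (p + 1) ^ N \<longrightarrow> real (r ^ l) ^ 1 \<le> C * w ^ p"
    by (rule quasipolynomial_le_exponential[OF w(1), where a = 1 and \<mu> = N])
  obtain g0 where "\<bar>K\<bar> * \<bar>C\<bar> < w ^ g0" using real_arch_pow[OF w(1)] by blast
  then have g0: "\<bar>K\<bar> * \<bar>C\<bar> \<le> w ^ Suc g0" using w(1) power_increasing[of g0 "Suc g0" w] by linarith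
  define g where "g = Suc g0"
  \<comment> \<open>Side condition for reading the polynomial \<open>(g + 1) ^ N\<close> as the
    quasi-polynomial bound with \<open>l = N\<close> and \<open>\<mu> = N\<close>.\<close>
  have "(2::nat) ^ (N - 1) < (g + 1) ^ N" if "N \<noteq> 0"
  proof -
    have "(2::nat) ^ (N - 1) < 2 ^ N" using that by simp
    also have "\<dots> \<le> (g + 1) ^ N" by (rule power_mono) (simp_all add: g_def)
    finally show ?thesis .
  qed
  then have "real (g + 1) ^ N \<le> C * w ^ g" using C[rule_format, of "g + 1" g N] by auto
  also have "\<dots> \<le> \<bar>C\<bar> * w ^ g" using w(1) by (intro mult_right_mono) auto
  finally have "\<bar>K\<bar> * real (g + 1) ^ N \<le> \<bar>K\<bar> * (\<bar>C\<bar> * w ^ g)" by (intro mult_left_mono) auto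
  also have "\<dots> \<le> w ^ g * w ^ g" using g0 w(1) by (simp add: g_def mult_right_mono flip: mult.assoc del: power_Suc)
  also have "\<dots> = \<rho> ^ g" using w(2) by (simp flip: power_mult_distrib)
  finally have "\<bar>K\<bar> * real (g + 1) ^ N \<le> \<rho> ^ g" .
  moreover have "K * real (g + 1) ^ N \<le> \<bar>K\<bar> * real (g + 1) ^ N" by (intro mult_right_mono) auto
  ultimately have "K * real (g + 1) ^ N \<le> \<rho> ^ g" by linarith
  moreover have "0 < g" by (simp add: g_def)
  ultimately show ?thesis by (intro that)
qed

section \<open>Choice of the constants and the final estimate\<close>

lemma eval_pos: "eval env e v k \<Longrightarrow> 0 < k"
  by (induction rule: eval.induct) auto

text \<open>The negated hypothesis says nothing about the signs of its constants. Every run takes at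
  least one step, so the empty universe forces \<open>1 \<le> C\<close> and a universe with one
  element forces \<open>0 < b\<close>.\<close>

lemma set_cover_time_pos:
  assumes A: "solves_set_cover d A (\<lambda>m. b ^ m * (C * (real m + 1) ^ c))" and d: "1 \<le> d"
  shows "1 \<le> C" "0 < b"
proof -
  have "set_cover_instance d {..<0::nat} {}" "lists_family [] ({} :: nat set set)"
    by (simp_all add: set_cover_instance_def lists_family_def lists_set_def)
  then have "\<exists>x y. decides_within A x y (b ^ 0 * (C * (real 0 + 1) ^ c))"
    using A unfolding solves_set_cover_def by blast
  then obtain k env v where "eval env A v k" "real k \<le> C" by (auto simp: decides_within_def)
  then show C: "1 \<le> C" using eval_pos[of env A v k] by linarith
  have "set_cover_instance d {..<1::nat} {{0}}" "lists_family [[0::nat]] {{0}}"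
    using d by (auto simp: set_cover_instance_def lists_family_def lists_set_def)
  then have "\<exists>x y. decides_within A x y (b ^ 1 * (C * (real 1 + 1) ^ c))"
    using A unfolding solves_set_cover_def by blast
  then obtain k' env' v' where k': "eval env' A v' k'" "real k' \<le> b * (C * 2 ^ c)" by (auto simp: decides_within_def)
  then have "0 < b * (C * 2 ^ c)" using eval_pos[OF k'(1)] by linarith
  moreover have "0 < C * 2 ^ c" using C by simp
  ultimately show "0 < b" by (rule zero_less_mult_pos2)
qed

text \<open>A factor \<open>K\<close> for each group of \<open>g\<close> hub vertices costs at most
  \<open>\<rho> ^ p\<close> altogether; the one additional bucket contributes the constant
  \<open>K\<close>.\<close>

lemma block_factor_le:
  fixes \<rho> :: real
  assumes "1 < \<rho>" "0 < g" "0 \<le> K" "K \<le> \<rho> ^ g"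
  shows "K ^ (p div g + 1) \<le> K * \<rho> ^ p"
proof -
  have "K ^ (p div g) \<le> (\<rho> ^ g) ^ (p div g)" using assms by (intro power_mono)
  also have "\<dots> \<le> \<rho> ^ p"
    using assms(1) unfolding power_mult[symmetric] by (intro power_increasing) (simp_all add: times_div_less_eq_dividend)
  finally show ?thesis using assms(3) by (simp add: mult_left_mono)
qed

theorem theorem9p4:
  assumes "\<not> SCC"
  shows "\<exists>\<epsilon>::real > 0. \<forall>\<sigma> \<ge> 1. \<forall>\<delta> \<ge> 1. \<exists>A (C::real) (c::nat).
    solves_triangle_packing_hub \<sigma> \<delta> A (\<lambda>n p. (2 - \<epsilon>) ^ p * (C * (real n + 1) ^ c))"
proof -
  obtain \<epsilon> :: real where \<epsilon>: "0 < \<epsilon>"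
    and scc: "\<And>d. 1 \<le> d \<Longrightarrow> \<exists>A C c. solves_set_cover d A (\<lambda>m. (2 - \<epsilon>) ^ m * (C * (real m + 1) ^ c))"
    using assms unfolding SCC_def by blast
  obtain A1 C1 c1 where "solves_set_cover 1 A1 (\<lambda>m. (2 - \<epsilon>) ^ m * (C1 * (real m + 1) ^ c1))"
    using scc[of 1] by auto
  from set_cover_time_pos(2)[OF this] have \<epsilon>2: "0 < 2 - \<epsilon>" by simp
  \<comment> \<open>The maximum makes powers of the base monotone in the exponent, also if
    \<open>\<epsilon>\<close> exceeds 1.\<close>
  define b where "b = max 1 (2 - \<epsilon>)"
  have b: "1 \<le> b" "b < 2" "2 - \<epsilon> \<le> b" using \<epsilon> by (auto simp: b_def)
  \<comment> \<open>Three factors \<open>\<rho> ^ p\<close> arise: from the labellings, from guesses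
    and tokens together, and from the tail. The cube root makes \<open>\<rho> ^ 3 * b\<close> the
    midpoint between \<open>b\<close> and 2.\<close>
  define \<rho> where "\<rho> = root 3 ((b + 2) / 2 / b)"
  have \<rho>: "1 < \<rho>" using b by (simp add: \<rho>_def)
  have \<rho>3: "\<rho> ^ 3 * b = 2 - (2 - b) / 2" using b by (simp add: \<rho>_def field_simps)
  obtain a1 a2 a3 where alg: "\<forall>\<sigma> \<delta> g h m ot. 0 < g \<longrightarrow> 0 < h \<longrightarrow> m = 9 * h * (\<delta> + 3 + g) \<longrightarrow>
    computes (sc_queries (m + 2)) sc_answer (\<lambda>z. ot (fst z)) \<longrightarrow>
    (\<exists>A e. \<forall>n E t Q Es Qs. hub_instance \<sigma> \<delta> n E Q Es Qs \<longrightarrow>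
      (\<exists>k N r. r = card Q div g + 1 \<and> N \<le> (card Q + 1) ^ (\<delta> + 3) \<and>
        eval [enc_list [enc_nat n, enc_natss Es, enc_int t, enc_nats Qs]] A (enc_bool (has_triangle_packing {..<n} E t)) k \<and>
        k \<le> (2 * n + 2) ^ e * (label_count r N ^ (a1 + 1) * ((length (choices m) ^ r) ^ (a2 + 1) *
          (binsum (card Q) (card Q div h) ^ (a3 + 1) * (ot (card Q + r + r) + 1))))))"
    using main_algorithm by (elim exE)
  obtain h where h: "0 < h" "\<forall>p. real (binsum p (p div h)) ^ Suc a3 \<le> \<rho> ^ p"
    by (rule binsum_le_exponential[OF \<rho>, where a = a3])
  show ?thesis
  proof (intro exI[of _ "(2 - b) / 2"] conjI allI impI)
    show "0 < (2 - b) / 2" using b by simp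
    fix \<sigma> \<delta> :: nat
    obtain Cl where Cl: "\<forall>p l r. r \<le> p + 1 \<longrightarrow> l = 0 \<or> 2 ^ (l - 1) < (p + 1) ^ (\<delta> + 3) \<longrightarrow>
      real (r ^ l) ^ (a1 + 1) \<le> Cl * \<rho> ^ p"
      by (rule quasipolynomial_le_exponential[OF \<rho>, where a = "a1 + 1" and \<mu> = "\<delta> + 3"])
    \<comment> \<open>Since \<open>m\<close> is linear in \<open>g\<close>, the cost of one bucket
      is polynomial in \<open>g\<close>, whereas \<open>\<rho> ^ g\<close> is exponential.
      \<open>h\<close> and \<open>\<delta>\<close> are already fixed here.\<close>
    obtain g where g: "0 < g" "real (4 * (2 * (9 * h * (\<delta> + 4) + 1)\<^sup>2) ^ (a2 + 1)) * real (g + 1) ^ (2 * (a2 + 1)) \<le> \<rho> ^ g"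
      by (rule polynomial_le_exponential[OF \<rho>,
            where K = "real (4 * (2 * (9 * h * (\<delta> + 4) + 1)\<^sup>2) ^ (a2 + 1))" and N = "2 * (a2 + 1)"])
    define m where "m = 9 * h * (\<delta> + 3 + g)"
    \<comment> \<open>The cost of one bucket: the number \<open>2 * (m + 1)\<^sup>2\<close> of its
      guesses to the power with which it enters the running time, times 4 for its two
      tokens.\<close>
    define K where "K = 4 * (2 * (m + 1)\<^sup>2) ^ (a2 + 1)"
    have "m + 1 \<le> (9 * h * (\<delta> + 4) + 1) * (g + 1)" by (simp add: m_def algebra_simps)
    then have "K \<le> 4 * (2 * ((9 * h * (\<delta> + 4) + 1) * (g + 1))\<^sup>2) ^ (a2 + 1)"
      unfolding K_def by (intro mult_le_mono2 power_mono) simp_all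
    also have "\<dots> = 4 * (2 * (9 * h * (\<delta> + 4) + 1)\<^sup>2) ^ (a2 + 1) * (g + 1) ^ (2 * (a2 + 1))"
      by (simp only: power_mult_distrib power_mult mult.assoc)
    finally have "real K \<le> real (4 * (2 * (9 * h * (\<delta> + 4) + 1)\<^sup>2) ^ (a2 + 1) * (g + 1) ^ (2 * (a2 + 1)))"
      by (rule of_nat_mono)
    then have K: "real K \<le> \<rho> ^ g" using g(2) unfolding of_nat_mult[of _ "(g + 1) ^ (2 * (a2 + 1))"] of_nat_power[of "g + 1"] by linarith
    obtain A0 C c where A0: "solves_set_cover (m + 2) A0 (\<lambda>m. (2 - \<epsilon>) ^ m * (C * (real m + 1) ^ c))"
      using scc[of "m + 2"] by auto
    have C: "1 \<le> C" by (rule set_cover_time_pos(1)[OF A0]) simp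
    define ot where "ot = (\<lambda>m. nat \<lfloor>(2 - \<epsilon>) ^ m * (C * (real m + 1) ^ c)\<rfloor>)"
    have "computes (sc_queries (m + 2)) sc_answer (\<lambda>z. ot (fst z))"
      using oracle_computes[OF A0] by (simp add: ot_def)
    from alg[rule_format, OF g(1) h(1) m_def this, of \<sigma>] obtain A e where A: "\<forall>n E t Q Es Qs. hub_instance \<sigma> \<delta> n E Q Es Qs \<longrightarrow>
      (\<exists>k N r. r = card Q div g + 1 \<and> N \<le> (card Q + 1) ^ (\<delta> + 3) \<and>
        eval [enc_list [enc_nat n, enc_natss Es, enc_int t, enc_nats Qs]] A (enc_bool (has_triangle_packing {..<n} E t)) k \<and>
        k \<le> (2 * n + 2) ^ e * (label_count r N ^ (a1 + 1) * ((length (choices m) ^ r) ^ (a2 + 1) *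
          (binsum (card Q) (card Q div h) ^ (a3 + 1) * (ot (card Q + r + r) + 1)))))"
      by (elim exE)
    have ot: "real (ot (p + r + r) + 1) \<le> b ^ p * 4 ^ r * (2 * C * 3 ^ c * (real n + 1) ^ c)"
      if "p \<le> n" "r \<le> p + 1" for p r n
    proof -
      have "0 \<le> (2 - \<epsilon>) ^ (p + r + r) * (C * (real (p + r + r) + 1) ^ c)" using \<epsilon>2 C by simp
      then have "real (ot (p + r + r)) \<le> (2 - \<epsilon>) ^ (p + r + r) * (C * (real (p + r + r) + 1) ^ c)"
        unfolding ot_def by (simp add: of_nat_nat)
      also have "\<dots> \<le> b ^ (p + r + r) * (C * (3 * (real n + 1)) ^ c)"
        using \<epsilon>2 C b that by (intro mult_mono power_mono) auto
      finally have 1: "real (ot (p + r + r) + 1) \<le> b ^ (p + r + r) * (C * (3 * (real n + 1)) ^ c) + 1" by simp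
      have "1 * (1 * 1) \<le> b ^ (p + r + r) * (C * (3 * (real n + 1)) ^ c)"
        using b C by (intro mult_mono one_le_power) auto
      then have "real (ot (p + r + r) + 1) \<le> 2 * (b ^ (p + r + r) * (C * (3 * (real n + 1)) ^ c))" using 1 by simp
      also have "\<dots> = b ^ p * (b * b) ^ r * (2 * C * 3 ^ c * (real n + 1) ^ c)"
        by (simp only: power_add power_mult_distrib mult_ac)
      also have "\<dots> \<le> b ^ p * 4 ^ r * (2 * C * 3 ^ c * (real n + 1) ^ c)"
        using b C mult_mono[of b 2 b 2] by (intro mult_right_mono mult_left_mono power_mono) auto
      finally show ?thesis .
    qed
    define CC where "CC = 2 ^ e * Cl * real K * (2 * C * 3 ^ c)"
    show "\<exists>A C c. solves_triangle_packing_hub \<sigma> \<delta> A (\<lambda>n p. (2 - (2 - b) / 2) ^ p * (C * (real n + 1) ^ c))"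
    proof (rule exI[of _ A], rule exI[of _ CC], rule exI[of _ "e + c"], unfold solves_triangle_packing_hub_def, intro allI impI)
      fix n :: nat and E t Q Es Qs
      assume "simple_graph {..<n} E" "hub \<sigma> \<delta> {..<n} E Q" "lists_family Es E" "lists_set Qs Q"
      then have hi: "hub_instance \<sigma> \<delta> n E Q Es Qs" by unfold_locales
      define p where "p = card Q"
      have p: "p \<le> n" unfolding p_def using card_mono[OF _ hub_instance.Q_subset[OF hi]] by simp
      obtain k N r where r: "r = p div g + 1" and N: "N \<le> (p + 1) ^ (\<delta> + 3)"
        and k: "eval [enc_list [enc_nat n, enc_natss Es, enc_int t, enc_nats Qs]] A (enc_bool (has_triangle_packing {..<n} E t)) k"
        "k \<le> (2 * n + 2) ^ e * (label_count r N ^ (a1 + 1) * ((length (choices m) ^ r) ^ (a2 + 1) *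
          (binsum p (p div h) ^ (a3 + 1) * (ot (p + r + r) + 1))))"
        using A[rule_format, OF hi, of t, folded p_def] by (elim exE conjE) (rule that)
      have rp: "r \<le> p + 1" by (simp add: r)
      obtain l where l: "label_count r N = r ^ l" "l = 0 \<or> 2 ^ (l - 1) < N" using label_count_mem by blast
      have 1: "real (label_count r N) ^ (a1 + 1) \<le> Cl * \<rho> ^ p"
        unfolding l(1) by (rule Cl[rule_format, OF rp]) (use l(2) N in linarith)
      have 2: "real (binsum p (p div h)) ^ (a3 + 1) \<le> \<rho> ^ p" using h(2)[rule_format, of p] by simp
      have "(length (choices m) ^ r) ^ (a2 + 1) = (length (choices m) ^ (a2 + 1)) ^ r"
        by (simp only: mult.commute flip: power_mult)
      then have "real ((length (choices m) ^ r) ^ (a2 + 1)) * 4 ^ r = real K ^ r"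
        unfolding K_def length_choices
        by (simp only: of_nat_mult of_nat_power of_nat_numeral power_mult_distrib mult.commute)
      also have "\<dots> \<le> real K * \<rho> ^ p" unfolding r by (rule block_factor_le[OF \<rho> g(1) _ K]) simp
      finally have 3: "real ((length (choices m) ^ r) ^ (a2 + 1)) * 4 ^ r \<le> real K * \<rho> ^ p" .
      let ?L = "real (label_count r N) ^ (a1 + 1)" and ?G = "real ((length (choices m) ^ r) ^ (a2 + 1))"
        and ?B = "real (binsum p (p div h)) ^ (a3 + 1)"
      have "real k \<le> real ((2 * n + 2) ^ e * (label_count r N ^ (a1 + 1) * ((length (choices m) ^ r) ^ (a2 + 1) *
          (binsum p (p div h) ^ (a3 + 1) * (ot (p + r + r) + 1)))))" by (rule of_nat_mono[OF k(2)])
      also have "\<dots> = real ((2 * n + 2) ^ e) * (?L * (?G * (?B * real (ot (p + r + r) + 1))))"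
        by (simp only: of_nat_mult of_nat_power)
      also have "\<dots> \<le> real ((2 * n + 2) ^ e) * (?L * (?G * (?B * (b ^ p * 4 ^ r * (2 * C * 3 ^ c * (real n + 1) ^ c)))))"
        by (intro mult_left_mono ot p rp) auto
      also have "\<dots> = 2 ^ e * (2 * C * 3 ^ c) * b ^ p * (real n + 1) ^ (e + c) * (?L * ((?G * 4 ^ r) * ?B))"
      proof -
        have "real ((2 * n + 2) ^ e) = 2 ^ e * (real n + 1) ^ e" by (simp add: algebra_simps flip: power_mult_distrib)
        then show ?thesis by (simp only: power_add mult_ac)
      qed
      also have "\<dots> \<le> 2 ^ e * (2 * C * 3 ^ c) * b ^ p * (real n + 1) ^ (e + c) * ((Cl * \<rho> ^ p) * ((real K * \<rho> ^ p) * \<rho> ^ p))"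
      proof (rule mult_left_mono)
        have "(?G * 4 ^ r) * ?B \<le> (real K * \<rho> ^ p) * \<rho> ^ p"
          using \<rho> by (intro mult_mono[OF 3 2]) simp_all
        moreover have "0 \<le> Cl * \<rho> ^ p" by (rule order_trans[OF _ 1]) simp
        ultimately show "?L * ((?G * 4 ^ r) * ?B) \<le> (Cl * \<rho> ^ p) * ((real K * \<rho> ^ p) * \<rho> ^ p)"
          by (intro mult_mono[OF 1]) simp_all
      qed (use C b in simp)
      also have "\<dots> = (\<rho> ^ 3 * b) ^ p * (CC * (real n + 1) ^ (e + c))"
        unfolding CC_def power_mult_distrib power3_eq_cube by (simp only: mult_ac)
      finally show "decides_within A (enc_list [enc_nat n, enc_natss Es, enc_int t, enc_nats Qs])
          (has_triangle_packing {..<n} E t) ((2 - (2 - b) / 2) ^ card Q * (CC * (real n + 1) ^ (e + c)))"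
        using k(1) unfolding decides_within_def \<rho>3 p_def by blast
    qed
  qed
qed

end
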